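(* Let $X$ be a separable Lorentzian pre-length space satisfying one of the following three conditions. (i) $X$ is a first-countable BMS-Lorentzian length space with compact causal diamonds, empty bubbling boundary, empty spacelike boundary, and timelike extensions. (ii) $X$ is a globally hyperbolic BM-length metric spacetime. (iii) $X$ is a globally hyperbolic KS-Lorentzian length space. If all strong Cauchy sets in $X$ are compact, then $(\mathcal{C}^s_X,d_J)$ is a metric space. If $X$ is timelike path-connected and all Cauchy sets in $X$ are compact, then $(\mathcal{C}_X,d_J)$ is a metric space. If $X$ is timelike path-connected, through every point of $X$ there exists a Cauchy complete timelike curve, and all weak Cauchy sets in $X$ are compact, then $(\mathcal{C}^w_X,d_J)$ is a metric space.
   Context: Lorentzian pre-length spaces. An extended time separation function on a set $X$ is a map $\ell:X\times X\to\{-\infty\}\cup[0,\infty]$ with $\ell(x,x)\ge0$ and $\ell(x,y)+\ell(y,z)\le\ell(x,z)$ (convention $-\infty+\infty=-\infty$). Put $d=\max(0,\ell)$; $x\le y$ iff $\ell(x,y)\ge0$; $x\ll y$ iff $d(x,y)>0$; $J^+(x)=\{y:x\le y\}$, $J^-(x)=\{y:y\le x\}$, $I^+(x)=\{y:x\ll y\}$, $I^-(x)=\{y:y\ll x\}$, $J^\pm(K)=\bigcup_{x\in K}J^\pm(x)$. A Lorentzian pre-length space is such a pair with a topology for which all $I^\pm(x)$ are open. Causal: $\le$ is antisymmetric. Globally hyperbolic: causal, $\le$ closed in $X\times X$, and $J^+(K)\cap J^-(K)$ compact for all compact $K$. Causal diamonds are the sets $J^+(x)\cap J^-(y)$. Boundaries: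 $\partial^\pm_{ca}X=\{x:J^\pm(x)=\{x\}\}$, $\partial^\pm_{ch}X=\{x:I^\pm(x)=\emptyset\}$; the bubbling boundary is empty if $\partial^+_{ca}X=\partial^+_{ch}X$ and $\partial^-_{ca}X=\partial^-_{ch}X$; the spacelike boundary is $\partial^+_{ch}X\cap\partial^-_{ch}X$. Curves are continuous maps from (possibly degenerate) intervals $I\subset\mathbb{R}$. A curve $\gamma$ is causal if $t<s$ implies $\gamma(t)\le\gamma(s)$ and $\gamma$ is not constant on any nondegenerate subinterval; timelike if $t<s$ implies $\gamma(t)\ll\gamma(s)$. $X$ is causally (timelike) path-connected if any $x\le y$ ($x\ll y$) can be connected by a causal (timelike) curve. $X$ has timelike extensions if for every $x\notin\partial^+_{ch}X$ (resp. $x\notin\partial^-_{ch}X$) there is a nonconstant timelike curve starting (resp. ending) at $x$. $L(\gamma)=\inf\sum_i d(\gamma(t_i),\gamma(t_{i+1}))$ over partitions of $[a,b]$. $X$ is geodesic if for all $x\le y$ there is a causal curve $\gamma$ from $x$ to $y$ with $L(\gamma)=d(x,y)$. A causal curve $\gamma:I\to X$ is future extendible if there exist an order-preserving homeomorphism $\varphi:I\to\hat I$ onto an interval, an interval $\tilde I\supset\hat I$ containing some $t$ with $t>s$ for all $s\in\hat I$, and a causal curve $\tilde\gamma:\tilde I\to X$ with $\tilde\gamma|_{\hat I}=\gamma\circ\varphi^{-1}$; otherwise future inextendible. Past versions are analogous; inextendible means both. A timelike curve is inextendible if it is so as a causal curve. A timelike curve $\gamma:I\to X$ is Cauchy complete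 if it is inextendible and: if $d(\gamma(t_0),\gamma(\cdot))$ is bounded on $[t_0,\infty)\cap I$ for some $t_0\in I$, then $\sup I\in I$; and if $d(\gamma(\cdot),\gamma(t_0))$ is bounded on $(-\infty,t_0]\cap I$ for some $t_0\in I$, then $\inf I\in I$. $\mathcal{C}_X$ (Cauchy sets), $\mathcal{C}^s_X$ (strong Cauchy sets), $\mathcal{C}^w_X$ (weak Cauchy sets) are the sets of subsets of $X$ that are intersected exactly once by every inextendible timelike curve, every inextendible causal curve, every Cauchy complete timelike curve, respectively. $d_J(A,B)=\sup_{x\in A,y\in B}(d(x,y)+d(y,x))$. A metric space has finite metric. BMS-Lorentzian length spaces. A Lorentzian metric space (Bykov–Minguzzi–Suhr) is a set $X$ with $d:X\times X\to[0,\infty)$ such that (1) $d(x,y)+d(y,z)\le d(x,z)$ whenever $d(x,y),d(y,z)>0$; (2) there is a topology on $X$ for which $d$ is continuous and for all $x,y\in X$, $\varepsilon>0$ the set $\{(x',y'):d(x',y')\ge\varepsilon\}\cap(\overline{I(x,y)}\times\overline{I(x,y)})$ is compact, where $I(x,y)=\{z:d(x,z)>0,\ d(z,y)>0\}$; (3) for all $x\neq y$ there is $z$ with $d(x,z)\ne d(y,z)$ or $d(z,x)\ne d(z,y)$. It is equipped with some topology as in (2) and regarded as a Lorentzian pre-length space with $x\le y$ iff $d(z,x)\le d(z,y)$ and $d(y,z)\le d(x,z)$ for all $z$, and $\ell=d$ where $x\le y$, $\ell=-\infty$ otherwise. A BMS-Lorentzian length space is a geodesic Lorentzian metric space. BM-length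 metric spacetimes. A first-countable, causal Lorentzian pre-length space such that (1) $\ell$ is upper semicontinuous and $d$ lower semicontinuous; (2) every $x\in X$ equals $\gamma(1/2)$ for some timelike curve $\gamma:[0,1]\to X$; (3) for $x\ll y$, $d(x,y)$ is the supremum of the lengths of (injective) causal curves from $x$ to $y$. KS-Lorentzian length spaces. A KS-Lorentzian pre-length space is a Lorentzian pre-length space with a metric $\rho$ inducing its topology such that $d$ is lower semicontinuous; here all curves, and all notions defined via curves, are in terms of curves locally Lipschitz with respect to $\rho$. It is a KS-Lorentzian length space if: (1) every point has a neighborhood $U$ such that $p_n,q_n\in U$, $p_n\le q_n$, $p_n\to p\in\overline U$, $q_n\to q\in\overline U$ imply $p\le q$; (2) it is causally and timelike path-connected; (3) every $x$ has an open neighborhood $\Omega_x$ such that (a) for some $C>0$ all causal curves in $\Omega_x$ have $\rho$-arclength at most $C$, (b) $I^\pm(y)\cap\Omega_x\ne\emptyset$ for all $y\in\Omega_x$, and there is a continuous $\omega_x:\Omega_x\times\Omega_x\to[0,\infty)$ making $\Omega_x$ with the restrictions of $\rho,\ll,\le$ a KS-Lorentzian pre-length space with Lorentzian distance $\omega_x$, (c) for all $p\le q$, $p\ne q$ in $\Omega_x$ there is a causal curve $\gamma_{p,q}$ in $\Omega_x$ from $p$ to $q$ of maximal length among causal curves from $p$ to $q$ in $\Omega_x$, with $L(\gamma_{p,q})=\omega_x(p,q)\le d(p,q)$; (4) for $x\ll y$, $d(x,y)$ is the supremum of the lengths of causal curves from $x$ to $y$. *)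

theory Defs
  imports "HOL-Analysis.Analysis"
begin

section \<open>Lorentzian pre-length spaces\<close>

text \<open>
  A space is given by a topology \<open>T\<close>, whose underlying set \<open>X\<close> is \<^term>\<open>topspace T\<close>, and an
  extended time separation function \<open>l\<close>. Values of \<open>l\<close> outside \<open>X\<close> are irrelevant.
\<close>

definition causal_le :: "('a \<Rightarrow> 'a \<Rightarrow> ereal) \<Rightarrow> 'a \<Rightarrow> 'a \<Rightarrow> bool" where
  "causal_le l x y \<longleftrightarrow> 0 \<le> l x y"

definition time_sep :: "('a \<Rightarrow> 'a \<Rightarrow> ereal) \<Rightarrow> 'a \<Rightarrow> 'a \<Rightarrow> ennreal" where
  "time_sep l x y = e2ennreal (max 0 (l x y))"

definition chron_less :: "('a \<Rightarrow> 'a \<Rightarrow> ereal) \<Rightarrow> 'a \<Rightarrow> 'a \<Rightarrow> bool" where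
  "chron_less l x y \<longleftrightarrow> 0 < time_sep l x y"

definition causal_future :: "'a topology \<Rightarrow> ('a \<Rightarrow> 'a \<Rightarrow> ereal) \<Rightarrow> 'a \<Rightarrow> 'a set" where
  "causal_future T l x = {y \<in> topspace T. causal_le l x y}"

definition causal_past :: "'a topology \<Rightarrow> ('a \<Rightarrow> 'a \<Rightarrow> ereal) \<Rightarrow> 'a \<Rightarrow> 'a set" where
  "causal_past T l x = {y \<in> topspace T. causal_le l y x}"

definition chron_future :: "'a topology \<Rightarrow> ('a \<Rightarrow> 'a \<Rightarrow> ereal) \<Rightarrow> 'a \<Rightarrow> 'a set" where
  "chron_future T l x = {y \<in> topspace T. chron_less l x y}"

definition chron_past :: "'a topology \<Rightarrow> ('a \<Rightarrow> 'a \<Rightarrow> ereal) \<Rightarrow> 'a \<Rightarrow> 'a set" where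
  "chron_past T l x = {y \<in> topspace T. chron_less l y x}"

text \<open>
  With the convention \<open>-\<infinity> + \<infinity> = -\<infinity>\<close> the reverse triangle inequality is void as soon as one
  summand is \<open>-\<infinity>\<close>. Since \<^typ>\<open>ereal\<close> addition has the opposite convention, these cases are
  excluded by the premises \<open>x \<le> y\<close> and \<open>y \<le> z\<close>.
\<close>

definition lorentzian_pre_length_space :: "'a topology \<Rightarrow> ('a \<Rightarrow> 'a \<Rightarrow> ereal) \<Rightarrow> bool" where
  "lorentzian_pre_length_space T l \<longleftrightarrow>
     (\<forall>x\<in>topspace T. \<forall>y\<in>topspace T. l x y = -\<infinity> \<or> 0 \<le> l x y) \<and>
     (\<forall>x\<in>topspace T. 0 \<le> l x x) \<and>
     (\<forall>x\<in>topspace T. \<forall>y\<in>topspace T. \<forall>z\<in>topspace T.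
        causal_le l x y \<longrightarrow> causal_le l y z \<longrightarrow> l x y + l y z \<le> l x z) \<and>
     (\<forall>x\<in>topspace T. openin T (chron_future T l x) \<and> openin T (chron_past T l x))"

definition causal_space :: "'a topology \<Rightarrow> ('a \<Rightarrow> 'a \<Rightarrow> ereal) \<Rightarrow> bool" where
  "causal_space T l \<longleftrightarrow>
     (\<forall>x\<in>topspace T. \<forall>y\<in>topspace T. causal_le l x y \<longrightarrow> causal_le l y x \<longrightarrow> x = y)"

definition globally_hyperbolic :: "'a topology \<Rightarrow> ('a \<Rightarrow> 'a \<Rightarrow> ereal) \<Rightarrow> bool" where
  "globally_hyperbolic T l \<longleftrightarrow>
     causal_space T l \<and>
     closedin (prod_topology T T) {(x, y). x \<in> topspace T \<and> y \<in> topspace T \<and> causal_le l x y} \<and>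
     (\<forall>K. compactin T K \<longrightarrow>
        compactin T ((\<Union>x\<in>K. causal_future T l x) \<inter> (\<Union>x\<in>K. causal_past T l x)))"

definition compact_causal_diamonds :: "'a topology \<Rightarrow> ('a \<Rightarrow> 'a \<Rightarrow> ereal) \<Rightarrow> bool" where
  "compact_causal_diamonds T l \<longleftrightarrow>
     (\<forall>x\<in>topspace T. \<forall>y\<in>topspace T. compactin T (causal_future T l x \<inter> causal_past T l y))"

definition future_causal_boundary :: "'a topology \<Rightarrow> ('a \<Rightarrow> 'a \<Rightarrow> ereal) \<Rightarrow> 'a set" where
  "future_causal_boundary T l = {x \<in> topspace T. causal_future T l x = {x}}"

definition past_causal_boundary :: "'a topology \<Rightarrow> ('a \<Rightarrow> 'a \<Rightarrow> ereal) \<Rightarrow> 'a set" where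
  "past_causal_boundary T l = {x \<in> topspace T. causal_past T l x = {x}}"

definition future_chron_boundary :: "'a topology \<Rightarrow> ('a \<Rightarrow> 'a \<Rightarrow> ereal) \<Rightarrow> 'a set" where
  "future_chron_boundary T l = {x \<in> topspace T. chron_future T l x = {}}"

definition past_chron_boundary :: "'a topology \<Rightarrow> ('a \<Rightarrow> 'a \<Rightarrow> ereal) \<Rightarrow> 'a set" where
  "past_chron_boundary T l = {x \<in> topspace T. chron_past T l x = {}}"

definition empty_bubbling_boundary :: "'a topology \<Rightarrow> ('a \<Rightarrow> 'a \<Rightarrow> ereal) \<Rightarrow> bool" where
  "empty_bubbling_boundary T l \<longleftrightarrow>
     future_causal_boundary T l = future_chron_boundary T l \<and>
     past_causal_boundary T l = past_chron_boundary T l"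

definition spacelike_boundary :: "'a topology \<Rightarrow> ('a \<Rightarrow> 'a \<Rightarrow> ereal) \<Rightarrow> 'a set" where
  "spacelike_boundary T l = future_chron_boundary T l \<inter> past_chron_boundary T l"


section \<open>Curves\<close>

text \<open>
  All notions defined via curves depend on which maps count as curves: continuous ones in general,
  locally Lipschitz ones for Kunzinger-Saemann spaces. They therefore take a predicate \<open>Cv\<close>, where
  \<open>Cv I \<gamma>\<close> says that \<open>\<gamma>\<close> restricted to the interval \<open>I\<close> is a curve. Intervals are nonempty and
  may consist of a single point; values of \<open>\<gamma>\<close> outside \<open>I\<close> are irrelevant.
\<close>

type_synonym 'a curve_class = "real set \<Rightarrow> (real \<Rightarrow> 'a) \<Rightarrow> bool"

definition continuous_curve :: "'a topology \<Rightarrow> 'a curve_class" where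
  "continuous_curve T I \<gamma> \<longleftrightarrow>
     is_interval I \<and> I \<noteq> {} \<and> continuous_map (top_of_set I) T \<gamma>"

definition locally_Lipschitz_curve :: "'a topology \<Rightarrow> ('a \<Rightarrow> 'a \<Rightarrow> real) \<Rightarrow> 'a curve_class" where
  "locally_Lipschitz_curve T \<rho> I \<gamma> \<longleftrightarrow>
     continuous_curve T I \<gamma> \<and>
     (\<forall>t\<in>I. \<exists>e>0. \<exists>K. \<forall>r\<in>I \<inter> ball t e. \<forall>s\<in>I \<inter> ball t e. \<rho> (\<gamma> r) (\<gamma> s) \<le> K * \<bar>r - s\<bar>)"

definition causal_curve ::
  "'a curve_class \<Rightarrow> ('a \<Rightarrow> 'a \<Rightarrow> ereal) \<Rightarrow> real set \<Rightarrow> (real \<Rightarrow> 'a) \<Rightarrow> bool" where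
  "causal_curve Cv l I \<gamma> \<longleftrightarrow>
     Cv I \<gamma> \<and>
     (\<forall>t\<in>I. \<forall>s\<in>I. t < s \<longrightarrow> causal_le l (\<gamma> t) (\<gamma> s)) \<and>
     (\<forall>a\<in>I. \<forall>b\<in>I. a < b \<longrightarrow> \<not> \<gamma> constant_on {a..b})"

definition timelike_curve ::
  "'a curve_class \<Rightarrow> ('a \<Rightarrow> 'a \<Rightarrow> ereal) \<Rightarrow> real set \<Rightarrow> (real \<Rightarrow> 'a) \<Rightarrow> bool" where
  "timelike_curve Cv l I \<gamma> \<longleftrightarrow>
     Cv I \<gamma> \<and> (\<forall>t\<in>I. \<forall>s\<in>I. t < s \<longrightarrow> chron_less l (\<gamma> t) (\<gamma> s))"

definition causally_path_connected ::
  "'a topology \<Rightarrow> 'a curve_class \<Rightarrow> ('a \<Rightarrow> 'a \<Rightarrow> ereal) \<Rightarrow> bool" where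
  "causally_path_connected T Cv l \<longleftrightarrow>
     (\<forall>x\<in>topspace T. \<forall>y\<in>topspace T. causal_le l x y \<longrightarrow>
        (\<exists>a b \<gamma>. a \<le> b \<and> causal_curve Cv l {a..b} \<gamma> \<and> \<gamma> a = x \<and> \<gamma> b = y))"

definition timelike_path_connected ::
  "'a topology \<Rightarrow> 'a curve_class \<Rightarrow> ('a \<Rightarrow> 'a \<Rightarrow> ereal) \<Rightarrow> bool" where
  "timelike_path_connected T Cv l \<longleftrightarrow>
     (\<forall>x\<in>topspace T. \<forall>y\<in>topspace T. chron_less l x y \<longrightarrow>
        (\<exists>a b \<gamma>. a \<le> b \<and> timelike_curve Cv l {a..b} \<gamma> \<and> \<gamma> a = x \<and> \<gamma> b = y))"

definition timelike_extensions ::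
  "'a topology \<Rightarrow> 'a curve_class \<Rightarrow> ('a \<Rightarrow> 'a \<Rightarrow> ereal) \<Rightarrow> bool" where
  "timelike_extensions T Cv l \<longleftrightarrow>
     (\<forall>x \<in> topspace T - future_chron_boundary T l.
        \<exists>I \<gamma> a. timelike_curve Cv l I \<gamma> \<and> \<not> \<gamma> constant_on I \<and>
                a \<in> I \<and> (\<forall>t\<in>I. a \<le> t) \<and> \<gamma> a = x) \<and>
     (\<forall>x \<in> topspace T - past_chron_boundary T l.
        \<exists>I \<gamma> b. timelike_curve Cv l I \<gamma> \<and> \<not> \<gamma> constant_on I \<and>
                b \<in> I \<and> (\<forall>t\<in>I. t \<le> b) \<and> \<gamma> b = x)"

definition curve_length ::
  "('a \<Rightarrow> 'a \<Rightarrow> ereal) \<Rightarrow> real \<Rightarrow> real \<Rightarrow> (real \<Rightarrow> 'a) \<Rightarrow> ennreal" where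
  "curve_length l a b \<gamma> =
     Inf {\<Sum>i<n. time_sep l (\<gamma> (t i)) (\<gamma> (t (Suc i))) | n t.
            t 0 = a \<and> t n = b \<and> (\<forall>i<n. t i < t (Suc i))}"

definition geodesic_space ::
  "'a topology \<Rightarrow> 'a curve_class \<Rightarrow> ('a \<Rightarrow> 'a \<Rightarrow> ereal) \<Rightarrow> bool" where
  "geodesic_space T Cv l \<longleftrightarrow>
     (\<forall>x\<in>topspace T. \<forall>y\<in>topspace T. causal_le l x y \<longrightarrow>
        (\<exists>a b \<gamma>. a \<le> b \<and> causal_curve Cv l {a..b} \<gamma> \<and> \<gamma> a = x \<and> \<gamma> b = y \<and>
                 curve_length l a b \<gamma> = time_sep l x y))"

text \<open>Here \<open>\<phi>\<close> is the reparametrisation with inverse \<open>\<psi>\<close>, \<open>I'\<close> its image, and \<open>\<gamma>'\<close> the extension.\<close>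

definition future_extendible ::
  "'a curve_class \<Rightarrow> ('a \<Rightarrow> 'a \<Rightarrow> ereal) \<Rightarrow> real set \<Rightarrow> (real \<Rightarrow> 'a) \<Rightarrow> bool" where
  "future_extendible Cv l I \<gamma> \<longleftrightarrow>
     (\<exists>I' \<phi> \<psi> J \<gamma>'. is_interval I' \<and> homeomorphism I I' \<phi> \<psi> \<and> strict_mono_on I \<phi> \<and>
        I' \<subseteq> J \<and> (\<exists>t\<in>J. \<forall>s\<in>I'. s < t) \<and>
        causal_curve Cv l J \<gamma>' \<and> (\<forall>s\<in>I'. \<gamma>' s = \<gamma> (\<psi> s)))"

definition past_extendible ::
  "'a curve_class \<Rightarrow> ('a \<Rightarrow> 'a \<Rightarrow> ereal) \<Rightarrow> real set \<Rightarrow> (real \<Rightarrow> 'a) \<Rightarrow> bool" where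
  "past_extendible Cv l I \<gamma> \<longleftrightarrow>
     (\<exists>I' \<phi> \<psi> J \<gamma>'. is_interval I' \<and> homeomorphism I I' \<phi> \<psi> \<and> strict_mono_on I \<phi> \<and>
        I' \<subseteq> J \<and> (\<exists>t\<in>J. \<forall>s\<in>I'. t < s) \<and>
        causal_curve Cv l J \<gamma>' \<and> (\<forall>s\<in>I'. \<gamma>' s = \<gamma> (\<psi> s)))"

definition inextendible_causal_curve ::
  "'a curve_class \<Rightarrow> ('a \<Rightarrow> 'a \<Rightarrow> ereal) \<Rightarrow> real set \<Rightarrow> (real \<Rightarrow> 'a) \<Rightarrow> bool" where
  "inextendible_causal_curve Cv l I \<gamma> \<longleftrightarrow>
     causal_curve Cv l I \<gamma> \<and> \<not> future_extendible Cv l I \<gamma> \<and> \<not> past_extendible Cv l I \<gamma>"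

definition inextendible_timelike_curve ::
  "'a curve_class \<Rightarrow> ('a \<Rightarrow> 'a \<Rightarrow> ereal) \<Rightarrow> real set \<Rightarrow> (real \<Rightarrow> 'a) \<Rightarrow> bool" where
  "inextendible_timelike_curve Cv l I \<gamma> \<longleftrightarrow>
     timelike_curve Cv l I \<gamma> \<and> inextendible_causal_curve Cv l I \<gamma>"

text \<open>
  \<open>sup I \<in> I\<close> (in the extended reals) is rendered as existence of a greatest element of \<open>I\<close>,
  because \<^term>\<open>Sup I\<close> is unspecified for unbounded sets of reals; likewise for \<open>inf I \<in> I\<close>.
\<close>

definition Cauchy_complete_timelike_curve ::
  "'a curve_class \<Rightarrow> ('a \<Rightarrow> 'a \<Rightarrow> ereal) \<Rightarrow> real set \<Rightarrow> (real \<Rightarrow> 'a) \<Rightarrow> bool" where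
  "Cauchy_complete_timelike_curve Cv l I \<gamma> \<longleftrightarrow>
     inextendible_timelike_curve Cv l I \<gamma> \<and>
     ((\<exists>t0\<in>I. \<exists>C::real. \<forall>t \<in> {t0..} \<inter> I. time_sep l (\<gamma> t0) (\<gamma> t) \<le> ennreal C) \<longrightarrow>
        (\<exists>m\<in>I. \<forall>t\<in>I. t \<le> m)) \<and>
     ((\<exists>t0\<in>I. \<exists>C::real. \<forall>t \<in> {..t0} \<inter> I. time_sep l (\<gamma> t) (\<gamma> t0) \<le> ennreal C) \<longrightarrow>
        (\<exists>m\<in>I. \<forall>t\<in>I. m \<le> t))"


section \<open>Cauchy sets\<close>

definition Cauchy_sets ::
  "'a topology \<Rightarrow> 'a curve_class \<Rightarrow> ('a \<Rightarrow> 'a \<Rightarrow> ereal) \<Rightarrow> 'a set set" where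
  "Cauchy_sets T Cv l =
     {A. A \<subseteq> topspace T \<and>
         (\<forall>I \<gamma>. inextendible_timelike_curve Cv l I \<gamma> \<longrightarrow> (\<exists>!t. t \<in> I \<and> \<gamma> t \<in> A))}"

definition strong_Cauchy_sets ::
  "'a topology \<Rightarrow> 'a curve_class \<Rightarrow> ('a \<Rightarrow> 'a \<Rightarrow> ereal) \<Rightarrow> 'a set set" where
  "strong_Cauchy_sets T Cv l =
     {A. A \<subseteq> topspace T \<and>
         (\<forall>I \<gamma>. inextendible_causal_curve Cv l I \<gamma> \<longrightarrow> (\<exists>!t. t \<in> I \<and> \<gamma> t \<in> A))}"

definition weak_Cauchy_sets ::
  "'a topology \<Rightarrow> 'a curve_class \<Rightarrow> ('a \<Rightarrow> 'a \<Rightarrow> ereal) \<Rightarrow> 'a set set" where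
  "weak_Cauchy_sets T Cv l =
     {A. A \<subseteq> topspace T \<and>
         (\<forall>I \<gamma>. Cauchy_complete_timelike_curve Cv l I \<gamma> \<longrightarrow> (\<exists>!t. t \<in> I \<and> \<gamma> t \<in> A))}"

text \<open>The supremum is taken in \<open>[0, \<infinity>]\<close>, so it is \<open>0\<close> if one of the sets is empty.\<close>

definition dist_J :: "('a \<Rightarrow> 'a \<Rightarrow> ereal) \<Rightarrow> 'a set \<Rightarrow> 'a set \<Rightarrow> ennreal" where
  "dist_J l A B = (SUP x\<in>A. SUP y\<in>B. time_sep l x y + time_sep l y x)"

definition finite_metric_on :: "'b set \<Rightarrow> ('b \<Rightarrow> 'b \<Rightarrow> ennreal) \<Rightarrow> bool" where
  "finite_metric_on M D \<longleftrightarrow>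
     (\<forall>A\<in>M. \<forall>B\<in>M. D A B < \<infinity>) \<and> Metric_space M (\<lambda>A B. enn2real (D A B))"


section \<open>Bykov-Minguzzi-Suhr spaces\<close>

definition BMS_chron_diamond :: "'a topology \<Rightarrow> ('a \<Rightarrow> 'a \<Rightarrow> real) \<Rightarrow> 'a \<Rightarrow> 'a \<Rightarrow> 'a set" where
  "BMS_chron_diamond T d x y = {z \<in> topspace T. d x z > 0 \<and> d z y > 0}"

definition BMS_Lorentzian_metric_space :: "'a topology \<Rightarrow> ('a \<Rightarrow> 'a \<Rightarrow> real) \<Rightarrow> bool" where
  "BMS_Lorentzian_metric_space T d \<longleftrightarrow>
     (\<forall>x\<in>topspace T. \<forall>y\<in>topspace T. 0 \<le> d x y) \<and>
     (\<forall>x\<in>topspace T. \<forall>y\<in>topspace T. \<forall>z\<in>topspace T.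
        0 < d x y \<longrightarrow> 0 < d y z \<longrightarrow> d x y + d y z \<le> d x z) \<and>
     continuous_map (prod_topology T T) euclideanreal (\<lambda>(x, y). d x y) \<and>
     (\<forall>x\<in>topspace T. \<forall>y\<in>topspace T. \<forall>\<epsilon>>0.
        compactin (prod_topology T T)
          ({(x', y'). \<epsilon> \<le> d x' y'} \<inter>
           (T closure_of BMS_chron_diamond T d x y) \<times> (T closure_of BMS_chron_diamond T d x y))) \<and>
     (\<forall>x\<in>topspace T. \<forall>y\<in>topspace T. x \<noteq> y \<longrightarrow>
        (\<exists>z\<in>topspace T. d x z \<noteq> d y z \<or> d z x \<noteq> d z y))"

definition BMS_causal_le :: "'a topology \<Rightarrow> ('a \<Rightarrow> 'a \<Rightarrow> real) \<Rightarrow> 'a \<Rightarrow> 'a \<Rightarrow> bool" where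
  "BMS_causal_le T d x y \<longleftrightarrow> (\<forall>z\<in>topspace T. d z x \<le> d z y \<and> d y z \<le> d x z)"

definition BMS_Lorentzian_length_space :: "'a topology \<Rightarrow> ('a \<Rightarrow> 'a \<Rightarrow> ereal) \<Rightarrow> bool" where
  "BMS_Lorentzian_length_space T l \<longleftrightarrow>
     (\<exists>d. BMS_Lorentzian_metric_space T d \<and>
          (\<forall>x\<in>topspace T. \<forall>y\<in>topspace T.
             l x y = (if BMS_causal_le T d x y then ereal (d x y) else -\<infinity>))) \<and>
     geodesic_space T (continuous_curve T) l"


section \<open>Braun-McCann spaces\<close>

definition BM_length_metric_spacetime :: "'a topology \<Rightarrow> ('a \<Rightarrow> 'a \<Rightarrow> ereal) \<Rightarrow> bool" where
  "BM_length_metric_spacetime T l \<longleftrightarrow>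
     lorentzian_pre_length_space T l \<and> first_countable T \<and> causal_space T l \<and>
     (\<forall>c. openin (prod_topology T T) {(x, y). x \<in> topspace T \<and> y \<in> topspace T \<and> l x y < c}) \<and>
     (\<forall>c. openin (prod_topology T T)
            {(x, y). x \<in> topspace T \<and> y \<in> topspace T \<and> c < time_sep l x y}) \<and>
     (\<forall>x\<in>topspace T. \<exists>\<gamma>. timelike_curve (continuous_curve T) l {0..1} \<gamma> \<and> \<gamma> (1/2) = x) \<and>
     (\<forall>x\<in>topspace T. \<forall>y\<in>topspace T. chron_less l x y \<longrightarrow>
        time_sep l x y =
          Sup {curve_length l a b \<gamma> | a b \<gamma>.
                 a \<le> b \<and> causal_curve (continuous_curve T) l {a..b} \<gamma> \<and> inj_on \<gamma> {a..b} \<and>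
                 \<gamma> a = x \<and> \<gamma> b = y})"


section \<open>Kunzinger-Saemann spaces\<close>

definition KS_pre_length_space ::
  "'a topology \<Rightarrow> ('a \<Rightarrow> 'a \<Rightarrow> real) \<Rightarrow> ('a \<Rightarrow> 'a \<Rightarrow> ereal) \<Rightarrow> bool" where
  "KS_pre_length_space T \<rho> l \<longleftrightarrow>
     lorentzian_pre_length_space T l \<and>
     Metric_space (topspace T) \<rho> \<and> Metric_space.mtopology (topspace T) \<rho> = T \<and>
     (\<forall>c. openin (prod_topology T T)
            {(x, y). x \<in> topspace T \<and> y \<in> topspace T \<and> c < time_sep l x y})"

definition arclength :: "('a \<Rightarrow> 'a \<Rightarrow> real) \<Rightarrow> real set \<Rightarrow> (real \<Rightarrow> 'a) \<Rightarrow> ennreal" where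
  "arclength \<rho> I \<gamma> =
     Sup {\<Sum>i<n. ennreal (\<rho> (\<gamma> (t i)) (\<gamma> (t (Suc i)))) | n t.
            (\<forall>i\<le>n. t i \<in> I) \<and> (\<forall>i<n. t i < t (Suc i))}"

text \<open>
  \<open>\<Omega>\<close> is a localizing neighborhood. The Lorentzian distance \<open>\<omega>\<close> and the restricted causal relation are combined
  into the extended time separation function that is \<open>\<omega>\<close> where \<open>p \<le> q\<close> and \<open>-\<infinity>\<close> elsewhere; the
  equivalence with \<open>p \<lless> q\<close> makes its chronological relation the restriction of that of the whole
  space (and forces \<open>\<omega> p q = 0\<close> unless \<open>p \<le> q\<close>).
\<close>

definition KS_localizing ::
  "'a topology \<Rightarrow> ('a \<Rightarrow> 'a \<Rightarrow> real) \<Rightarrow> ('a \<Rightarrow> 'a \<Rightarrow> ereal) \<Rightarrow> 'a set \<Rightarrow> bool" where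
  "KS_localizing T \<rho> l \<Omega> \<longleftrightarrow>
     (\<exists>C>0. \<forall>I \<gamma>. causal_curve (locally_Lipschitz_curve T \<rho>) l I \<gamma> \<longrightarrow> \<gamma> ` I \<subseteq> \<Omega> \<longrightarrow>
        arclength \<rho> I \<gamma> \<le> ennreal C) \<and>
     (\<forall>y\<in>\<Omega>. chron_future T l y \<inter> \<Omega> \<noteq> {} \<and> chron_past T l y \<inter> \<Omega> \<noteq> {}) \<and>
     (\<exists>\<omega> :: 'a \<Rightarrow> 'a \<Rightarrow> real.
        (\<forall>p\<in>\<Omega>. \<forall>q\<in>\<Omega>. 0 \<le> \<omega> p q) \<and>
        continuous_map (prod_topology (subtopology T \<Omega>) (subtopology T \<Omega>)) euclideanreal
          (\<lambda>(p, q). \<omega> p q) \<and>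
        (\<forall>p\<in>\<Omega>. \<forall>q\<in>\<Omega>. 0 < \<omega> p q \<longleftrightarrow> chron_less l p q) \<and>
        KS_pre_length_space (subtopology T \<Omega>) \<rho>
          (\<lambda>p q. if causal_le l p q then ereal (\<omega> p q) else -\<infinity>) \<and>
        (\<forall>p\<in>\<Omega>. \<forall>q\<in>\<Omega>. causal_le l p q \<longrightarrow> p \<noteq> q \<longrightarrow>
           (\<exists>a b \<gamma>. a \<le> b \<and> causal_curve (locally_Lipschitz_curve T \<rho>) l {a..b} \<gamma> \<and>
              \<gamma> ` {a..b} \<subseteq> \<Omega> \<and> \<gamma> a = p \<and> \<gamma> b = q \<and>
              (\<forall>a' b' \<gamma>'. a' \<le> b' \<longrightarrow> causal_curve (locally_Lipschitz_curve T \<rho>) l {a'..b'} \<gamma>' \<longrightarrow>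
                 \<gamma>' ` {a'..b'} \<subseteq> \<Omega> \<longrightarrow> \<gamma>' a' = p \<longrightarrow> \<gamma>' b' = q \<longrightarrow>
                 curve_length l a' b' \<gamma>' \<le> curve_length l a b \<gamma>) \<and>
              curve_length l a b \<gamma> = ennreal (\<omega> p q) \<and>
              ennreal (\<omega> p q) \<le> time_sep l p q)))"

definition KS_Lorentzian_length_space ::
  "'a topology \<Rightarrow> ('a \<Rightarrow> 'a \<Rightarrow> real) \<Rightarrow> ('a \<Rightarrow> 'a \<Rightarrow> ereal) \<Rightarrow> bool" where
  "KS_Lorentzian_length_space T \<rho> l \<longleftrightarrow>
     KS_pre_length_space T \<rho> l \<and>
     (\<forall>x\<in>topspace T. \<exists>U V. openin T V \<and> x \<in> V \<and> V \<subseteq> U \<and> U \<subseteq> topspace T \<and>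
        (\<forall>p q p' q'.
           (\<forall>n::nat. p n \<in> U \<and> q n \<in> U \<and> causal_le l (p n) (q n)) \<longrightarrow>
           p' \<in> T closure_of U \<longrightarrow> q' \<in> T closure_of U \<longrightarrow>
           limitin T p p' sequentially \<longrightarrow> limitin T q q' sequentially \<longrightarrow>
           causal_le l p' q')) \<and>
     causally_path_connected T (locally_Lipschitz_curve T \<rho>) l \<and>
     timelike_path_connected T (locally_Lipschitz_curve T \<rho>) l \<and>
     (\<forall>x\<in>topspace T. \<exists>\<Omega>. openin T \<Omega> \<and> x \<in> \<Omega> \<and> KS_localizing T \<rho> l \<Omega>) \<and>
     (\<forall>x\<in>topspace T. \<forall>y\<in>topspace T. chron_less l x y \<longrightarrow>
        time_sep l x y =
          Sup {curve_length l a b \<gamma> | a b \<gamma>.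
                 a \<le> b \<and> causal_curve (locally_Lipschitz_curve T \<rho>) l {a..b} \<gamma> \<and>
                 \<gamma> a = x \<and> \<gamma> b = y})"

end

theory Submission
  imports Defs
begin

text \<open>
  Call a set a slice if it is achronal and every point of the space lies on it or is
  chronologically related to one of its points. All three kinds of Cauchy sets are slices once every
  point lies on an inextendible timelike curve and every causal (timelike) segment extends to an
  inextendible causal (timelike) curve. Such extensions are built greedily: a countable dense set
  yields a concatenation of timelike segments that cannot have a limit from which one could
  continue. Neither Zorn's lemma nor a limit curve theorem is needed.

  If \<open>B\<close> is a slice, the space is the disjoint union of \<open>B\<close> and the open sets \<open>I\<^sup>+(B)\<close>, \<open>I\<^sup>-(B)\<close>, so by
  connectedness an almost maximizing causal curve from \<open>x \<in> A\<close> to \<open>z \<in> C\<close> meets \<open>B\<close>, unless \<open>x\<close> is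
  in the future or \<open>z\<close> in the past of \<open>B\<close>; in each case the triangle inequality follows.
  Finiteness is clear if \<open>d\<close> is continuous. Otherwise the causal hull of two compact slices is compact
  and covered by finitely many open sets such that causal curves with both endpoints in the same one
  have length at most 1; then every causal curve in the hull is at most as long as the cover is large.
\<close>

section \<open>Restriction, reparametrization and gluing for continuous and for Lipschitz
  curves\<close>

section \<open>Classes of curves\<close>

text \<open>Inextendibility quantifies over all reparametrizations and all extensions, and an
  extension only has to be causal. Parameters and arclength therefore say little. What can be
  controlled is the limit point that an extension would add: by push-up it lies in the chronological
  future of the whole curve. From there an open diamond lies ahead, and a ray that has passed every
  dense point it could pass leaves no room for one. This is where separability enters.

  Both kinds of curves are treated at once through \<open>curve_class\<close>. Slope -1 in
  \<open>affine\<close> provides time reversal, \<open>join\<close> glues two pieces,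
  \<open>local\<close> glues infinitely many.

  When a segment is extended in one direction and then in the other, the second extension must not
  spoil the first. Hence the tail lemmas: extendibility and completeness towards the future depend
  only on the curve after some parameter.

  The length bound 1 on the sets of a cover is a normalization; any finite bound would serve. What
  matters is that the resulting bound depends on the number of sets and not on the curve.\<close>

locale curve_class =
  fixes T :: "'a topology" and Cv :: "'a curve_class"
  assumes continuous: "Cv I \<gamma> \<Longrightarrow> continuous_curve T I \<gamma>"
    and subset_cong: "\<lbrakk>Cv I \<gamma>; is_interval J; J \<noteq> {}; J \<subseteq> I; \<And>t. t \<in> J \<Longrightarrow> \<gamma>' t = \<gamma> t\<rbrakk> \<Longrightarrow> Cv J \<gamma>'"
    and affine: "\<lbrakk>Cv I \<gamma>; m \<noteq> 0\<rbrakk> \<Longrightarrow> Cv {t. m * t + c \<in> I} (\<lambda>t. \<gamma> (m * t + c))"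
    and join: "\<lbrakk>is_interval I; b \<in> I; Cv (I \<inter> {..b}) \<gamma>; Cv (I \<inter> {b..}) \<gamma>\<rbrakk> \<Longrightarrow> Cv I \<gamma>"
    and local: "\<lbrakk>is_interval I; I \<noteq> {}; \<And>t. t \<in> I \<Longrightarrow> \<exists>e>0. Cv (I \<inter> ball t e) \<gamma>\<rbrakk> \<Longrightarrow> Cv I \<gamma>"
    and point: "x \<in> topspace T \<Longrightarrow> Cv {t} (\<lambda>_. x)"

lemma is_interval_affine_vimage:
  fixes I :: "real set"
  assumes "is_interval I"
  shows "is_interval {t. m * t + c \<in> I}"
proof -
  have "m * x + c \<in> I" if "m * a + c \<in> I" "m * b + c \<in> I" "a \<le> x" "x \<le> b" for a b x
  proof (cases "m \<ge> 0")
    case True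
    then have "m * a + c \<le> m * x + c" "m * x + c \<le> m * b + c"
      using that by (simp_all add: mult_left_mono)
    then show ?thesis
      using assms that(1,2) unfolding is_interval_1 by blast
  next
    case False
    then have "m * b + c \<le> m * x + c" "m * x + c \<le> m * a + c"
      using that by (simp_all add: mult_left_mono_neg)
    then show ?thesis
      using assms that(1,2) unfolding is_interval_1 by blast
  qed
  then show ?thesis
    unfolding is_interval_1 by blast
qed

lemma affine_vimage_nonempty:
  fixes I :: "real set"
  assumes "I \<noteq> {}" "m \<noteq> 0"
  shows "{t. m * t + c \<in> I} \<noteq> {}"
proof -
  obtain s where "s \<in> I"
    using assms by blast
  then have "(s - c) / m \<in> {t. m * t + c \<in> I}"
    using assms by simp
  then show ?thesis
    by blast
qed

lemma continuous_curve_image: "continuous_curve T I \<gamma> \<Longrightarrow> t \<in> I \<Longrightarrow> \<gamma> t \<in> topspace T"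
  unfolding continuous_curve_def continuous_map_def by auto

lemma curve_class_continuous: "curve_class T (continuous_curve T)"
proof
  fix I \<gamma> J \<gamma>'
  assume "continuous_curve T I \<gamma>" "is_interval J" "J \<noteq> {}" "J \<subseteq> I" "\<And>t. t \<in> J \<Longrightarrow> \<gamma>' t = \<gamma> t"
  then show "continuous_curve T J \<gamma>'"
    unfolding continuous_curve_def
    using continuous_map_eq[OF continuous_map_from_subtopology_mono] by force
next
  fix I \<gamma> and m c :: real
  assume \<gamma>: "continuous_curve T I \<gamma>" and m: "m \<noteq> 0"
  have "continuous_map (top_of_set {t. m * t + c \<in> I}) (top_of_set I) (\<lambda>t. m * t + c)"
    by (auto simp: continuous_map_in_subtopology intro!: continuous_intros)
  then have "continuous_map (top_of_set {t. m * t + c \<in> I}) T (\<gamma> \<circ> (\<lambda>t. m * t + c))"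
    using \<gamma> continuous_map_compose unfolding continuous_curve_def by blast
  then show "continuous_curve T {t. m * t + c \<in> I} (\<lambda>t. \<gamma> (m * t + c))"
    using \<gamma> m unfolding continuous_curve_def
    by (auto simp: o_def is_interval_affine_vimage dest!: affine_vimage_nonempty[of I m c])
next
  fix I b \<gamma>
  assume I: "is_interval I" "b \<in> I" and L: "continuous_curve T (I \<inter> {..b}) \<gamma>"
    and R: "continuous_curve T (I \<inter> {b..}) \<gamma>"
  \<comment> \<open>Both branches are \<gamma>; the case distinction gives the form that the pasting
    lemma for two closed pieces expects.\<close>
  have "continuous_map (top_of_set I) T (\<lambda>t. if t \<le> b then \<gamma> t else \<gamma> t)"
  proof (rule continuous_map_cases_le)
    have "I \<inter> {t \<in> I. t \<le> b} = I \<inter> {..b}" "I \<inter> {t \<in> I. b \<le> t} = I \<inter> {b..}"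
      by auto
    then show "continuous_map (subtopology (top_of_set I) {t \<in> topspace (top_of_set I). t \<le> b}) T \<gamma>"
      and "continuous_map (subtopology (top_of_set I) {t \<in> topspace (top_of_set I). b \<le> t}) T \<gamma>"
      using L R unfolding continuous_curve_def by (simp_all add: subtopology_subtopology)
  qed auto
  then show "continuous_curve T I \<gamma>"
    using I unfolding continuous_curve_def by auto
next
  fix I \<gamma>
  assume I: "is_interval I" "I \<noteq> {}" and loc: "\<And>t. t \<in> I \<Longrightarrow> \<exists>e>0. continuous_curve T (I \<inter> ball t e) \<gamma>"
  have "openin (top_of_set I) {t \<in> I. \<gamma> t \<in> U}" if U: "openin T U" for U
  proof (subst openin_subopen, intro ballI)
    fix t assume t: "t \<in> {t \<in> I. \<gamma> t \<in> U}"
    then obtain e where e: "e > 0" "continuous_curve T (I \<inter> ball t e) \<gamma>"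
      using loc by blast
    let ?B = "I \<inter> ball t e"
    have "openin (top_of_set ?B) {s \<in> ?B. \<gamma> s \<in> U}"
      using e U unfolding continuous_curve_def continuous_map_def by auto
    moreover have "openin (top_of_set I) ?B"
      by (simp add: openin_open_Int)
    ultimately have "openin (top_of_set I) {s \<in> ?B. \<gamma> s \<in> U}"
      using openin_trans by blast
    then show "\<exists>V. openin (top_of_set I) V \<and> t \<in> V \<and> V \<subseteq> {t \<in> I. \<gamma> t \<in> U}"
      using t e by (intro exI[of _ "{s \<in> ?B. \<gamma> s \<in> U}"]) auto
  qed
  moreover have "\<gamma> t \<in> topspace T" if "t \<in> I" for t
    using loc[OF that] continuous_curve_image that by fastforce
  ultimately show "continuous_curve T I \<gamma>"
    using I unfolding continuous_curve_def continuous_map_def by auto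
next
  fix x t assume "x \<in> topspace T"
  then show "continuous_curve T {t} (\<lambda>_. x)"
    unfolding continuous_curve_def by (simp add: is_interval_1)
qed

text \<open>The delicate axiom is \<open>join\<close> at the point \<open>b\<close> itself: there
  the larger of the two one-sided constants works, on the smaller of the two radii. Everywhere else
  one side alone decides.\<close>

lemma curve_class_locally_Lipschitz:
  assumes M: "Metric_space (topspace T) \<rho>"
  shows "curve_class T (locally_Lipschitz_curve T \<rho>)"
proof -
  interpret C: curve_class T "continuous_curve T"
    by (rule curve_class_continuous)
  interpret Metric_space "topspace T" \<rho>
    by (rule M)
  show ?thesis
  proof
    fix I \<gamma>
    assume "locally_Lipschitz_curve T \<rho> I \<gamma>"
    then show "continuous_curve T I \<gamma>"
      unfolding locally_Lipschitz_curve_def by simp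
  next
    fix I \<gamma> J \<gamma>'
    assume A: "locally_Lipschitz_curve T \<rho> I \<gamma>" "is_interval J" "J \<noteq> {}" "J \<subseteq> I" "\<And>t. t \<in> J \<Longrightarrow> \<gamma>' t = \<gamma> t"
    have "continuous_curve T J \<gamma>'"
      using A C.subset_cong unfolding locally_Lipschitz_curve_def by blast
    moreover have "\<exists>e>0. \<exists>K. \<forall>r\<in>J \<inter> ball t e. \<forall>s\<in>J \<inter> ball t e. \<rho> (\<gamma>' r) (\<gamma>' s) \<le> K * \<bar>r - s\<bar>"
      if t: "t \<in> J" for t
    proof -
      obtain e K where "e > 0"
        and "\<forall>r\<in>I \<inter> ball t e. \<forall>s\<in>I \<inter> ball t e. \<rho> (\<gamma> r) (\<gamma> s) \<le> K * \<bar>r - s\<bar>"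
        using A(1,4) t unfolding locally_Lipschitz_curve_def by blast
      then show ?thesis
        using A(4,5) by (intro exI[of _ e] conjI exI[of _ K]) auto
    qed
    ultimately show "locally_Lipschitz_curve T \<rho> J \<gamma>'"
      unfolding locally_Lipschitz_curve_def by blast
  next
    fix I \<gamma> and m c :: real
    assume \<gamma>: "locally_Lipschitz_curve T \<rho> I \<gamma>" and m: "m \<noteq> 0"
    show "locally_Lipschitz_curve T \<rho> {t. m * t + c \<in> I} (\<lambda>t. \<gamma> (m * t + c))"
      unfolding locally_Lipschitz_curve_def
    proof (intro conjI ballI)
      show "continuous_curve T {t. m * t + c \<in> I} (\<lambda>t. \<gamma> (m * t + c))"
        using \<gamma> m C.affine unfolding locally_Lipschitz_curve_def by blast
    next
      fix t assume "t \<in> {t. m * t + c \<in> I}"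
      then obtain e K where e: "e > 0"
        and K: "\<And>r s. r \<in> I \<inter> ball (m * t + c) e \<Longrightarrow> s \<in> I \<inter> ball (m * t + c) e \<Longrightarrow> \<rho> (\<gamma> r) (\<gamma> s) \<le> K * \<bar>r - s\<bar>"
        using \<gamma> unfolding locally_Lipschitz_curve_def by blast
      \<comment> \<open>The affine map stretches distances by the factor
        \<open>\<bar>m\<bar>\<close>, so the radius is divided by it and the Lipschitz constant
        multiplied by it.\<close>
      have in_ball: "m * r + c \<in> ball (m * t + c) e" if "r \<in> ball t (e / \<bar>m\<bar>)" for r
      proof -
        have "\<bar>m\<bar> * \<bar>t - r\<bar> < e"
          using that m by (simp add: dist_real_def field_simps)
        then show ?thesis
          by (simp add: dist_real_def flip: abs_mult right_diff_distrib)
      qed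
      have "\<rho> (\<gamma> (m * r + c)) (\<gamma> (m * s + c)) \<le> (K * \<bar>m\<bar>) * \<bar>r - s\<bar>"
        if "r \<in> {t. m * t + c \<in> I} \<inter> ball t (e / \<bar>m\<bar>)" "s \<in> {t. m * t + c \<in> I} \<inter> ball t (e / \<bar>m\<bar>)" for r s
        using K[of "m * r + c" "m * s + c"] that in_ball
        by (simp add: mult.assoc flip: abs_mult right_diff_distrib)
      moreover have "e / \<bar>m\<bar> > 0"
        using e m by simp
      ultimately show "\<exists>e>0. \<exists>K. \<forall>r\<in>{t. m * t + c \<in> I} \<inter> ball t e. \<forall>s\<in>{t. m * t + c \<in> I} \<inter> ball t e.
               \<rho> (\<gamma> (m * r + c)) (\<gamma> (m * s + c)) \<le> K * \<bar>r - s\<bar>"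
        by blast
    qed
  next
    fix I b \<gamma>
    assume I: "is_interval I" "b \<in> I" and L: "locally_Lipschitz_curve T \<rho> (I \<inter> {..b}) \<gamma>"
      and R: "locally_Lipschitz_curve T \<rho> (I \<inter> {b..}) \<gamma>"
    have cont: "continuous_curve T I \<gamma>"
      using I L R C.join unfolding locally_Lipschitz_curve_def by blast
    have "\<exists>e>0. \<exists>K. \<forall>r\<in>I \<inter> ball t e. \<forall>s\<in>I \<inter> ball t e. \<rho> (\<gamma> r) (\<gamma> s) \<le> K * \<bar>r - s\<bar>" if t: "t \<in> I" for t
    proof -
      consider "t < b" | "b < t" | "t = b" by linarith
      then show ?thesis
      proof cases
        case 1
        then obtain e K where e: "e > 0"
          and K: "\<And>r s. r \<in> I \<inter> {..b} \<inter> ball t e \<Longrightarrow> s \<in> I \<inter> {..b} \<inter> ball t e \<Longrightarrow> \<rho> (\<gamma> r) (\<gamma> s) \<le> K * \<bar>r - s\<bar>"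
          using L t unfolding locally_Lipschitz_curve_def by (metis IntI atMost_iff less_imp_le)
        then show ?thesis
          using 1 by (intro exI[of _ "min e (b - t)"] exI[of _ K] conjI) (auto simp: dist_real_def)
      next
        case 2
        then obtain e K where e: "e > 0"
          and K: "\<And>r s. r \<in> I \<inter> {b..} \<inter> ball t e \<Longrightarrow> s \<in> I \<inter> {b..} \<inter> ball t e \<Longrightarrow> \<rho> (\<gamma> r) (\<gamma> s) \<le> K * \<bar>r - s\<bar>"
          using R t unfolding locally_Lipschitz_curve_def by (metis IntI atLeast_iff less_imp_le)
        then show ?thesis
          using 2 by (intro exI[of _ "min e (t - b)"] exI[of _ K] conjI) (auto simp: dist_real_def)
      next
        case 3
        obtain e1 K1 where e1: "e1 > 0"
          and K1: "\<And>r s. r \<in> I \<inter> {..b} \<inter> ball b e1 \<Longrightarrow> s \<in> I \<inter> {..b} \<inter> ball b e1 \<Longrightarrow> \<rho> (\<gamma> r) (\<gamma> s) \<le> K1 * \<bar>r - s\<bar>"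
          using L I unfolding locally_Lipschitz_curve_def by (metis IntI atMost_iff order_refl)
        obtain e2 K2 where e2: "e2 > 0"
          and K2: "\<And>r s. r \<in> I \<inter> {b..} \<inter> ball b e2 \<Longrightarrow> s \<in> I \<inter> {b..} \<inter> ball b e2 \<Longrightarrow> \<rho> (\<gamma> r) (\<gamma> s) \<le> K2 * \<bar>r - s\<bar>"
          using R I unfolding locally_Lipschitz_curve_def by (metis IntI atLeast_iff order_refl)
        define K where "K = max K1 K2"
        define e where "e = min e1 e2"
        have mono: "K1 * \<bar>r\<bar> \<le> K * \<bar>r\<bar>" "K2 * \<bar>r\<bar> \<le> K * \<bar>r\<bar>" for r
          unfolding K_def by (simp_all add: mult_right_mono)
        have X: "\<gamma> r \<in> topspace T" if "r \<in> I" for r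
          using cont continuous_curve_image that by blast
        \<comment> \<open>The detour through \<open>\<gamma> b\<close> costs nothing on the
          parameter side: since \<open>b\<close> lies between \<open>r\<close> and \<open>s\<close>,
          the two parameter distances add up exactly.\<close>
        have across: "\<rho> (\<gamma> r) (\<gamma> s) \<le> K * \<bar>r - s\<bar>"
          if "r \<in> I \<inter> ball b e" "s \<in> I \<inter> ball b e" "r \<le> b" "b \<le> s" for r s
        proof -
          have "\<rho> (\<gamma> r) (\<gamma> s) \<le> \<rho> (\<gamma> r) (\<gamma> b) + \<rho> (\<gamma> b) (\<gamma> s)"
            using triangle X that I by auto
          also have "\<dots> \<le> K * \<bar>r - b\<bar> + K * \<bar>b - s\<bar>"
            using K1[of r b] K2[of b s] mono(1)[of "r - b"] mono(2)[of "b - s"] that I e1 e2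
            by (auto simp: e_def)
          also have "\<dots> = K * \<bar>r - s\<bar>"
            using that by (simp add: algebra_simps)
          finally show ?thesis .
        qed
        have "\<rho> (\<gamma> r) (\<gamma> s) \<le> K * \<bar>r - s\<bar>" if "r \<in> I \<inter> ball b e" "s \<in> I \<inter> ball b e" for r s
        proof -
          consider "r \<le> b" "s \<le> b" | "b \<le> r" "b \<le> s" | "r \<le> b" "b \<le> s" | "s \<le> b" "b \<le> r"
            by linarith
          then show ?thesis
          proof cases
            case 1
            then show ?thesis
              using K1[of r s] mono(1)[of "r - s"] that by (auto simp: e_def)
          next
            case 2
            then show ?thesis
              using K2[of r s] mono(2)[of "r - s"] that by (auto simp: e_def)
          next
            case 3
            then show ?thesis
              using across that by blast
          next
            case 4
            then show ?thesis
              using across[of s r] that by (simp add: commute abs_minus_commute)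
          qed
        qed
        moreover have "e > 0"
          using e1 e2 by (simp add: e_def)
        ultimately show ?thesis
          using 3 by blast
      qed
    qed
    then show "locally_Lipschitz_curve T \<rho> I \<gamma>"
      using cont unfolding locally_Lipschitz_curve_def by blast
  next
    fix I \<gamma>
    assume I: "is_interval I" "I \<noteq> {}"
      and loc: "\<And>t. t \<in> I \<Longrightarrow> \<exists>e>0. locally_Lipschitz_curve T \<rho> (I \<inter> ball t e) \<gamma>"
    have "continuous_curve T I \<gamma>"
      using I loc C.local unfolding locally_Lipschitz_curve_def by metis
    moreover have "\<exists>e>0. \<exists>K. \<forall>r\<in>I \<inter> ball t e. \<forall>s\<in>I \<inter> ball t e. \<rho> (\<gamma> r) (\<gamma> s) \<le> K * \<bar>r - s\<bar>" if t: "t \<in> I" for t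
    proof -
      obtain d where d: "d > 0" "locally_Lipschitz_curve T \<rho> (I \<inter> ball t d) \<gamma>"
        using loc t by blast
      then obtain e K where "e > 0"
        and "\<forall>r\<in>I \<inter> ball t d \<inter> ball t e. \<forall>s\<in>I \<inter> ball t d \<inter> ball t e. \<rho> (\<gamma> r) (\<gamma> s) \<le> K * \<bar>r - s\<bar>"
        using t unfolding locally_Lipschitz_curve_def by (metis IntI centre_in_ball)
      moreover have "min d e > 0" and "I \<inter> ball t (min d e) \<subseteq> I \<inter> ball t d \<inter> ball t e"
        using d \<open>e > 0\<close> by auto
      ultimately show ?thesis
        by (meson subsetD)
    qed
    ultimately show "locally_Lipschitz_curve T \<rho> I \<gamma>"
      unfolding locally_Lipschitz_curve_def by blast
  next
    fix x t assume "x \<in> topspace T"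
    then show "locally_Lipschitz_curve T \<rho> {t} (\<lambda>_. x)"
      unfolding locally_Lipschitz_curve_def using C.point by (auto intro!: exI[of _ 1])
  qed
qed

section \<open>The reverse triangle inequality and its consequences for the two order
  relations\<close>

section \<open>Time separation\<close>

text \<open>Truncation at 0 does not affect positivity. In this form, exchanging the arguments of
  \<open>l\<close> visibly reverses the relation.\<close>

lemma chron_less_iff: "chron_less l x y \<longleftrightarrow> 0 < l x y"
proof -
  have "0 < e2ennreal (max 0 (l x y)) \<longleftrightarrow> 0 < enn2ereal (e2ennreal (max 0 (l x y)))"
    by (simp add: less_ennreal.rep_eq zero_ennreal.rep_eq)
  then show ?thesis
    unfolding chron_less_def time_sep_def by (simp add: enn2ereal_e2ennreal less_max_iff_disj)
qed

lemma chron_less_imp_causal_le: "chron_less l x y \<Longrightarrow> causal_le l x y"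
  by (simp add: chron_less_iff causal_le_def)

lemma time_sep_eq_0: "\<not> chron_less l x y \<Longrightarrow> time_sep l x y = 0"
  by (simp add: chron_less_def)

text \<open>At equal points the reverse triangle inequality leaves \<open>l x x\<close> equal to 0
  or to \<infinity>. The value \<infinity> is excluded by \<open>chron_irrefl\<close>, which each of
  the three classes yields by an argument of its own.\<close>

locale causal_lorentzian_space =
  fixes T :: "'a topology" and l :: "'a \<Rightarrow> 'a \<Rightarrow> ereal"
  assumes pre_length: "lorentzian_pre_length_space T l"
    and causal: "causal_space T l"
    and chron_irrefl: "x \<in> topspace T \<Longrightarrow> \<not> chron_less l x x"
begin

lemma causal_refl: "x \<in> topspace T \<Longrightarrow> causal_le l x x"
  using pre_length unfolding lorentzian_pre_length_space_def causal_le_def by blast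

lemma reverse_triangle:
  assumes "x \<in> topspace T" "y \<in> topspace T" "z \<in> topspace T" "causal_le l x y" "causal_le l y z"
  shows "l x y + l y z \<le> l x z"
  using assms pre_length unfolding lorentzian_pre_length_space_def by blast

lemma causal_trans:
  assumes "x \<in> topspace T" "y \<in> topspace T" "z \<in> topspace T" "causal_le l x y" "causal_le l y z"
  shows "causal_le l x z"
  using reverse_triangle[OF assms] assms(4,5) unfolding causal_le_def
  by (meson add_nonneg_nonneg order_trans)

lemma causal_antisym:
  assumes "x \<in> topspace T" "y \<in> topspace T" "causal_le l x y" "causal_le l y x"
  shows "x = y"
  using assms causal unfolding causal_space_def by blast

text \<open>The causal premises are essential: \<open>time_sep\<close> is 0 between unrelated
  points, and without the premises the inequality already fails in Minkowski space.\<close>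

lemma time_sep_triangle:
  assumes "x \<in> topspace T" "y \<in> topspace T" "z \<in> topspace T" "causal_le l x y" "causal_le l y z"
  shows "time_sep l x y + time_sep l y z \<le> time_sep l x z"
proof -
  have nonneg: "0 \<le> l x y" "0 \<le> l y z" "0 \<le> l x z"
    using causal_trans[OF assms] assms(4,5) by (simp_all add: causal_le_def)
  then have "enn2ereal (time_sep l x y + time_sep l y z) \<le> enn2ereal (time_sep l x z)"
    using reverse_triangle[OF assms] unfolding time_sep_def
    by (simp add: plus_ennreal.rep_eq enn2ereal_e2ennreal max_absorb2)
  then show ?thesis
    by (simp add: less_eq_ennreal.rep_eq)
qed

lemma time_sep_mono_left:
  assumes "x \<in> topspace T" "y \<in> topspace T" "z \<in> topspace T" "causal_le l x y" "causal_le l y z"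
  shows "time_sep l y z \<le> time_sep l x z"
  using time_sep_triangle[OF assms] by (metis add_increasing order_trans zero_le order_refl)

lemma time_sep_mono_right:
  assumes "x \<in> topspace T" "y \<in> topspace T" "z \<in> topspace T" "causal_le l x y" "causal_le l y z"
  shows "time_sep l x y \<le> time_sep l x z"
  using time_sep_triangle[OF assms] by (metis add_increasing2 order_trans zero_le order_refl)

lemma chron_causal_trans:
  assumes "x \<in> topspace T" "y \<in> topspace T" "z \<in> topspace T" "chron_less l x y" "causal_le l y z"
  shows "chron_less l x z"
  using time_sep_mono_right[of x y z] assms chron_less_imp_causal_le[of l x y]
  unfolding chron_less_def by (metis order_less_le_trans)

lemma chron_trans:
  assumes "x \<in> topspace T" "y \<in> topspace T" "z \<in> topspace T" "chron_less l x y" "chron_less l y z"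
  shows "chron_less l x z"
  by (rule chron_causal_trans[OF assms(1-4) chron_less_imp_causal_le[OF assms(5)]])

lemma dual: "causal_lorentzian_space T (\<lambda>x y. l y x)"
proof
  have "l y x + l z y \<le> l z x"
    if "x \<in> topspace T" "y \<in> topspace T" "z \<in> topspace T" "0 \<le> l y x" "0 \<le> l z y" for x y z
    using reverse_triangle[of z y x] that by (simp add: causal_le_def add.commute)
  then show "lorentzian_pre_length_space T (\<lambda>x y. l y x)"
    using pre_length unfolding lorentzian_pre_length_space_def
    by (simp add: causal_le_def chron_future_def chron_past_def chron_less_iff)
  show "causal_space T (\<lambda>x y. l y x)"
    using causal unfolding causal_space_def causal_le_def by blast
  show "\<not> chron_less (\<lambda>x y. l y x) x x" if "x \<in> topspace T" for x
    using chron_irrefl that by (simp add: chron_less_iff)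
qed

end


section \<open>Injectivity, concatenation and time reversal of causal curves\<close>

section \<open>Causal and timelike curves\<close>

text \<open>A point equal to its own causal future is where an inextendible curve may end; from any
  other point one can continue. In class (i) this dichotomy comes from the empty bubbling boundary
  and timelike extensions; in (ii) and (iii) every point can be left in both directions.\<close>

locale curve_space = curve_class T Cv + causal_lorentzian_space T l
  for T :: "'a topology" and Cv and l +
  assumes separable: "separable_space T"
    and future_timelike_curve: "x \<in> topspace T \<Longrightarrow> causal_future T l x = {x} \<or>
        (\<exists>a b \<gamma>. a < b \<and> timelike_curve Cv l {a..b} \<gamma> \<and> \<gamma> a = x)"
    and past_timelike_curve: "x \<in> topspace T \<Longrightarrow> causal_past T l x = {x} \<or>
        (\<exists>a b \<gamma>. a < b \<and> timelike_curve Cv l {a..b} \<gamma> \<and> \<gamma> b = x)"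
begin

lemma Cv_interval: "Cv I \<gamma> \<Longrightarrow> is_interval I"
  using continuous continuous_curve_def by blast

lemma Cv_image: "Cv I \<gamma> \<Longrightarrow> t \<in> I \<Longrightarrow> \<gamma> t \<in> topspace T"
  using continuous continuous_curve_image by blast

lemma timelike_image: "timelike_curve Cv l I \<gamma> \<Longrightarrow> t \<in> I \<Longrightarrow> \<gamma> t \<in> topspace T"
  using Cv_image timelike_curve_def by blast

lemma causal_image: "causal_curve Cv l I \<gamma> \<Longrightarrow> t \<in> I \<Longrightarrow> \<gamma> t \<in> topspace T"
  using Cv_image causal_curve_def by blast

text \<open>By antisymmetry, a curve that returns to a point is constant in between. Nonconstancy on
  intervals thus becomes a condition on pairs of parameters, which is easy to restrict and to
  glue.\<close>

lemma causal_curve_iff: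
  "causal_curve Cv l I \<gamma> \<longleftrightarrow>
     Cv I \<gamma> \<and> (\<forall>t\<in>I. \<forall>s\<in>I. t < s \<longrightarrow> causal_le l (\<gamma> t) (\<gamma> s) \<and> \<gamma> t \<noteq> \<gamma> s)"
proof
  assume \<gamma>: "causal_curve Cv l I \<gamma>"
  have "\<gamma> t \<noteq> \<gamma> s" if ts: "t \<in> I" "s \<in> I" "t < s" for t s
  proof
    assume eq: "\<gamma> t = \<gamma> s"
    have "\<gamma> u = \<gamma> t" if u: "u \<in> {t..s}" for u
    proof -
      have "u \<in> I"
        using Cv_interval \<gamma> ts u unfolding causal_curve_def is_interval_1 by (metis atLeastAtMost_iff)
      then have "causal_le l (\<gamma> t) (\<gamma> u)" "causal_le l (\<gamma> u) (\<gamma> s)"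
        using \<gamma> ts u causal_refl causal_image[OF \<gamma>] unfolding causal_curve_def
        by (metis atLeastAtMost_iff less_eq_real_def)+
      then show ?thesis
        using causal_antisym causal_image[OF \<gamma>] ts \<open>u \<in> I\<close> eq by metis
    qed
    then show False
      using \<gamma> ts unfolding causal_curve_def constant_on_def by blast
  qed
  then show "Cv I \<gamma> \<and> (\<forall>t\<in>I. \<forall>s\<in>I. t < s \<longrightarrow> causal_le l (\<gamma> t) (\<gamma> s) \<and> \<gamma> t \<noteq> \<gamma> s)"
    using \<gamma> unfolding causal_curve_def by blast
next
  assume R: "Cv I \<gamma> \<and> (\<forall>t\<in>I. \<forall>s\<in>I. t < s \<longrightarrow> causal_le l (\<gamma> t) (\<gamma> s) \<and> \<gamma> t \<noteq> \<gamma> s)"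
  have "\<not> \<gamma> constant_on {a..b}" if "a \<in> I" "b \<in> I" "a < b" for a b
  proof
    assume "\<gamma> constant_on {a..b}"
    then have "\<gamma> a = \<gamma> b"
      using \<open>a < b\<close> unfolding constant_on_def by (metis atLeastAtMost_iff less_eq_real_def order_refl)
    then show False
      using R that by blast
  qed
  then show "causal_curve Cv l I \<gamma>"
    using R unfolding causal_curve_def by blast
qed

lemma timelike_imp_causal:
  assumes "timelike_curve Cv l I \<gamma>"
  shows "causal_curve Cv l I \<gamma>"
  unfolding causal_curve_iff
  using assms chron_less_imp_causal_le chron_irrefl timelike_image[OF assms] unfolding timelike_curve_def by metis

lemma causal_curve_le:
  assumes "causal_curve Cv l I \<gamma>" "t \<in> I" "s \<in> I" "t \<le> s"
  shows "causal_le l (\<gamma> t) (\<gamma> s)"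
  using assms causal_refl causal_image[OF assms(1)] unfolding causal_curve_iff
  by (cases "t = s") auto

lemma timelike_subset_cong:
  assumes "timelike_curve Cv l I \<gamma>" "is_interval J" "J \<noteq> {}" "J \<subseteq> I" "\<And>t. t \<in> J \<Longrightarrow> \<gamma>' t = \<gamma> t"
  shows "timelike_curve Cv l J \<gamma>'"
  using assms subset_cong[of I \<gamma> J \<gamma>'] unfolding timelike_curve_def by auto

lemma causal_subset_cong:
  assumes "causal_curve Cv l I \<gamma>" "is_interval J" "J \<noteq> {}" "J \<subseteq> I" "\<And>t. t \<in> J \<Longrightarrow> \<gamma>' t = \<gamma> t"
  shows "causal_curve Cv l J \<gamma>'"
  using assms subset_cong[of I \<gamma> J \<gamma>'] unfolding causal_curve_iff by auto

lemma timelike_affine: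
  assumes "timelike_curve Cv l I \<gamma>" "m > 0"
  shows "timelike_curve Cv l {t. m * t + c \<in> I} (\<lambda>t. \<gamma> (m * t + c))"
  using assms affine[of I \<gamma> m c] unfolding timelike_curve_def by auto

lemma causal_affine:
  assumes "causal_curve Cv l I \<gamma>" "m > 0"
  shows "causal_curve Cv l {t. m * t + c \<in> I} (\<lambda>t. \<gamma> (m * t + c))"
  using assms affine[of I \<gamma> m c] unfolding causal_curve_iff by auto

lemma timelike_join:
  assumes I: "is_interval I" "b \<in> I"
    and L: "timelike_curve Cv l (I \<inter> {..b}) \<gamma>" and R: "timelike_curve Cv l (I \<inter> {b..}) \<gamma>"
  shows "timelike_curve Cv l I \<gamma>"
proof -
  have Cv: "Cv I \<gamma>"
    using join assms unfolding timelike_curve_def by blast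
  have "chron_less l (\<gamma> t) (\<gamma> s)" if "t \<in> I" "s \<in> I" "t < s" for t s
  proof -
    consider "s \<le> b" | "b \<le> t" | "t < b" "b < s" by linarith
    then show ?thesis
    proof cases
      case 3
      then have "chron_less l (\<gamma> t) (\<gamma> b)" "chron_less l (\<gamma> b) (\<gamma> s)"
        using L R that I unfolding timelike_curve_def by auto
      then show ?thesis
        using chron_trans Cv_image[OF Cv] that I by blast
    qed (use L R that in \<open>auto simp: timelike_curve_def\<close>)
  qed
  then show ?thesis
    using Cv unfolding timelike_curve_def by blast
qed

lemma causal_join:
  assumes I: "is_interval I" "b \<in> I"
    and L: "causal_curve Cv l (I \<inter> {..b}) \<gamma>" and R: "causal_curve Cv l (I \<inter> {b..}) \<gamma>"
  shows "causal_curve Cv l I \<gamma>"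
proof -
  have Cv: "Cv I \<gamma>"
    using join assms unfolding causal_curve_def by blast
  have "causal_le l (\<gamma> t) (\<gamma> s) \<and> \<gamma> t \<noteq> \<gamma> s" if "t \<in> I" "s \<in> I" "t < s" for t s
  proof -
    consider "s \<le> b" | "b \<le> t" | "t < b" "b < s" by linarith
    then show ?thesis
    proof cases
      case 3
      then have "causal_le l (\<gamma> t) (\<gamma> b)" "causal_le l (\<gamma> b) (\<gamma> s)" "\<gamma> t \<noteq> \<gamma> b"
        using L R that I unfolding causal_curve_iff by auto
      \<comment> \<open>If \<open>\<gamma> t = \<gamma> s\<close>, then \<open>\<gamma> b\<close>
        lies causally between equal points, so it equals \<open>\<gamma> t\<close>, which is
        excluded on the left half.\<close>
      then show ?thesis
        using causal_trans causal_antisym Cv_image[OF Cv] that I by metis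
    qed (use L R that in \<open>auto simp: causal_curve_iff\<close>)
  qed
  then show ?thesis
    using Cv unfolding causal_curve_iff by blast
qed

lemma timelike_point: "x \<in> topspace T \<Longrightarrow> timelike_curve Cv l {t} (\<lambda>_. x)"
  using point unfolding timelike_curve_def by auto

text \<open>Time reversal: past notions for \<open>l\<close> are future notions for \<open>\<lambda>x y. l y x\<close>.\<close>

lemma dual: "curve_space T Cv (\<lambda>x y. l y x)"
proof -
  interpret D: causal_lorentzian_space T "\<lambda>x y. l y x"
    by (rule dual)
  have rev: "timelike_curve Cv (\<lambda>x y. l y x) {-b..-a} (\<lambda>t. \<gamma> (-t))"
    if "timelike_curve Cv l {a..b} \<gamma>" for a b \<gamma>
  proof -
    have "{t. (-1) * t + 0 \<in> {a..b}} = {-b..-a}"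
      by auto
    then show ?thesis
      using that affine[of "{a..b}" \<gamma> "-1" 0] unfolding timelike_curve_def by (auto simp: chron_less_iff)
  qed
  show ?thesis
  proof
    show "separable_space T"
      by (rule separable)
  next
    fix x assume x: "x \<in> topspace T"
    show "causal_future T (\<lambda>x y. l y x) x = {x} \<or>
        (\<exists>a b \<gamma>. a < b \<and> timelike_curve Cv (\<lambda>x y. l y x) {a..b} \<gamma> \<and> \<gamma> a = x)"
      using past_timelike_curve[OF x]
    proof (elim disjE exE conjE)
      fix a b \<gamma> assume "a < b" "timelike_curve Cv l {a..b} \<gamma>" "\<gamma> b = x"
      then show ?thesis
        using rev by (intro disjI2 exI[of _ "-b"] exI[of _ "-a"] exI[of _ "\<lambda>t. \<gamma> (-t)"]) auto
    qed (simp add: causal_future_def causal_past_def causal_le_def)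
    show "causal_past T (\<lambda>x y. l y x) x = {x} \<or>
        (\<exists>a b \<gamma>. a < b \<and> timelike_curve Cv (\<lambda>x y. l y x) {a..b} \<gamma> \<and> \<gamma> b = x)"
      using future_timelike_curve[OF x]
    proof (elim disjE exE conjE)
      fix a b \<gamma> assume "a < b" "timelike_curve Cv l {a..b} \<gamma>" "\<gamma> a = x"
      then show ?thesis
        using rev by (intro disjI2 exI[of _ "-b"] exI[of _ "-a"] exI[of _ "\<lambda>t. \<gamma> (-t)"]) auto
    qed (simp add: causal_future_def causal_past_def causal_le_def)
  qed
qed

lemma timelike_reverse:
  assumes "timelike_curve Cv l I \<gamma>"
  shows "timelike_curve Cv (\<lambda>x y. l y x) {t. - t \<in> I} (\<lambda>t. \<gamma> (- t))"
  using assms affine[of I \<gamma> "-1" 0] unfolding timelike_curve_def by (auto simp: chron_less_iff)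

lemma causal_reverse:
  assumes "causal_curve Cv l I \<gamma>"
  shows "causal_curve Cv (\<lambda>x y. l y x) {t. - t \<in> I} (\<lambda>t. \<gamma> (- t))"
proof -
  interpret D: curve_space T Cv "\<lambda>x y. l y x"
    by (rule dual)
  show ?thesis
    using assms affine[of I \<gamma> "-1" 0] unfolding causal_curve_iff D.causal_curve_iff
    by (fastforce simp: causal_le_def)
qed

end

section \<open>Existence of inextendible curves through points and beyond segments\<close>

section \<open>Inextendible curves\<close>

context curve_space
begin

text \<open>In general stronger than \<open>chron_less\<close>, since the space need not be timelike
  path-connected. Rays are assembled along this relation.\<close>

definition reach :: "'a \<Rightarrow> 'a \<Rightarrow> bool" where
  "reach x y \<longleftrightarrow> (\<exists>a b \<gamma>. a < b \<and> timelike_curve Cv l {a..b} \<gamma> \<and> \<gamma> a = x \<and> \<gamma> b = y)"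

text \<open>Affine reparametrization taking \<open>c\<close> to \<open>a\<close> and
  \<open>d\<close> to \<open>b\<close>; it lets segments be laid end to end on prescribed
  intervals.\<close>

lemma reach_on:
  assumes "reach x y" "c < d"
  obtains \<gamma> where "timelike_curve Cv l {c..d} \<gamma>" "\<gamma> c = x" "\<gamma> d = y"
proof -
  obtain a b \<gamma> where \<gamma>: "a < b" "timelike_curve Cv l {a..b} \<gamma>" "\<gamma> a = x" "\<gamma> b = y"
    using assms reach_def by blast
  define m where "m = (b - a) / (d - c)"
  have m: "m > 0" "m * (d - c) = b - a"
    using \<gamma> assms by (simp_all add: m_def)
  have "{t. m * t + (a - m * c) \<in> {a..b}} = {c..d}"
  proof -
    have "m * t + (a - m * c) \<in> {a..b} \<longleftrightarrow> t \<in> {c..d}" for t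
    proof -
      have "m * t + (a - m * c) \<in> {a..b} \<longleftrightarrow> m * c \<le> m * t \<and> m * t \<le> m * d"
        using m(2) by (auto simp: algebra_simps)
      then show ?thesis
        using m(1) by simp
    qed
    then show ?thesis
      by blast
  qed
  then have "timelike_curve Cv l {c..d} (\<lambda>t. \<gamma> (m * t + (a - m * c)))"
    using timelike_affine[OF \<gamma>(2) m(1), of "a - m * c"] by simp
  moreover have "m * d + (a - m * c) = b"
    using m(2) by (simp add: algebra_simps)
  ultimately show thesis
    using that[of "\<lambda>t. \<gamma> (m * t + (a - m * c))"] \<gamma> by simp
qed

lemma reach_chron: "reach x y \<Longrightarrow> chron_less l x y"
  unfolding reach_def timelike_curve_def by fastforce

lemma reach_topspace: "reach x y \<Longrightarrow> x \<in> topspace T \<and> y \<in> topspace T"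
  unfolding reach_def using timelike_image by fastforce

text \<open>An interior point of the curve serves. The purpose is to make the open diamond between
  \<open>x\<close> and \<open>y\<close> nonempty, so that it contains a dense point.\<close>

lemma reach_between:
  assumes "reach x y"
  obtains z where "z \<in> topspace T" "chron_less l x z" "chron_less l z y"
proof -
  obtain \<gamma> where \<gamma>: "timelike_curve Cv l {0..2} \<gamma>" "\<gamma> 0 = x" "\<gamma> 2 = y"
    using assms by (rule reach_on[of _ _ 0 2]) auto
  show thesis
    using that[of "\<gamma> 1"] \<gamma> timelike_image[OF \<gamma>(1), of 1] unfolding timelike_curve_def by force
qed

lemma reach_trans:
  assumes "reach x y" "reach y z"
  shows "reach x z"
proof -
  obtain \<alpha> where \<alpha>: "timelike_curve Cv l {0..1} \<alpha>" "\<alpha> 0 = x" "\<alpha> 1 = y"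
    using assms(1) by (rule reach_on[of _ _ 0 1]) auto
  obtain \<beta> where \<beta>: "timelike_curve Cv l {1..2} \<beta>" "\<beta> 1 = y" "\<beta> 2 = z"
    using assms(2) by (rule reach_on[of _ _ 1 2]) auto
  define \<gamma> where "\<gamma> t = (if t \<le> 1 then \<alpha> t else \<beta> t)" for t :: real
  have "timelike_curve Cv l {0..2} \<gamma>"
  proof (rule timelike_join)
    have "timelike_curve Cv l {0..1} \<gamma>"
      by (rule timelike_subset_cong[OF \<alpha>(1)]) (auto simp: \<gamma>_def is_interval_1)
    moreover have "timelike_curve Cv l {1..2} \<gamma>"
      by (rule timelike_subset_cong[OF \<beta>(1)]) (use \<alpha>(3) \<beta>(2) in \<open>auto simp: \<gamma>_def is_interval_1 dest: antisym\<close>)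
    moreover have "{0..2} \<inter> {..1} = {0..1::real}" "{0..2} \<inter> {1..} = {1..2::real}"
      by auto
    ultimately show "timelike_curve Cv l ({0..2} \<inter> {..1}) \<gamma>" "timelike_curve Cv l ({0..2} \<inter> {1..}) \<gamma>"
      by simp_all
  qed (auto simp: is_interval_1)
  then show ?thesis
    unfolding reach_def using \<alpha> \<beta> by (intro exI[of _ 0] exI[of _ 2] exI[of _ \<gamma>]) (auto simp: \<gamma>_def)
qed

text \<open>The extension passes through \<open>\<gamma> M\<close> and later through another point,
  as causal curves are injective. Read contrapositively: a curve that ends where nothing else lies
  in the causal future cannot be extended.\<close>

lemma future_extendible_with_max:
  assumes "future_extendible Cv l I \<gamma>" "M \<in> I" "\<And>t. t \<in> I \<Longrightarrow> t \<le> M"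
  shows "causal_future T l (\<gamma> M) \<noteq> {\<gamma> M}"
proof -
  obtain I' \<phi> \<psi> J \<gamma>' t where h: "homeomorphism I I' \<phi> \<psi>" "I' \<subseteq> J" "t \<in> J" "\<forall>s\<in>I'. s < t"
    "causal_curve Cv l J \<gamma>'" "\<forall>s\<in>I'. \<gamma>' s = \<gamma> (\<psi> s)"
    using assms(1) unfolding future_extendible_def by blast
  have M: "\<phi> M \<in> I'" "\<psi> (\<phi> M) = M"
    using h(1) assms(2) unfolding homeomorphism_def by auto
  then have "causal_le l (\<gamma> M) (\<gamma>' t)" "\<gamma> M \<noteq> \<gamma>' t"
    using h unfolding causal_curve_iff by (metis subsetD)+
  moreover have "\<gamma>' t \<in> topspace T"
    using causal_image h by blast
  ultimately have "\<gamma>' t \<in> causal_future T l (\<gamma> M)"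
    unfolding causal_future_def by blast
  then show ?thesis
    using \<open>\<gamma> M \<noteq> \<gamma>' t\<close> by auto
qed

text \<open>The point sought is the value of the extension at the supremum \<open>m\<close> of the
  reparametrized domain. The extension is only known to be causal, but before \<open>m\<close> it
  runs along a timelike curve, so it is timelike up to and including \<open>m\<close>.\<close>

lemma future_extendible_without_max:
  assumes \<gamma>: "timelike_curve Cv l I \<gamma>" and ext: "future_extendible Cv l I \<gamma>"
    and nomax: "\<And>t. t \<in> I \<Longrightarrow> \<exists>s\<in>I. t < s"
  obtains p where "\<And>t. t \<in> I \<Longrightarrow> reach (\<gamma> t) p"
proof -
  obtain I' \<phi> \<psi> J \<gamma>' u where h: "is_interval I'" "homeomorphism I I' \<phi> \<psi>" "strict_mono_on I \<phi>"
    "I' \<subseteq> J" "u \<in> J" "\<forall>s\<in>I'. s < u" "causal_curve Cv l J \<gamma>'" "\<forall>s\<in>I'. \<gamma>' s = \<gamma> (\<psi> s)"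
    using ext unfolding future_extendible_def by blast
  have J: "is_interval J"
    using h(7) Cv_interval causal_curve_def by blast
  have I'_eq: "I' = \<phi> ` I" and \<psi>\<phi>: "\<And>t. t \<in> I \<Longrightarrow> \<psi> (\<phi> t) = t"
    using h(2) unfolding homeomorphism_def by auto
  have ne: "I' \<noteq> {}"
    using \<gamma> continuous I'_eq unfolding timelike_curve_def continuous_curve_def by blast
  have bdd: "bdd_above I'"
    using h(6) by (meson bdd_above.I less_imp_le)
  define m where "m = Sup I'"
  have nomax': "\<exists>s'\<in>I'. s < s'" if "s \<in> I'" for s
    using that nomax h(3) unfolding I'_eq by (auto dest: strict_mono_onD)
  have lt_m: "s < m" if "s \<in> I'" for s
    using nomax'[OF that] cSup_upper[OF _ bdd] unfolding m_def by (meson less_le_trans)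
  have below_m: "r \<in> I'" if "s \<in> I'" "s \<le> r" "r < m" for r s
    using that less_cSupD[OF ne, of r] h(1) unfolding m_def is_interval_1 by (meson less_imp_le)
  \<comment> \<open>The supremum lies after a point of \<open>I'\<close> and not after
    \<open>u\<close>, both in the interval \<open>J\<close>.\<close>
  have mJ: "m \<in> J"
  proof -
    obtain s where "s \<in> I'"
      using ne by blast
    moreover have "m \<le> u"
      using cSup_least[OF ne] h(6) unfolding m_def by (meson less_imp_le)
    ultimately show ?thesis
      using J h(4,5) lt_m unfolding is_interval_1 by (meson less_imp_le subsetD)
  qed
  have chron: "chron_less l (\<gamma>' r) (\<gamma>' s)" if rs: "r \<in> I'" "s \<in> I'" "r < s" for r s
  proof -
    obtain t v where tv: "t \<in> I" "v \<in> I" "r = \<phi> t" "s = \<phi> v"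
      using rs I'_eq by blast
    then have "t < v"
      using h(3) rs by (metis linorder_cases order_less_asym strict_mono_onD)
    then show ?thesis
      using \<gamma> tv h(8) rs \<psi>\<phi> unfolding timelike_curve_def by metis
  qed
  \<comment> \<open>Push-up through an intermediate parameter \<open>s\<close>, which exists because
    there is no last one.\<close>
  have chron_m: "chron_less l (\<gamma>' r) (\<gamma>' m)" if r: "r \<in> I'" for r
  proof -
    obtain s where s: "s \<in> I'" "r < s"
      using nomax' r by blast
    show ?thesis
    proof (rule chron_causal_trans)
      show "chron_less l (\<gamma>' r) (\<gamma>' s)"
        using chron r s by blast
      show "causal_le l (\<gamma>' s) (\<gamma>' m)"
        using causal_curve_le[OF h(7)] s h(4) mJ lt_m by (meson less_imp_le subsetD)
    qed (use causal_image[OF h(7)] r s h(4) mJ in auto)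
  qed
  have "reach (\<gamma> t) (\<gamma>' m)" if t: "t \<in> I" for t
  proof -
    have \<phi>t: "\<phi> t \<in> I'"
      using t I'_eq by blast
    have sub: "{\<phi> t..m} \<subseteq> J"
    proof
      fix r assume "r \<in> {\<phi> t..m}"
      then show "r \<in> J"
        using J subsetD[OF h(4) \<phi>t] mJ unfolding is_interval_1 by (metis atLeastAtMost_iff)
    qed
    have "Cv {\<phi> t..m} \<gamma>'"
      using h(7) lt_m[OF \<phi>t] sub subset_cong[of J \<gamma>' "{\<phi> t..m}" \<gamma>']
      unfolding causal_curve_def by (auto simp: is_interval_1)
    moreover have "chron_less l (\<gamma>' r) (\<gamma>' s)" if "r \<in> {\<phi> t..m}" "s \<in> {\<phi> t..m}" "r < s" for r s
      using that chron chron_m below_m[OF \<phi>t] by (cases "s = m") auto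
    ultimately have "timelike_curve Cv l {\<phi> t..m} \<gamma>'"
      unfolding timelike_curve_def by blast
    moreover have "\<gamma>' (\<phi> t) = \<gamma> t"
      using h(8) \<phi>t \<psi>\<phi>[OF t] by metis
    ultimately show ?thesis
      unfolding reach_def using lt_m[OF \<phi>t] by blast
  qed
  then show thesis
    by (rule that)
qed

lemma dense_sequence:
  assumes "topspace T \<noteq> {}"
  obtains d :: "nat \<Rightarrow> 'a" where "range d \<subseteq> topspace T"
    "\<And>U. openin T U \<Longrightarrow> U \<noteq> {} \<Longrightarrow> \<exists>n. d n \<in> U"
proof -
  obtain C where C: "countable C" "C \<subseteq> topspace T" "T closure_of C = topspace T"
    using separable unfolding separable_space_def by blast
  have meets: "C \<inter> U \<noteq> {}" if "openin T U" "U \<noteq> {}" for U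
    using C(3) that dense_intersects_open by blast
  then have "C \<noteq> {}"
    using assms openin_topspace by blast
  \<comment> \<open>Nonemptiness matters: \<open>from_nat_into\<close> enumerates every nonempty
    countable set, with repetitions if it is finite.\<close>
  then have range: "range (from_nat_into C) = C"
    using range_from_nat_into C(1) by metis
  have "\<exists>n. from_nat_into C n \<in> U" if U: "openin T U" "U \<noteq> {}" for U
  proof -
    obtain y where "y \<in> C" "y \<in> U"
      using meets[OF U] by blast
    then show ?thesis
      using from_nat_into_surj[OF C(1)] by metis
  qed
  then show thesis
    using that[of "from_nat_into C"] C(2) range by simp
qed

text \<open>Finitely many unit pieces are glued by induction. For the whole half-line,
  \<open>local\<close> applies, because a ball around \<open>t\<close> lies in a bounded initial
  part.\<close>

lemma timelike_concatenation:
  fixes x :: "nat \<Rightarrow> 'a"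
  assumes "\<And>n. reach (x n) (x (Suc n))"
  obtains \<gamma> where "timelike_curve Cv l {0..} \<gamma>" "\<And>n. \<gamma> (real n) = x n"
proof -
  have "\<exists>\<gamma>. timelike_curve Cv l {real n..real (Suc n)} \<gamma> \<and> \<gamma> (real n) = x n \<and> \<gamma> (real (Suc n)) = x (Suc n)" for n
    by (rule reach_on[OF assms, of "real n" "real (Suc n)" n]) auto
  then obtain c where c: "\<And>n. timelike_curve Cv l {real n..real (Suc n)} (c n)"
    "\<And>n. c n (real n) = x n" "\<And>n. c n (real (Suc n)) = x (Suc n)"
    by metis
  \<comment> \<open>On \<open>[n, n + 1)\<close> this is the piece \<open>c n\<close>; at
    \<open>n + 1\<close> the next piece takes over with the same value
    \<open>x (Suc n)\<close>.\<close>
  define \<gamma> where "\<gamma> t = c (nat \<lfloor>t\<rfloor>) t" for t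
  have \<gamma>_nat: "\<gamma> (real n) = x n" for n
    by (simp add: \<gamma>_def c)
  have \<gamma>_eq: "\<gamma> t = c n t" if "t \<in> {real n..real (Suc n)}" for n t
  proof (cases "t = real (Suc n)")
    case True
    then show ?thesis
      using \<gamma>_nat[of "Suc n"] c(3)[of n] by simp
  next
    case False
    then have "\<lfloor>t\<rfloor> = int n"
      using that by (intro floor_unique) auto
    then show ?thesis
      by (simp add: \<gamma>_def)
  qed
  have piece: "timelike_curve Cv l {real n..real (Suc n)} \<gamma>" for n
    by (rule timelike_subset_cong[OF c(1)]) (use \<gamma>_eq in \<open>auto simp: is_interval_1\<close>)
  have initial: "timelike_curve Cv l {0..real n} \<gamma>" for n
  proof (induction n)
    case 0
    have "x 0 \<in> topspace T"
      using reach_topspace assms by blast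
    then show ?case
      using timelike_subset_cong[OF timelike_point[of "x 0" 0], of "{0}" \<gamma>] \<gamma>_nat[of 0]
      by (auto simp: is_interval_1)
  next
    case (Suc n)
    have "{0..real (Suc n)} \<inter> {..real n} = {0..real n}"
      and "{0..real (Suc n)} \<inter> {real n..} = {real n..real (Suc n)}"
      by auto
    then show ?case
      using timelike_join[of "{0..real (Suc n)}" "real n" \<gamma>] Suc piece[of n] by (auto simp: is_interval_1)
  qed
  have "Cv {0..} \<gamma>"
  proof (rule local)
    fix t :: real assume t: "t \<in> {0..}"
    obtain n where n: "t + 1 < real n"
      using reals_Archimedean2 by blast
    have "Cv ({0..} \<inter> ball t 1) \<gamma>"
    proof (rule subset_cong)
      show "Cv {0..real n} \<gamma>"
        using initial timelike_curve_def by blast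
      show "is_interval ({0..} \<inter> ball t 1)"
        by (simp add: is_interval_Int is_interval_ball_real is_interval_ci)
    qed (use t n in \<open>auto simp: dist_real_def\<close>)
    then show "\<exists>e>0. Cv ({0..} \<inter> ball t e) \<gamma>"
      by (intro exI[of _ 1]) simp
  qed (auto simp: is_interval_1)
  moreover have "chron_less l (\<gamma> t) (\<gamma> s)" if "t \<in> {0..}" "s \<in> {0..}" "t < s" for t s
  proof -
    obtain n where "s < real n"
      using reals_Archimedean2 by blast
    then show ?thesis
      using initial[of n] that unfolding timelike_curve_def by auto
  qed
  ultimately have "timelike_curve Cv l {0..} \<gamma>"
    unfolding timelike_curve_def by blast
  then show thesis
    using that \<gamma>_nat by blast
qed

text \<open>
  The greedy choice: the curve enters \<open>I\<^sup>+(d n)\<close> at step \<open>n\<close> whenever this is possible. If it had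
  a limit \<open>p\<close>, then \<open>p\<close> could be left towards some \<open>q\<close>, and a dense point \<open>d k\<close> between \<open>p\<close> and
  \<open>q\<close> would have been passed at step \<open>k\<close>.
\<close>

lemma future_inextendible_ray:
  assumes x: "x \<in> topspace T"
  obtains I \<gamma> t where "timelike_curve Cv l I \<gamma>" "\<not> future_extendible Cv l I \<gamma>" "t \<in> I" "\<gamma> t = x"
proof (cases "\<exists>y. (y = x \<or> reach x y) \<and> causal_future T l y = {y}")
  case True
  then obtain y where y: "y = x \<or> reach x y" "causal_future T l y = {y}"
    by blast
  show thesis
  proof (cases "reach x y")
    case True
    then obtain \<gamma> where \<gamma>: "timelike_curve Cv l {0..1} \<gamma>" "\<gamma> 0 = x" "\<gamma> 1 = y"
      by (rule reach_on[of _ _ 0 1]) auto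
    then have "\<not> future_extendible Cv l {0..1} \<gamma>"
      using future_extendible_with_max[of "{0..1}" \<gamma> 1] y by auto
    then show thesis
      using that[of "{0..1}" \<gamma> 0] \<gamma> by auto
  next
    case False
    \<comment> \<open>Here \<open>y = x\<close>, so already the one-point curve at \<open>x\<close>
      cannot be extended.\<close>
    then have "\<not> future_extendible Cv l {0} (\<lambda>_. x)"
      using future_extendible_with_max[of "{0}" "\<lambda>_. x" 0] y by auto
    then show thesis
      using that[of "{0}" "\<lambda>_. x" 0] timelike_point x by auto
  qed
next
  case False
  have step: "\<exists>z. reach y z" if y: "y = x \<or> reach x y" for y
  proof -
    have "y \<in> topspace T" "causal_future T l y \<noteq> {y}"
      using y x reach_topspace False by blast+
    then show ?thesis
      using future_timelike_curve unfolding reach_def by metis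
  qed
  obtain d :: "nat \<Rightarrow> 'a" where d: "range d \<subseteq> topspace T" "\<And>U. openin T U \<Longrightarrow> U \<noteq> {} \<Longrightarrow> \<exists>n. d n \<in> U"
    using dense_sequence x by blast
  have ex: "\<exists>z. reach y z \<and> ((\<exists>w. reach y w \<and> chron_less l (d n) w) \<longrightarrow> chron_less l (d n) z)"
    if "y = x \<or> reach x y" for n y
    using step[OF that] by blast
  define next_pt where "next_pt n y =
    (SOME z. reach y z \<and> ((\<exists>w. reach y w \<and> chron_less l (d n) w) \<longrightarrow> chron_less l (d n) z))" for n y
  have next_pt: "reach y (next_pt n y)"
    "\<And>w. reach y w \<Longrightarrow> chron_less l (d n) w \<Longrightarrow> chron_less l (d n) (next_pt n y)"
    if "y = x \<or> reach x y" for n y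
    using someI_ex[OF ex[OF that, of n]] unfolding next_pt_def[symmetric] by blast+
  define X where "X = rec_nat x next_pt"
  have X0: "X 0 = x" and XSuc: "\<And>n. X (Suc n) = next_pt n (X n)"
    by (simp_all add: X_def)
  have X: "X n = x \<or> reach x (X n)" for n
  proof (induction n)
    case (Suc n)
    then show ?case
      using next_pt(1)[OF Suc, of n] reach_trans XSuc by metis
  qed (simp add: X0)
  have "reach (X n) (X (Suc n))" for n
    using next_pt(1) X XSuc by metis
  then obtain \<gamma> where \<gamma>: "timelike_curve Cv l {0..} \<gamma>" "\<And>n. \<gamma> (real n) = X n"
    using timelike_concatenation by blast
  have "\<not> future_extendible Cv l {0..} \<gamma>"
  proof
    assume "future_extendible Cv l {0..} \<gamma>"
    then obtain p where "\<And>t. t \<in> {0..} \<Longrightarrow> reach (\<gamma> t) p"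
    proof (rule future_extendible_without_max[OF \<gamma>(1)])
      show "\<exists>s\<in>{0..}. t < s" if "t \<in> {0..}" for t :: real
        using that by (intro bexI[of _ "t + 1"]) auto
    qed blast
    then have p: "reach (X n) p" for n
      using \<gamma>(2) by (metis atLeast_iff of_nat_0_le_iff)
    then have "reach x p"
      using X0 by metis
    then obtain q where q: "reach p q"
      using step by blast
    obtain z where z: "z \<in> topspace T" "chron_less l p z" "chron_less l z q"
      using q by (rule reach_between)
    have pq: "p \<in> topspace T" "q \<in> topspace T"
      using q reach_topspace by blast+
    have "openin T (chron_future T l p \<inter> chron_past T l q)"
      using pre_length pq unfolding lorentzian_pre_length_space_def by (simp add: openin_Int)
    moreover have "z \<in> chron_future T l p \<inter> chron_past T l q"
      using z by (simp add: chron_future_def chron_past_def)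
    ultimately obtain k where k: "d k \<in> chron_future T l p \<inter> chron_past T l q"
      using d(2) by (metis empty_iff)
    then have dk: "d k \<in> topspace T" "chron_less l p (d k)" "chron_less l (d k) q"
      by (auto simp: chron_future_def chron_past_def)
    \<comment> \<open>At step \<open>k\<close> the point \<open>q\<close> is an admissible target
      beyond \<open>d k\<close>, being reachable from \<open>X k\<close> through \<open>p\<close>.
      So the greedy choice has passed \<open>d k\<close>, which closes the cycle \<open>d k\<close>,
      \<open>X (Suc k)\<close>, \<open>p\<close>, \<open>d k\<close>.\<close>
    have "chron_less l (d k) (X (Suc k))"
      using next_pt(2)[OF X[of k], of q k] reach_trans[OF p q] dk XSuc by simp
    then have "chron_less l (d k) p"
      using chron_trans[of "d k" "X (Suc k)" p] dk p[of "Suc k"] reach_chron reach_topspace by blast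
    then show False
      using chron_trans[of p "d k" p] dk pq chron_irrefl by blast
  qed
  then show thesis
    using that[of "{0..}" \<gamma> 0] \<gamma>(1) \<gamma>(2)[of 0] X0 by simp
qed

end

section \<open>Completeness, time reversal and dependence on tails\<close>

definition future_complete :: "('a \<Rightarrow> 'a \<Rightarrow> ereal) \<Rightarrow> real set \<Rightarrow> (real \<Rightarrow> 'a) \<Rightarrow> bool" where
  "future_complete l I \<gamma> \<longleftrightarrow>
     ((\<exists>t0\<in>I. \<exists>C::real. \<forall>t \<in> {t0..} \<inter> I. time_sep l (\<gamma> t0) (\<gamma> t) \<le> ennreal C) \<longrightarrow>
        (\<exists>m\<in>I. \<forall>t\<in>I. t \<le> m))"

text \<open>Defined by reversal, so that statements about \<open>future_complete\<close> in the
  reversed space apply directly; \<open>past_complete_iff\<close> recovers the explicit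
  condition.\<close>

definition past_complete :: "('a \<Rightarrow> 'a \<Rightarrow> ereal) \<Rightarrow> real set \<Rightarrow> (real \<Rightarrow> 'a) \<Rightarrow> bool" where
  "past_complete l I \<gamma> \<longleftrightarrow> future_complete (\<lambda>x y. l y x) {t. - t \<in> I} (\<lambda>t. \<gamma> (- t))"

lemma past_complete_iff:
  "past_complete l I \<gamma> \<longleftrightarrow>
     ((\<exists>t0\<in>I. \<exists>C::real. \<forall>t \<in> {..t0} \<inter> I. time_sep l (\<gamma> t) (\<gamma> t0) \<le> ennreal C) \<longrightarrow>
        (\<exists>m\<in>I. \<forall>t\<in>I. m \<le> t))"
proof -
  have ts: "time_sep (\<lambda>x y. l y x) x y = time_sep l y x" for x y
    by (simp add: time_sep_def)
  have ex: "(\<exists>t\<in>{t. - t \<in> I}. P t) \<longleftrightarrow> (\<exists>t\<in>I. P (- t))" for P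
    by (metis (no_types, lifting) add.inverse_inverse mem_Collect_eq)
  have all1: "(\<forall>t\<in>{- t0..} \<inter> {t. - t \<in> I}. P (- t)) \<longleftrightarrow> (\<forall>t\<in>{..t0} \<inter> I. P t)" for P t0
    by (auto simp: Ball_def) (metis add.inverse_inverse neg_le_iff_le)
  have all2: "(\<forall>t\<in>{t. - t \<in> I}. t \<le> - m) \<longleftrightarrow> (\<forall>t\<in>I. m \<le> t)" for m
    by (auto simp: Ball_def) (metis add.inverse_inverse neg_le_iff_le)
  show ?thesis
    unfolding past_complete_def future_complete_def ts ex add.inverse_inverse all2
    by (subst all1[where P = "\<lambda>t. time_sep l (\<gamma> t) (\<gamma> _) \<le> ennreal _"]) (rule refl)
qed

lemma homeomorphism_reverse:
  fixes I I' :: "real set"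
  assumes "homeomorphism I I' \<phi> \<psi>"
  shows "homeomorphism {t. - t \<in> I} {s. - s \<in> I'} (\<lambda>t. - \<phi> (- t)) (\<lambda>s. - \<psi> (- s))"
proof (rule homeomorphismI)
  have cont: "continuous_on {t. - t \<in> A} (\<lambda>t. - f (- t))" if "continuous_on A f" for A and f :: "real \<Rightarrow> real"
  proof (rule continuous_on_minus)
    show "continuous_on {t. - t \<in> A} (\<lambda>t. f (- t))"
      by (rule continuous_on_compose2[OF that]) (auto intro!: continuous_intros)
  qed
  show "continuous_on {t. - t \<in> I} (\<lambda>t. - \<phi> (- t))" "continuous_on {s. - s \<in> I'} (\<lambda>s. - \<psi> (- s))"
    using cont assms unfolding homeomorphism_def by blast+
qed (use assms in \<open>auto simp: homeomorphism_def\<close>)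

lemma strict_mono_on_reverse:
  fixes \<phi> :: "real \<Rightarrow> real"
  assumes "strict_mono_on I \<phi>"
  shows "strict_mono_on {t. - t \<in> I} (\<lambda>t. - \<phi> (- t))"
  by (rule strict_mono_onI) (use assms in \<open>auto dest: strict_mono_onD\<close>)

lemma is_interval_glue:
  fixes A B :: "real set"
  assumes "is_interval A" "is_interval B" "e \<in> A" "e \<in> B"
  shows "is_interval (A \<inter> {..e} \<union> B \<inter> {e..})"
  unfolding is_interval_1
proof (intro ballI allI impI, elim conjE)
  fix a b x assume ab: "a \<in> A \<inter> {..e} \<union> B \<inter> {e..}" "b \<in> A \<inter> {..e} \<union> B \<inter> {e..}" "a \<le> x" "x \<le> b"
  show "x \<in> A \<inter> {..e} \<union> B \<inter> {e..}"
  proof (cases "x \<le> e")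
    case True
    then have "x \<in> A"
      using ab assms(1,3) unfolding is_interval_1 by (metis IntE UnE atLeast_iff order_antisym order_trans)
    then show ?thesis
      using True by simp
  next
    case False
    then have "x \<in> B"
      using ab assms(2,4) unfolding is_interval_1 by (metis IntE UnE atMost_iff linear order_trans)
    then show ?thesis
      using False by simp
  qed
qed

context curve_space
begin

text \<open>Glue the extension of \<gamma>2, from the point common to both curves on, to \<gamma>1
  before \<open>b\<close>. The new reparametrization and the new extension are piecewise: a
  translation of \<gamma>1 first, the given data afterwards.\<close>

lemma future_extendible_tail:
  assumes \<gamma>1: "causal_curve Cv l I1 \<gamma>1" and b: "b \<in> I1"
    and dom: "\<And>t. b \<le> t \<Longrightarrow> t \<in> I1 \<longleftrightarrow> t + c \<in> I2"
    and eq: "\<And>t. t \<in> I1 \<Longrightarrow> b \<le> t \<Longrightarrow> \<gamma>2 (t + c) = \<gamma>1 t"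
    and ext: "future_extendible Cv l I2 \<gamma>2"
  shows "future_extendible Cv l I1 \<gamma>1"
proof -
  obtain I' \<phi>2 \<psi>2 J \<gamma>' u where h: "is_interval I'" "homeomorphism I2 I' \<phi>2 \<psi>2" "strict_mono_on I2 \<phi>2"
    "I' \<subseteq> J" "u \<in> J" "\<forall>s\<in>I'. s < u" "causal_curve Cv l J \<gamma>'" "\<forall>s\<in>I'. \<gamma>' s = \<gamma>2 (\<psi>2 s)"
    using ext unfolding future_extendible_def by blast
  have hom: "\<And>t. t \<in> I2 \<Longrightarrow> \<psi>2 (\<phi>2 t) = t" "\<And>t. t \<in> I2 \<Longrightarrow> \<phi>2 t \<in> I'"
    "\<And>s. s \<in> I' \<Longrightarrow> \<phi>2 (\<psi>2 s) = s" "\<And>s. s \<in> I' \<Longrightarrow> \<psi>2 s \<in> I2"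
    "continuous_on I2 \<phi>2" "continuous_on I' \<psi>2"
    using h(2) unfolding homeomorphism_def by auto
  have I1: "is_interval I1" and J: "is_interval J"
    using \<gamma>1 h(7) Cv_interval causal_curve_def by blast+
  have bc: "b + c \<in> I2"
    using b dom by blast
  \<comment> \<open>The parameter at which the given extension passes through
    \<open>\<gamma>1 b\<close>.\<close>
  define e where "e = \<phi>2 (b + c)"
  have e: "e \<in> I'" "\<psi>2 e = b + c" "e \<in> J" "e < u"
    using hom bc h(4,6) by (auto simp: e_def)
  have mono: "\<phi>2 t < \<phi>2 s \<longleftrightarrow> t < s" if "t \<in> I2" "s \<in> I2" for t s
    using strict_mono_onD[OF h(3)] that by (metis linorder_neqE_linordered_idom order_less_asym)
  have e_le: "e \<le> s \<longleftrightarrow> b + c \<le> \<psi>2 s" if "s \<in> I'" for s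
    using mono[of "\<psi>2 s" "b + c"] hom that bc by (simp add: e_def linorder_not_less[symmetric])
  have e_less: "e < \<phi>2 (t + c) \<longleftrightarrow> b < t" if "t + c \<in> I2" for t
    using mono[OF bc that] by (simp add: e_def)
  \<comment> \<open>The domain of \<gamma>1 translated so that \<open>b\<close> lands at
    \<open>e\<close>.\<close>
  define A where "A = {s. s - e + b \<in> I1}"
  define I'' where "I'' = A \<inter> {..e} \<union> I' \<inter> {e..}"
  define J'' where "J'' = A \<inter> {..e} \<union> J \<inter> {e..}"
  define \<phi> where "\<phi> t = (if t \<le> b then t - b + e else \<phi>2 (t + c))" for t
  define \<psi> where "\<psi> s = (if s \<le> e then s - e + b else \<psi>2 s - c)" for s
  define \<gamma>'' where "\<gamma>'' s = (if s \<le> e then \<gamma>1 (s - e + b) else \<gamma>' s)" for s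
  have A: "is_interval A" "e \<in> A"
    using is_interval_affine_vimage[OF I1, of 1 "b - e"] b by (simp_all add: A_def algebra_simps)
  have \<gamma>'_e: "\<gamma>' e = \<gamma>1 b"
    using h(8) e eq b by simp
  have "homeomorphism I1 I'' \<phi> \<psi>"
  proof (rule homeomorphismI)
    show "continuous_on I1 \<phi>"
      unfolding \<phi>_def
    proof (rule continuous_on_cases_le)
      show "continuous_on {t \<in> I1. b \<le> t} (\<lambda>t. \<phi>2 (t + c))"
        by (rule continuous_on_compose2[OF hom(5)]) (use dom in \<open>auto intro!: continuous_intros\<close>)
    qed (auto intro!: continuous_intros simp: e_def)
    show "continuous_on I'' \<psi>"
      unfolding \<psi>_def
    proof (rule continuous_on_cases_le)
      have "{s \<in> I''. e \<le> s} \<subseteq> I'"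
        using e by (auto simp: I''_def)
      then show "continuous_on {s \<in> I''. e \<le> s} (\<lambda>s. \<psi>2 s - c)"
        using continuous_on_subset[OF hom(6)] by (intro continuous_intros) auto
    qed (auto intro!: continuous_intros simp: e)
    show "\<phi> ` I1 \<subseteq> I''"
    proof
      fix s assume "s \<in> \<phi> ` I1"
      then obtain t where t: "t \<in> I1" "s = \<phi> t"
        by blast
      show "s \<in> I''"
      proof (cases "t \<le> b")
        case True
        then show ?thesis
          using t by (simp add: \<phi>_def I''_def A_def)
      next
        case False
        then have "t + c \<in> I2"
          using t dom by simp
        then show ?thesis
          using False t hom(2) e_less[of t] by (simp add: \<phi>_def I''_def)
      qed
    qed
    have \<psi>_ge: "\<psi>2 s - c \<in> I1 \<and> b \<le> \<psi>2 s - c" if "s \<in> I'" "e \<le> s" for s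
      using that e_le[of s] dom[of "\<psi>2 s - c"] hom(4) by simp
    show "\<psi> ` I'' \<subseteq> I1"
      using \<psi>_ge b by (auto simp: \<psi>_def I''_def A_def)
    show "\<psi> (\<phi> t) = t" if "t \<in> I1" for t
    proof (cases "t \<le> b")
      case False
      then have "t + c \<in> I2"
        using dom that by simp
      then show ?thesis
        using False e_less[of t] hom(1) by (simp add: \<phi>_def \<psi>_def)
    qed (simp add: \<phi>_def \<psi>_def)
    show "\<phi> (\<psi> s) = s" if s: "s \<in> I''" for s
    proof (cases "s \<le> e")
      case False
      then have "s \<in> I'"
        using s by (simp add: I''_def)
      \<comment> \<open>This excludes equality, so that \<phi> evaluates by its second branch at
        this parameter.\<close>
      moreover have "\<psi>2 s - c \<noteq> b"
        using False hom(3)[OF \<open>s \<in> I'\<close>] by (auto simp: e_def algebra_simps)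
      ultimately show ?thesis
        using False \<psi>_ge[of s] hom(3) by (simp add: \<phi>_def \<psi>_def)
    qed (simp add: \<phi>_def \<psi>_def)
  qed
  moreover have "is_interval I''"
    unfolding I''_def using is_interval_glue A h(1) e(1) by blast
  moreover have "strict_mono_on I1 \<phi>"
  proof (rule strict_mono_onI)
    fix t s assume ts: "t \<in> I1" "s \<in> I1" "t < s"
    show "\<phi> t < \<phi> s"
    proof (cases "s \<le> b")
      case False
      then have s: "s + c \<in> I2"
        using dom ts by simp
      show ?thesis
      proof (cases "t \<le> b")
        case True
        then show ?thesis
          using e_less[OF s] False by (simp add: \<phi>_def)
      next
        case False
        then show ?thesis
          using mono[of "t + c" "s + c"] dom[of t] ts s by (simp add: \<phi>_def)
      qed
    qed (use ts in \<open>simp add: \<phi>_def\<close>)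
  qed
  moreover have "I'' \<subseteq> J''"
    using h(4) by (auto simp: I''_def J''_def)
  moreover have "u \<in> J''" "\<forall>s\<in>I''. s < u"
    using e h(5,6) by (auto simp: I''_def J''_def)
  moreover have "causal_curve Cv l J'' \<gamma>''"
  proof (rule causal_join)
    show "is_interval J''"
      unfolding J''_def using is_interval_glue A J e(3) by blast
    show "e \<in> J''"
      using e by (simp add: J''_def)
    have "J'' \<inter> {..e} = A \<inter> {..e}" "J'' \<inter> {e..} = J \<inter> {e..}"
      using A e by (auto simp: J''_def)
    moreover have "causal_curve Cv l (A \<inter> {..e}) \<gamma>''"
    proof (rule causal_subset_cong)
      show "causal_curve Cv l A (\<lambda>s. \<gamma>1 (s - e + b))"
        using causal_affine[OF \<gamma>1, of 1 "b - e"] by (simp add: A_def algebra_simps)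
      show "A \<inter> {..e} \<noteq> {}"
        using A(2) by blast
    qed (use A in \<open>auto simp: \<gamma>''_def is_interval_Int is_interval_ic\<close>)
    moreover have "causal_curve Cv l (J \<inter> {e..}) \<gamma>''"
    proof (rule causal_subset_cong[OF h(7)])
      show "\<gamma>'' t = \<gamma>' t" if "t \<in> J \<inter> {e..}" for t
        using that \<gamma>'_e by (cases "t = e") (auto simp: \<gamma>''_def)
      show "J \<inter> {e..} \<noteq> {}"
        using e(3) by blast
    qed (use J in \<open>auto simp: is_interval_Int is_interval_ci\<close>)
    ultimately show "causal_curve Cv l (J'' \<inter> {..e}) \<gamma>''" "causal_curve Cv l (J'' \<inter> {e..}) \<gamma>''"
      by simp_all
  qed
  moreover have "\<forall>s\<in>I''. \<gamma>'' s = \<gamma>1 (\<psi> s)"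
  proof
    fix s assume s: "s \<in> I''"
    show "\<gamma>'' s = \<gamma>1 (\<psi> s)"
    proof (cases "s \<le> e")
      case False
      then have "s \<in> I'"
        using s by (simp add: I''_def)
      then have "\<psi>2 s - c \<in> I1" "b \<le> \<psi>2 s - c"
        using False e_le[of s] dom[of "\<psi>2 s - c"] hom(4) by simp_all
      then show ?thesis
        using False h(8) \<open>s \<in> I'\<close> eq[of "\<psi>2 s - c"] by (simp add: \<gamma>''_def \<psi>_def)
    qed (simp add: \<gamma>''_def \<psi>_def)
  qed
  ultimately show ?thesis
    unfolding future_extendible_def by blast
qed

text \<open>Moving the base point forward along the curve can only decrease the time separation to
  later points. So a bound seen from \<open>s0\<close> persists from a base point in the common
  tail, and a greatest parameter transfers by the shift \<open>c\<close>.\<close>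

lemma future_complete_tail:
  assumes \<gamma>2: "causal_curve Cv l I2 \<gamma>2" and b: "b \<in> I1"
    and dom: "\<And>t. b \<le> t \<Longrightarrow> t \<in> I1 \<longleftrightarrow> t + c \<in> I2"
    and eq: "\<And>t. t \<in> I1 \<Longrightarrow> b \<le> t \<Longrightarrow> \<gamma>2 (t + c) = \<gamma>1 t"
    and complete: "future_complete l I1 \<gamma>1"
  shows "future_complete l I2 \<gamma>2"
  unfolding future_complete_def
proof (intro impI, elim bexE exE)
  fix s0 C
  assume s0: "s0 \<in> I2" and C: "\<forall>t\<in>{s0..} \<inter> I2. time_sep l (\<gamma>2 s0) (\<gamma>2 t) \<le> ennreal C"
  \<comment> \<open>In the parameters of \<gamma>1, the earliest base point that lies in the common
    tail and not before \<open>s0\<close>.\<close>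
  define r where "r = max (s0 - c) b"
  have r: "b \<le> r" "r \<in> I1" "r + c \<in> I2" "s0 \<le> r + c"
    using s0 b dom[of "s0 - c"] dom[of b] by (auto simp: r_def max_def)
  have "time_sep l (\<gamma>1 r) (\<gamma>1 t) \<le> ennreal C" if t: "t \<in> {r..} \<inter> I1" for t
  proof -
    have t': "b \<le> t" "t \<in> I1" "t + c \<in> I2" "r + c \<le> t + c"
      using t r dom[of t] by auto
    have "time_sep l (\<gamma>2 (r + c)) (\<gamma>2 (t + c)) \<le> time_sep l (\<gamma>2 s0) (\<gamma>2 (t + c))"
      by (rule time_sep_mono_left) (use causal_image[OF \<gamma>2] causal_curve_le[OF \<gamma>2] s0 r t' in auto)
    also have "\<dots> \<le> ennreal C"
      using C t' r by auto
    finally show ?thesis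
      using eq r t' by simp
  qed
  then obtain m where m: "m \<in> I1" "\<And>t. t \<in> I1 \<Longrightarrow> t \<le> m"
    using complete r(2) unfolding future_complete_def by blast
  have "t \<le> m + c" if "t \<in> I2" for t
    using that m(2)[of "t - c"] m(2)[OF b] dom[of "t - c"] by (cases "b \<le> t - c") auto
  moreover have "m + c \<in> I2"
    using m b dom by blast
  ultimately show "\<exists>m\<in>I2. \<forall>t\<in>I2. t \<le> m"
    by blast
qed

text \<open>Only the part of \<delta> from \<open>t0\<close> on is attached, shifted so that
  \<open>t0\<close> becomes \<open>b\<close>. It is a tail of \<delta> and of the new curve alike,
  so the tail lemmas give the last two claims. The domain is unchanged up to \<open>b\<close>, which
  permits a past end to be attached later.\<close>

lemma extend_future:
  assumes \<gamma>: "causal_curve Cv l I \<gamma>" and b: "b \<in> I" "\<And>t. t \<in> I \<Longrightarrow> t \<le> b"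
    and \<delta>: "timelike_curve Cv l I2 \<delta>" and t0: "t0 \<in> I2" "\<delta> t0 = \<gamma> b"
  obtains I' \<gamma>' where "causal_curve Cv l I' \<gamma>'" "I \<subseteq> I'" "\<forall>t\<in>I'. t \<le> b \<longrightarrow> t \<in> I"
    "\<forall>t\<in>I. \<gamma>' t = \<gamma> t" "timelike_curve Cv l I \<gamma> \<longrightarrow> timelike_curve Cv l I' \<gamma>'"
    "future_extendible Cv l I' \<gamma>' \<longrightarrow> future_extendible Cv l I2 \<delta>"
    "future_complete l I2 \<delta> \<longrightarrow> future_complete l I' \<gamma>'"
proof -
  define B where "B = {t. t - b + t0 \<in> I2}"
  define I' where "I' = I \<inter> {..b} \<union> B \<inter> {b..}"
  define \<gamma>' where "\<gamma>' t = (if t \<le> b then \<gamma> t else \<delta> (t - b + t0))" for t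
  have I: "is_interval I" and I2: "is_interval I2"
    using \<gamma> \<delta> Cv_interval unfolding causal_curve_def timelike_curve_def by blast+
  have B: "is_interval B" "b \<in> B"
    using is_interval_affine_vimage[OF I2, of 1 "t0 - b"] t0 by (simp_all add: B_def algebra_simps)
  have I': "is_interval I'" "b \<in> I'"
    unfolding I'_def using is_interval_glue I B b by auto
  have split: "I' \<inter> {..b} = I" "I' \<inter> {b..} = B \<inter> {b..}"
    using b B by (auto simp: I'_def)
  have left: "\<gamma>' t = \<gamma> t" if "t \<in> I" for t
    using that b by (simp add: \<gamma>'_def)
  have right: "timelike_curve Cv l (B \<inter> {b..}) \<gamma>'"
  proof (rule timelike_subset_cong)
    show "timelike_curve Cv l B (\<lambda>t. \<delta> (t - b + t0))"
      using timelike_affine[OF \<delta>, of 1 "t0 - b"] by (simp add: B_def algebra_simps)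
    show "\<gamma>' t = \<delta> (t - b + t0)" if "t \<in> B \<inter> {b..}" for t
      using that t0 by (cases "t = b") (auto simp: \<gamma>'_def)
    show "B \<inter> {b..} \<noteq> {}"
      using B(2) by blast
  qed (use B in \<open>auto simp: is_interval_Int is_interval_ci\<close>)
  have causal: "causal_curve Cv l I' \<gamma>'"
  proof (rule causal_join[OF I'])
    show "causal_curve Cv l (I' \<inter> {..b}) \<gamma>'"
      unfolding split by (rule causal_subset_cong[OF \<gamma> I]) (use b left in auto)
    show "causal_curve Cv l (I' \<inter> {b..}) \<gamma>'"
      unfolding split by (rule timelike_imp_causal[OF right])
  qed
  have dom: "t \<in> I2 \<longleftrightarrow> t + (b - t0) \<in> I'" if "t0 \<le> t" for t
    using that t0 b(2)[of "t + (b - t0)"] by (auto simp: I'_def B_def)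
  have eq: "\<gamma>' (t + (b - t0)) = \<delta> t" if "t \<in> I2" "t0 \<le> t" for t
    using that t0 by (cases "t = t0") (auto simp: \<gamma>'_def)
  show thesis
  proof (rule that[of I' \<gamma>'])
    have "timelike_curve Cv l I' \<gamma>'" if "timelike_curve Cv l I \<gamma>"
    proof (rule timelike_join[OF I'])
      show "timelike_curve Cv l (I' \<inter> {..b}) \<gamma>'"
        unfolding split by (rule timelike_subset_cong[OF that I]) (use b left in auto)
      show "timelike_curve Cv l (I' \<inter> {b..}) \<gamma>'"
        unfolding split by (rule right)
    qed
    then show "timelike_curve Cv l I \<gamma> \<longrightarrow> timelike_curve Cv l I' \<gamma>'"
      by blast
    show "future_extendible Cv l I' \<gamma>' \<longrightarrow> future_extendible Cv l I2 \<delta>"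
      using future_extendible_tail[OF timelike_imp_causal[OF \<delta>] t0(1) dom eq] by blast
    show "future_complete l I2 \<delta> \<longrightarrow> future_complete l I' \<gamma>'"
      using future_complete_tail[OF causal t0(1) dom eq] by blast
  qed (use causal b left in \<open>auto simp: I'_def\<close>)
qed

lemma past_extendible_imp_reverse:
  assumes "past_extendible Cv l I \<gamma>"
  shows "future_extendible Cv (\<lambda>x y. l y x) {t. - t \<in> I} (\<lambda>t. \<gamma> (- t))"
proof -
  obtain I' \<phi> \<psi> J \<gamma>' u where h: "is_interval I'" "homeomorphism I I' \<phi> \<psi>" "strict_mono_on I \<phi>"
    "I' \<subseteq> J" "u \<in> J" "\<forall>s\<in>I'. u < s" "causal_curve Cv l J \<gamma>'" "\<forall>s\<in>I'. \<gamma>' s = \<gamma> (\<psi> s)"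
    using assms unfolding past_extendible_def by blast
  note homeomorphism_reverse[OF h(2)]
  moreover note strict_mono_on_reverse[OF h(3)]
  moreover have "is_interval {s. - s \<in> I'}"
    using is_interval_affine_vimage[OF h(1), of "-1" 0] by simp
  moreover have "causal_curve Cv (\<lambda>x y. l y x) {s. - s \<in> J} (\<lambda>s. \<gamma>' (- s))"
    by (rule causal_reverse[OF h(7)])
  moreover have "{s. - s \<in> I'} \<subseteq> {s. - s \<in> J}" "- u \<in> {s. - s \<in> J}"
    "\<forall>s\<in>{s. - s \<in> I'}. s < - u" "\<forall>s\<in>{s. - s \<in> I'}. \<gamma>' (- s) = \<gamma> (- (- \<psi> (- s)))"
    using h by force+
  ultimately show ?thesis
    unfolding future_extendible_def by (intro exI conjI bexI) assumption+
qed

lemma future_extendible_imp_reverse: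
  assumes "future_extendible Cv l I \<gamma>"
  shows "past_extendible Cv (\<lambda>x y. l y x) {t. - t \<in> I} (\<lambda>t. \<gamma> (- t))"
proof -
  obtain I' \<phi> \<psi> J \<gamma>' u where h: "is_interval I'" "homeomorphism I I' \<phi> \<psi>" "strict_mono_on I \<phi>"
    "I' \<subseteq> J" "u \<in> J" "\<forall>s\<in>I'. s < u" "causal_curve Cv l J \<gamma>'" "\<forall>s\<in>I'. \<gamma>' s = \<gamma> (\<psi> s)"
    using assms unfolding future_extendible_def by blast
  note homeomorphism_reverse[OF h(2)]
  moreover note strict_mono_on_reverse[OF h(3)]
  moreover have "is_interval {s. - s \<in> I'}"
    using is_interval_affine_vimage[OF h(1), of "-1" 0] by simp
  moreover have "causal_curve Cv (\<lambda>x y. l y x) {s. - s \<in> J} (\<lambda>s. \<gamma>' (- s))"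
    by (rule causal_reverse[OF h(7)])
  moreover have "{s. - s \<in> I'} \<subseteq> {s. - s \<in> J}" "- u \<in> {s. - s \<in> J}"
    "\<forall>s\<in>{s. - s \<in> I'}. - u < s" "\<forall>s\<in>{s. - s \<in> I'}. \<gamma>' (- s) = \<gamma> (- (- \<psi> (- s)))"
    using h by force+
  ultimately show ?thesis
    unfolding past_extendible_def by (intro exI conjI bexI) assumption+
qed

text \<open>The converse is the mirrored implication in the reversed space, because reversing twice
  restores the curve.\<close>

lemma past_extendible_iff:
  "past_extendible Cv l I \<gamma> \<longleftrightarrow>
     future_extendible Cv (\<lambda>x y. l y x) {t. - t \<in> I} (\<lambda>t. \<gamma> (- t))"
  using past_extendible_imp_reverse
    curve_space.future_extendible_imp_reverse[OF dual, of "{t. - t \<in> I}" "\<lambda>t. \<gamma> (- t)"] by auto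

text \<open>This is \<open>extend_future\<close> in reversed time. The curve \<delta> is already
  given reversed, so its future end becomes the past end of the result.\<close>

lemma extend_past:
  assumes \<gamma>: "causal_curve Cv l I \<gamma>" and a: "a \<in> I" "\<And>t. t \<in> I \<Longrightarrow> a \<le> t"
    and \<delta>: "timelike_curve Cv (\<lambda>x y. l y x) I2 \<delta>" and t0: "t0 \<in> I2" "\<delta> t0 = \<gamma> a"
  obtains I' \<gamma>' where "causal_curve Cv l I' \<gamma>'" "I \<subseteq> I'" "\<forall>t\<in>I'. a \<le> t \<longrightarrow> t \<in> I"
    "\<forall>t\<in>I. \<gamma>' t = \<gamma> t" "timelike_curve Cv l I \<gamma> \<longrightarrow> timelike_curve Cv l I' \<gamma>'"
    "past_extendible Cv l I' \<gamma>' \<longrightarrow> future_extendible Cv (\<lambda>x y. l y x) I2 \<delta>"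
    "future_complete (\<lambda>x y. l y x) I2 \<delta> \<longrightarrow> past_complete l I' \<gamma>'"
proof -
  interpret D: curve_space T Cv "\<lambda>x y. l y x"
    by (rule dual)
  have a': "- a \<in> {t. - t \<in> I}" "\<And>t. t \<in> {t. - t \<in> I} \<Longrightarrow> t \<le> - a"
    using a by fastforce+
  have t0': "\<delta> t0 = \<gamma> (- (- a))"
    using t0 by simp
  obtain I' \<gamma>' where h: "causal_curve Cv (\<lambda>x y. l y x) I' \<gamma>'" "{t. - t \<in> I} \<subseteq> I'"
    "\<forall>t\<in>I'. t \<le> - a \<longrightarrow> t \<in> {t. - t \<in> I}" "\<forall>t\<in>{t. - t \<in> I}. \<gamma>' t = \<gamma> (- t)"
    "timelike_curve Cv (\<lambda>x y. l y x) {t. - t \<in> I} (\<lambda>t. \<gamma> (- t)) \<longrightarrow> timelike_curve Cv (\<lambda>x y. l y x) I' \<gamma>'"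
    "future_extendible Cv (\<lambda>x y. l y x) I' \<gamma>' \<longrightarrow> future_extendible Cv (\<lambda>x y. l y x) I2 \<delta>"
    "future_complete (\<lambda>x y. l y x) I2 \<delta> \<longrightarrow> future_complete (\<lambda>x y. l y x) I' \<gamma>'"
    by (rule D.extend_future[OF causal_reverse[OF \<gamma>] a' \<delta> t0(1) t0'])
  show thesis
  proof (rule that[of "{t. - t \<in> I'}" "\<lambda>t. \<gamma>' (- t)"])
    show "causal_curve Cv l {t. - t \<in> I'} (\<lambda>t. \<gamma>' (- t))"
      using D.causal_reverse[OF h(1)] by simp
    show "timelike_curve Cv l I \<gamma> \<longrightarrow> timelike_curve Cv l {t. - t \<in> I'} (\<lambda>t. \<gamma>' (- t))"
      using D.timelike_reverse[of I' \<gamma>'] h(5) timelike_reverse by simp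
    show "past_extendible Cv l {t. - t \<in> I'} (\<lambda>t. \<gamma>' (- t)) \<longrightarrow> future_extendible Cv (\<lambda>x y. l y x) I2 \<delta>"
      using h(6) by (simp add: past_extendible_iff)
    show "future_complete (\<lambda>x y. l y x) I2 \<delta> \<longrightarrow> past_complete l {t. - t \<in> I'} (\<lambda>t. \<gamma>' (- t))"
      using h(7) by (simp add: past_complete_def)
    show "I \<subseteq> {t. - t \<in> I'}"
      using h(2) by auto
    show "\<forall>t\<in>{t. - t \<in> I'}. a \<le> t \<longrightarrow> t \<in> I"
      using h(3) by (metis (no_types, lifting) add.inverse_inverse mem_Collect_eq neg_le_iff_le)
    show "\<forall>t\<in>I. \<gamma>' (- t) = \<gamma> t"
      using h(4) by simp
  qed
qed

text \<open>The future end is attached before the past end. The latter leaves the curve unchanged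
  from \<open>a\<close> on, and so preserves inextendibility and completeness towards the
  future.\<close>

lemma extend_inextendible:
  assumes \<gamma>: "causal_curve Cv l {a..b} \<gamma>" "a \<le> b"
    and \<delta>1: "timelike_curve Cv l I1 \<delta>1" "t1 \<in> I1" "\<delta>1 t1 = \<gamma> b" "\<not> future_extendible Cv l I1 \<delta>1"
    and \<delta>2: "timelike_curve Cv (\<lambda>x y. l y x) I2 \<delta>2" "t2 \<in> I2" "\<delta>2 t2 = \<gamma> a"
      "\<not> future_extendible Cv (\<lambda>x y. l y x) I2 \<delta>2"
  obtains I \<gamma>' where "inextendible_causal_curve Cv l I \<gamma>'" "{a..b} \<subseteq> I"
    "\<forall>t\<in>{a..b}. \<gamma>' t = \<gamma> t" "timelike_curve Cv l {a..b} \<gamma> \<longrightarrow> timelike_curve Cv l I \<gamma>'"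
    "future_complete l I1 \<delta>1 \<longrightarrow> future_complete l I \<gamma>'"
    "future_complete (\<lambda>x y. l y x) I2 \<delta>2 \<longrightarrow> past_complete l I \<gamma>'"
proof -
  have b: "b \<in> {a..b}" "\<And>t. t \<in> {a..b} \<Longrightarrow> t \<le> b"
    using \<gamma>(2) by auto
  obtain I \<alpha> where \<alpha>: "causal_curve Cv l I \<alpha>" "{a..b} \<subseteq> I" "\<forall>t\<in>I. t \<le> b \<longrightarrow> t \<in> {a..b}"
    "\<forall>t\<in>{a..b}. \<alpha> t = \<gamma> t" "timelike_curve Cv l {a..b} \<gamma> \<longrightarrow> timelike_curve Cv l I \<alpha>"
    "future_extendible Cv l I \<alpha> \<longrightarrow> future_extendible Cv l I1 \<delta>1"
    "future_complete l I1 \<delta>1 \<longrightarrow> future_complete l I \<alpha>"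
    by (rule extend_future[OF \<gamma>(1) b \<delta>1(1-3)])
  have "a \<in> I"
    using \<alpha>(2) \<gamma>(2) by auto
  moreover have "a \<le> t" if "t \<in> I" for t
    using \<alpha>(3) \<gamma>(2) that by (cases "t \<le> b") auto
  ultimately have a: "a \<in> I" "\<And>t. t \<in> I \<Longrightarrow> a \<le> t" .
  have \<delta>2_\<alpha>: "\<delta>2 t2 = \<alpha> a"
    using \<delta>2(3) \<alpha>(4) \<gamma>(2) by simp
  obtain I' \<beta> where \<beta>: "causal_curve Cv l I' \<beta>" "I \<subseteq> I'" "\<forall>t\<in>I'. a \<le> t \<longrightarrow> t \<in> I"
    "\<forall>t\<in>I. \<beta> t = \<alpha> t" "timelike_curve Cv l I \<alpha> \<longrightarrow> timelike_curve Cv l I' \<beta>"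
    "past_extendible Cv l I' \<beta> \<longrightarrow> future_extendible Cv (\<lambda>x y. l y x) I2 \<delta>2"
    "future_complete (\<lambda>x y. l y x) I2 \<delta>2 \<longrightarrow> past_complete l I' \<beta>"
    by (rule extend_past[OF \<alpha>(1) a \<delta>2(1,2) \<delta>2_\<alpha>])
  \<comment> \<open>Shift 0: the two curves share their parameters from \<open>a\<close> on.\<close>
  have dom: "t \<in> I \<longleftrightarrow> t + 0 \<in> I'" if "a \<le> t" for t
    using that \<beta>(2,3) by auto
  have eq: "\<beta> (t + 0) = \<alpha> t" if "t \<in> I" "a \<le> t" for t
    using \<beta>(4) that by simp
  have "\<not> future_extendible Cv l I' \<beta>"
    using future_extendible_tail[OF \<alpha>(1) a(1) dom eq] \<alpha>(6) \<delta>1(4) by blast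
  then have "inextendible_causal_curve Cv l I' \<beta>"
    using \<beta>(1,6) \<delta>2(4) unfolding inextendible_causal_curve_def by blast
  moreover have "future_complete l I1 \<delta>1 \<longrightarrow> future_complete l I' \<beta>"
    using future_complete_tail[OF \<beta>(1) a(1) dom eq] \<alpha>(7) by blast
  moreover have "{a..b} \<subseteq> I'"
    using \<alpha>(2) \<beta>(2) by blast
  moreover have "\<forall>t\<in>{a..b}. \<beta> t = \<gamma> t"
    using \<alpha>(2,4) \<beta>(4) by (metis subsetD)
  moreover have "timelike_curve Cv l {a..b} \<gamma> \<longrightarrow> timelike_curve Cv l I' \<beta>"
    using \<alpha>(5) \<beta>(5) by blast
  ultimately show thesis
    using \<beta>(7) that by metis
qed

text \<open>Both ends continue along greedy rays. The case \<open>a = b\<close> is allowed and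
  produces inextendible timelike curves through a single point.\<close>

lemma extend_inextendible_causal:
  assumes \<gamma>: "causal_curve Cv l {a..b} \<gamma>" "a \<le> b"
  obtains I \<gamma>' where "inextendible_causal_curve Cv l I \<gamma>'" "{a..b} \<subseteq> I"
    "\<forall>t\<in>{a..b}. \<gamma>' t = \<gamma> t" "timelike_curve Cv l {a..b} \<gamma> \<longrightarrow> timelike_curve Cv l I \<gamma>'"
proof -
  interpret D: curve_space T Cv "\<lambda>x y. l y x"
    by (rule dual)
  have ends: "\<gamma> a \<in> topspace T" "\<gamma> b \<in> topspace T"
    using causal_image[OF \<gamma>(1)] \<gamma>(2) by auto
  obtain I1 \<delta>1 t1 where \<delta>1: "timelike_curve Cv l I1 \<delta>1" "\<not> future_extendible Cv l I1 \<delta>1" "t1 \<in> I1" "\<delta>1 t1 = \<gamma> b"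
    using future_inextendible_ray[OF ends(2)] by blast
  obtain I2 \<delta>2 t2 where \<delta>2: "timelike_curve Cv (\<lambda>x y. l y x) I2 \<delta>2"
    "\<not> future_extendible Cv (\<lambda>x y. l y x) I2 \<delta>2" "t2 \<in> I2" "\<delta>2 t2 = \<gamma> a"
    using D.future_inextendible_ray[OF ends(1)] by blast
  show thesis
    using extend_inextendible[OF \<gamma> \<delta>1(1,3,4,2) \<delta>2(1,3,4,2)] that by metis
qed

end

section \<open>Achronality and comparability for the three kinds of Cauchy sets\<close>

section \<open>Cauchy sets\<close>

definition chron_slice :: "'a topology \<Rightarrow> ('a \<Rightarrow> 'a \<Rightarrow> ereal) \<Rightarrow> 'a set \<Rightarrow> bool" where
  "chron_slice T l S \<longleftrightarrow> S \<subseteq> topspace T \<and>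
     (\<forall>x\<in>topspace T. \<exists>s\<in>S. s = x \<or> chron_less l x s \<or> chron_less l s x) \<and>
     (\<forall>x\<in>S. \<forall>y\<in>S. \<not> chron_less l x y)"

lemma Cauchy_complete_iff:
  "Cauchy_complete_timelike_curve Cv l I \<gamma> \<longleftrightarrow>
     inextendible_timelike_curve Cv l I \<gamma> \<and> future_complete l I \<gamma> \<and> past_complete l I \<gamma>"
  unfolding Cauchy_complete_timelike_curve_def future_complete_def past_complete_iff by (rule refl)

context curve_space
begin

lemma timelike_comparable:
  assumes "timelike_curve Cv l I \<gamma>" "t \<in> I" "s \<in> I"
  shows "\<gamma> s = \<gamma> t \<or> chron_less l (\<gamma> t) (\<gamma> s) \<or> chron_less l (\<gamma> s) (\<gamma> t)"
  using assms unfolding timelike_curve_def by (cases t s rule: linorder_cases) auto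

lemma inextendible_timelike_curve_through:
  assumes "x \<in> topspace T"
  obtains I \<gamma> t where "inextendible_timelike_curve Cv l I \<gamma>" "t \<in> I" "\<gamma> t = x"
proof -
  have tl: "timelike_curve Cv l {0..0} (\<lambda>_. x)"
    using timelike_point[OF assms, of 0] by simp
  obtain I \<gamma> where "inextendible_causal_curve Cv l I \<gamma>" "{0..0} \<subseteq> I" "\<forall>t\<in>{0..0}. \<gamma> t = x"
    "timelike_curve Cv l {0..0} (\<lambda>_. x) \<longrightarrow> timelike_curve Cv l I \<gamma>"
    by (rule extend_inextendible_causal[OF timelike_imp_causal[OF tl] order_refl])
  then show thesis
    using that[of I \<gamma> 0] tl unfolding inextendible_timelike_curve_def by simp
qed

lemma strong_Cauchy_sets_subset: "strong_Cauchy_sets T Cv l \<subseteq> Cauchy_sets T Cv l"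
  unfolding strong_Cauchy_sets_def Cauchy_sets_def inextendible_timelike_curve_def by blast

lemma Cauchy_set_comparable:
  assumes S: "S \<in> Cauchy_sets T Cv l" and x: "x \<in> topspace T"
  shows "\<exists>s\<in>S. s = x \<or> chron_less l x s \<or> chron_less l s x"
proof -
  obtain I \<gamma> t where \<gamma>: "inextendible_timelike_curve Cv l I \<gamma>" "t \<in> I" "\<gamma> t = x"
    using x by (rule inextendible_timelike_curve_through)
  then obtain s where "s \<in> I" "\<gamma> s \<in> S"
    using S unfolding Cauchy_sets_def by blast
  then show ?thesis
    using timelike_comparable[of I \<gamma> t s] \<gamma> unfolding inextendible_timelike_curve_def by blast
qed

text \<open>A causal curve joining two chronologically related points of \<open>S\<close> extends to
  an inextendible one, which would meet \<open>S\<close> twice. Any causal curve will do, because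
  strong Cauchy sets control all inextendible causal curves.\<close>

lemma chron_slice_strong_Cauchy:
  assumes S: "S \<in> strong_Cauchy_sets T Cv l"
    and connected: "\<And>x y. \<lbrakk>x \<in> topspace T; y \<in> topspace T; chron_less l x y\<rbrakk> \<Longrightarrow>
      \<exists>a b \<gamma>. a \<le> b \<and> causal_curve Cv l {a..b} \<gamma> \<and> \<gamma> a = x \<and> \<gamma> b = y"
  shows "chron_slice T l S"
proof -
  have sub: "S \<subseteq> topspace T"
    using S unfolding strong_Cauchy_sets_def by blast
  have "\<not> chron_less l x y" if xy: "x \<in> S" "y \<in> S" for x y
  proof
    assume less: "chron_less l x y"
    obtain a b \<gamma> where \<gamma>: "a \<le> b" "causal_curve Cv l {a..b} \<gamma>" "\<gamma> a = x" "\<gamma> b = y"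
      using connected[OF _ _ less] xy sub by blast
    obtain I \<gamma>' where \<gamma>': "inextendible_causal_curve Cv l I \<gamma>'" "{a..b} \<subseteq> I" "\<forall>t\<in>{a..b}. \<gamma>' t = \<gamma> t"
      "timelike_curve Cv l {a..b} \<gamma> \<longrightarrow> timelike_curve Cv l I \<gamma>'"
      using \<gamma>(2,1) by (rule extend_inextendible_causal)
    have "a \<in> I" "\<gamma>' a \<in> S" "b \<in> I" "\<gamma>' b \<in> S"
      using \<gamma> \<gamma>' xy by auto
    \<comment> \<open>Uniqueness concerns the parameter; it forces \<open>x = y\<close>, against
      irreflexivity.\<close>
    then have "a = b"
      using S \<gamma>'(1) unfolding strong_Cauchy_sets_def by blast
    then show False
      using \<gamma> less chron_irrefl sub xy by auto
  qed
  then show ?thesis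
    using sub Cauchy_set_comparable strong_Cauchy_sets_subset S unfolding chron_slice_def by blast
qed

text \<open>Here \<open>S\<close> controls timelike curves only, so the joining segment must be
  timelike for its extension to count. Timelike path-connectedness supplies such a segment.\<close>

lemma chron_slice_Cauchy:
  assumes S: "S \<in> Cauchy_sets T Cv l" and tpc: "timelike_path_connected T Cv l"
  shows "chron_slice T l S"
proof -
  have sub: "S \<subseteq> topspace T"
    using S unfolding Cauchy_sets_def by blast
  have "\<not> chron_less l x y" if xy: "x \<in> S" "y \<in> S" for x y
  proof
    assume less: "chron_less l x y"
    obtain a b \<gamma> where \<gamma>: "a \<le> b" "timelike_curve Cv l {a..b} \<gamma>" "\<gamma> a = x" "\<gamma> b = y"
      using tpc less xy sub unfolding timelike_path_connected_def by blast
    obtain I \<gamma>' where \<gamma>': "inextendible_causal_curve Cv l I \<gamma>'" "{a..b} \<subseteq> I" "\<forall>t\<in>{a..b}. \<gamma>' t = \<gamma> t"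
      "timelike_curve Cv l {a..b} \<gamma> \<longrightarrow> timelike_curve Cv l I \<gamma>'"
      using timelike_imp_causal[OF \<gamma>(2)] \<gamma>(1) by (rule extend_inextendible_causal)
    have "inextendible_timelike_curve Cv l I \<gamma>'"
      using \<gamma>' \<gamma>(2) unfolding inextendible_timelike_curve_def by blast
    moreover have "a \<in> I" "\<gamma>' a \<in> S" "b \<in> I" "\<gamma>' b \<in> S"
      using \<gamma> \<gamma>' xy by auto
    ultimately have "a = b"
      using S unfolding Cauchy_sets_def by blast
    then show False
      using \<gamma> less chron_irrefl sub xy by auto
  qed
  then show ?thesis
    using sub Cauchy_set_comparable S unfolding chron_slice_def by blast
qed

text \<open>The extension of a segment must now be Cauchy complete, which greedy rays need not be.
  Its future end is borrowed from a complete curve through the last point, its past end from one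
  through the starting point.\<close>

lemma chron_slice_weak_Cauchy:
  assumes S: "S \<in> weak_Cauchy_sets T Cv l" and tpc: "timelike_path_connected T Cv l"
    and through: "\<And>x. x \<in> topspace T \<Longrightarrow> \<exists>I \<gamma>. Cauchy_complete_timelike_curve Cv l I \<gamma> \<and> x \<in> \<gamma> ` I"
  shows "chron_slice T l S"
proof -
  have sub: "S \<subseteq> topspace T"
    using S unfolding weak_Cauchy_sets_def by blast
  have "\<exists>s\<in>S. s = x \<or> chron_less l x s \<or> chron_less l s x" if x: "x \<in> topspace T" for x
  proof -
    obtain I \<gamma> t where \<gamma>: "Cauchy_complete_timelike_curve Cv l I \<gamma>" "t \<in> I" "\<gamma> t = x"
      using through[OF x] by blast
    then obtain s where "s \<in> I" "\<gamma> s \<in> S"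
      using S unfolding weak_Cauchy_sets_def by blast
    then show ?thesis
      using timelike_comparable[of I \<gamma> t s] \<gamma>
      unfolding Cauchy_complete_iff inextendible_timelike_curve_def by blast
  qed
  moreover have "\<not> chron_less l x y" if xy: "x \<in> S" "y \<in> S" for x y
  proof
    assume less: "chron_less l x y"
    obtain a b \<gamma> where \<gamma>: "a \<le> b" "timelike_curve Cv l {a..b} \<gamma>" "\<gamma> a = x" "\<gamma> b = y"
      using tpc less xy sub unfolding timelike_path_connected_def by blast
    have ends: "\<gamma> a \<in> topspace T" "\<gamma> b \<in> topspace T"
      using \<gamma>(3,4) xy sub by auto
    obtain I1 \<delta>1 t1 where \<delta>1: "Cauchy_complete_timelike_curve Cv l I1 \<delta>1" "t1 \<in> I1" "\<delta>1 t1 = \<gamma> b"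
      using through[OF ends(2)] by (metis imageE)
    obtain I2 \<delta>2 t2 where \<delta>2: "Cauchy_complete_timelike_curve Cv l I2 \<delta>2" "t2 \<in> I2" "\<delta>2 t2 = \<gamma> a"
      using through[OF ends(1)] by (metis imageE)
    have f: "timelike_curve Cv l I1 \<delta>1" "\<not> future_extendible Cv l I1 \<delta>1" "future_complete l I1 \<delta>1"
      using \<delta>1 unfolding Cauchy_complete_iff inextendible_timelike_curve_def inextendible_causal_curve_def by blast+
    \<comment> \<open>The past end of \<delta>2, in the reversed form that
      \<open>extend_inextendible\<close> takes.\<close>
    have p: "timelike_curve Cv (\<lambda>x y. l y x) {t. - t \<in> I2} (\<lambda>t. \<delta>2 (- t))"
      "\<not> future_extendible Cv (\<lambda>x y. l y x) {t. - t \<in> I2} (\<lambda>t. \<delta>2 (- t))"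
      "future_complete (\<lambda>x y. l y x) {t. - t \<in> I2} (\<lambda>t. \<delta>2 (- t))"
      using \<delta>2(1) timelike_reverse[of I2 \<delta>2]
      unfolding Cauchy_complete_iff inextendible_timelike_curve_def inextendible_causal_curve_def
        past_extendible_iff past_complete_def by blast+
    have t2: "- t2 \<in> {t. - t \<in> I2}" "\<delta>2 (- (- t2)) = \<gamma> a"
      using \<delta>2 by simp_all
    obtain I \<gamma>' where \<gamma>': "inextendible_causal_curve Cv l I \<gamma>'" "{a..b} \<subseteq> I"
      "\<forall>t\<in>{a..b}. \<gamma>' t = \<gamma> t" "timelike_curve Cv l {a..b} \<gamma> \<longrightarrow> timelike_curve Cv l I \<gamma>'"
      "future_complete l I1 \<delta>1 \<longrightarrow> future_complete l I \<gamma>'"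
      "future_complete (\<lambda>x y. l y x) {t. - t \<in> I2} (\<lambda>t. \<delta>2 (- t)) \<longrightarrow> past_complete l I \<gamma>'"
      by (rule extend_inextendible[OF timelike_imp_causal[OF \<gamma>(2)] \<gamma>(1) f(1) \<delta>1(2,3) f(2) p(1) t2 p(2)])
    have "Cauchy_complete_timelike_curve Cv l I \<gamma>'"
      using \<gamma>' \<gamma>(2) f(3) p(3) unfolding Cauchy_complete_iff inextendible_timelike_curve_def by blast
    moreover have "a \<in> I" "\<gamma>' a \<in> S" "b \<in> I" "\<gamma>' b \<in> S"
      using \<gamma> \<gamma>' xy by auto
    ultimately have "a = b"
      using S unfolding weak_Cauchy_sets_def by blast
    then show False
      using \<gamma> less chron_irrefl sub xy by auto
  qed
  ultimately show ?thesis
    using sub unfolding chron_slice_def by blast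
qed

end


section \<open>Subadditivity of length and a bound by the size of an open cover\<close>

section \<open>Length of curves\<close>

text \<open>The partition without any step is allowed, and its sum is empty.\<close>

lemma curve_length_self: "curve_length l a a \<gamma> = 0"
proof -
  have "curve_length l a a \<gamma> \<le> 0"
    unfolding curve_length_def
    by (rule Inf_lower, rule CollectI, rule exI[of _ 0], rule exI[of _ "\<lambda>_. a"]) simp
  then show ?thesis
    by simp
qed

lemma curve_length_le_time_sep:
  assumes "a < b"
  shows "curve_length l a b \<gamma> \<le> time_sep l (\<gamma> a) (\<gamma> b)"
  unfolding curve_length_def
  by (rule Inf_lower, rule CollectI, rule exI[of _ 1], rule exI[of _ "\<lambda>i. if i = 0 then a else b"])
     (use assms in simp)

text \<open>Partitions of the two parts concatenate to a partition of the whole, so the infimum on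
  the left runs over more partitions. No order of \<open>a\<close>, \<open>b\<close>,
  \<open>c\<close> is assumed: where there is no partition, the infimum is \<infinity>.\<close>

lemma curve_length_add: "curve_length l a c \<gamma> \<le> curve_length l a b \<gamma> + curve_length l b c \<gamma>"
proof -
  define P where "P a b = {\<Sum>i<n. time_sep l (\<gamma> (t i)) (\<gamma> (t (Suc i))) | n t.
            t 0 = a \<and> t n = b \<and> (\<forall>i<n. t i < t (Suc i))}" for a b :: real
  have L: "curve_length l a b \<gamma> = Inf (P a b)" for a b
    by (simp add: curve_length_def P_def)
  have concat: "p + q \<in> P a c" if pq: "p \<in> P a b" "q \<in> P b c" for p q
  proof -
    obtain n t where t: "p = (\<Sum>i<n. time_sep l (\<gamma> (t i)) (\<gamma> (t (Suc i))))"
      "t 0 = a" "t n = b" "\<forall>i<n. t i < t (Suc i)"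
      using pq(1) unfolding P_def by blast
    obtain m s where s: "q = (\<Sum>i<m. time_sep l (\<gamma> (s i)) (\<gamma> (s (Suc i))))"
      "s 0 = b" "s m = c" "\<forall>i<m. s i < s (Suc i)"
      using pq(2) unfolding P_def by blast
    define r where "r i = (if i \<le> n then t i else s (i - n))" for i
    have r1: "r i = t i" if "i \<le> n" for i
      using that by (simp add: r_def)
    have r2: "r (n + i) = s i" for i
      using t(3) s(2) by (cases i) (simp_all add: r_def)
    have sum_split: "(\<Sum>i<n + k. f i) = (\<Sum>i<n. f i) + (\<Sum>i<k. f (n + i))" for k and f :: "nat \<Rightarrow> ennreal"
      by (induction k) (simp_all add: add.assoc)
    have "(\<Sum>i<n. time_sep l (\<gamma> (r i)) (\<gamma> (r (Suc i)))) = p"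
      unfolding t(1) by (rule sum.cong) (simp_all add: r1)
    moreover have "(\<Sum>i<m. time_sep l (\<gamma> (r (n + i))) (\<gamma> (r (Suc (n + i))))) = q"
      unfolding s(1)
    proof (rule sum.cong)
      show "time_sep l (\<gamma> (r (n + i))) (\<gamma> (r (Suc (n + i)))) = time_sep l (\<gamma> (s i)) (\<gamma> (s (Suc i)))" for i
        using r2[of i] r2[of "Suc i"] by simp
    qed simp
    ultimately have "(\<Sum>i<n + m. time_sep l (\<gamma> (r i)) (\<gamma> (r (Suc i)))) = p + q"
      unfolding sum_split by simp
    moreover have "r 0 = a" "r (n + m) = c"
      using r1[of 0] r2[of m] t s by simp_all
    moreover have "r i < r (Suc i)" if i: "i < n + m" for i
    proof (cases "i < n")
      case True
      then show ?thesis
        using r1[of i] r1[of "Suc i"] t by simp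
    next
      case False
      then have "i = n + (i - n)" "i - n < m"
        using i by simp_all
      then show ?thesis
        using r2[of "i - n"] r2[of "Suc (i - n)"] s(4) by (metis add_Suc_right)
    qed
    ultimately show ?thesis
      unfolding P_def by (intro CollectI exI[of _ "n + m"] exI[of _ r]) simp
  qed
  show ?thesis
    unfolding L
  proof (rule ennreal_le_epsilon)
    fix e :: real
    assume fin: "Inf (P a b) + Inf (P b c) < top" and e: "0 < e"
    \<comment> \<open>Finiteness is essential for the strict increase; the case of an infinite
      right-hand side is left out by the rule just applied.\<close>
    have less: "x < x + ennreal (e / 2)" if "x < top" for x
      using that e by (cases x) (simp_all add: ennreal_less_iff flip: ennreal_plus)
    have "Inf (P a b) < top" "Inf (P b c) < top"
      using fin by simp_all
    then have "Inf (P a b) < Inf (P a b) + ennreal (e / 2)" "Inf (P b c) < Inf (P b c) + ennreal (e / 2)"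
      using less by blast+
    then obtain p q where pq: "p \<in> P a b" "p < Inf (P a b) + ennreal (e / 2)"
      "q \<in> P b c" "q < Inf (P b c) + ennreal (e / 2)"
      unfolding Inf_less_iff by blast
    have "Inf (P a c) \<le> p + q"
      using concat pq by (simp add: Inf_lower)
    also have "\<dots> \<le> (Inf (P a b) + ennreal (e / 2)) + (Inf (P b c) + ennreal (e / 2))"
      using pq by (intro add_mono) auto
    also have "\<dots> = Inf (P a b) + Inf (P b c) + (ennreal (e / 2) + ennreal (e / 2))"
      by (simp add: algebra_simps)
    also have "ennreal (e / 2) + ennreal (e / 2) = ennreal e"
      using e by (simp flip: ennreal_plus)
    finally show "Inf (P a c) \<le> Inf (P a b) + Inf (P b c) + ennreal e" .
  qed
qed

text \<open>
  A chain may be cut down so that every set of the cover is used for at most one step: jump from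
  the first to the last visit.
\<close>

lemma chain_length_le_card:
  fixes L :: "nat \<Rightarrow> nat \<Rightarrow> ennreal"
  assumes "finite F" "k \<le> n"
    and "\<And>i. k \<le> i \<Longrightarrow> i < n \<Longrightarrow> \<exists>U\<in>F. p i \<in> U \<and> p (Suc i) \<in> U"
    and "\<And>i j k. L i k \<le> L i j + L j k" and "\<And>i. L i i = 0"
    and "\<And>U i j. \<lbrakk>U \<in> F; i \<le> j; j \<le> n; p i \<in> U; p j \<in> U\<rbrakk> \<Longrightarrow> L i j \<le> 1"
  shows "L k n \<le> of_nat (card F)"
  using assms(1-3,6)
proof (induction "card F" arbitrary: F k)
  case 0
  then have "k = n"
    by (metis card_0_eq empty_iff le_neq_implies_less order_refl)
  then show ?case
    using assms(5) by simp
next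
  case (Suc c)
  show ?case
  proof (cases "k = n")
    case True
    then show ?thesis
      using assms(5) by simp
  next
    case False
    then obtain U where U: "U \<in> F" "p k \<in> U"
      using Suc.prems(2,3) by (metis le_neq_implies_less order_refl)
    define j where "j = Max {i. k \<le> i \<and> i \<le> n \<and> p i \<in> U}"
    have fin: "finite {i. k \<le> i \<and> i \<le> n \<and> p i \<in> U}"
      by (rule finite_subset[of _ "{..n}"]) auto
    moreover have "k \<in> {i. k \<le> i \<and> i \<le> n \<and> p i \<in> U}"
      using U Suc.prems(2) by simp
    ultimately have j: "k \<le> j" "j \<le> n" "p j \<in> U"
      using Max_in unfolding j_def by blast+
    have last: "p i \<notin> U" if "j < i" "i \<le> n" for i
      using that j Max_ge[OF fin, of i] unfolding j_def[symmetric] by auto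
    have card: "c = card (F - {U})" "card F = Suc (card (F - {U}))"
      using Suc.hyps(2) U Suc.prems(1) by (simp_all add: card_Suc_Diff1)
    have "L j n \<le> of_nat (card (F - {U}))"
    proof (rule Suc.hyps(1)[OF card(1)])
      \<comment> \<open>From the last visit \<open>j\<close> on, \<open>p (Suc i)\<close> is outside
        \<open>U\<close>, so the set covering this step is another one.\<close>
      show "\<exists>V\<in>F - {U}. p i \<in> V \<and> p (Suc i) \<in> V" if "j \<le> i" "i < n" for i
        using Suc.prems(3)[of i] last[of "Suc i"] that j by fastforce
      show "L i i' \<le> 1" if "V \<in> F - {U}" "i \<le> i'" "i' \<le> n" "p i \<in> V" "p i' \<in> V" for V i i'
        using Suc.prems(4) that by blast
    qed (use Suc.prems j in auto)
    moreover have "L k j \<le> 1"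
      using Suc.prems(4) U j by blast
    ultimately have "L k j + L j n \<le> 1 + of_nat (card (F - {U}))"
      using add_mono by blast
    also have "\<dots> = of_nat (card F)"
      unfolding card(2) by simp
    finally show ?thesis
      using assms(4)[of k n j] order_trans by blast
  qed
qed

text \<open>A fine subdivision turns the curve into a chain whose steps each stay in one set of the
  cover. Hypothesis \<open>local\<close> restricts endpoints only: the curve may leave
  \<open>U\<close> in between, and this is what makes the jumps of the chain argument
  legitimate.\<close>

lemma curve_length_le_card:
  assumes \<gamma>: "continuous_curve T {a..b} \<gamma>" "a \<le> b"
    and F: "finite F" "\<And>U. U \<in> F \<Longrightarrow> openin T U" "\<gamma> ` {a..b} \<subseteq> \<Union>F"
    and local: "\<And>U r s. \<lbrakk>U \<in> F; a \<le> r; r \<le> s; s \<le> b; \<gamma> r \<in> U; \<gamma> s \<in> U\<rbrakk> \<Longrightarrow> curve_length l r s \<gamma> \<le> 1"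
  shows "curve_length l a b \<gamma> \<le> of_nat (card F)"
proof (cases "a = b")
  case True
  then show ?thesis
    by (simp add: curve_length_self)
next
  case False
  then have ab: "a < b"
    using \<gamma>(2) by simp
  have "openin (top_of_set {a..b}) {t \<in> {a..b}. \<gamma> t \<in> U}" if "U \<in> F" for U
    using \<gamma>(1) F(2)[OF that] unfolding continuous_curve_def continuous_map_def by simp
  then have "\<exists>W. open W \<and> {t \<in> {a..b}. \<gamma> t \<in> U} = {a..b} \<inter> W" if "U \<in> F" for U
    using that unfolding openin_open by blast
  then obtain W where W: "\<And>U. U \<in> F \<Longrightarrow> open (W U)"
    "\<And>U. U \<in> F \<Longrightarrow> {t \<in> {a..b}. \<gamma> t \<in> U} = {a..b} \<inter> W U"
    by metis
  have cover: "{a..b} \<subseteq> \<Union>(W ` F)"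
  proof
    fix t assume t: "t \<in> {a..b}"
    then obtain U where "U \<in> F" "\<gamma> t \<in> U"
      using F(3) by blast
    then show "t \<in> \<Union>(W ` F)"
      using W(2) t by blast
  qed
  \<comment> \<open>A Lebesgue number for the preimages of the cover; \<open>n\<close> is then
    chosen so that steps of length \<open>(b - a) / n\<close> are shorter than it.\<close>
  obtain e where e: "e > 0" "\<And>x. x \<in> {a..b} \<Longrightarrow> \<exists>G\<in>W ` F. ball x e \<subseteq> G"
    by (rule Heine_Borel_lemma[OF compact_Icc cover]) (use W(1) in auto)
  obtain n where n: "(b - a) / e < real n"
    using reals_Archimedean2 by blast
  have "(b - a) / e > 0"
    using ab e by simp
  then have n0: "real n > 0"
    using n by linarith
  define d where "d = (b - a) / real n"
  have d: "0 < d" "d < e" "real n * d = b - a"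
    using n n0 ab e(1) by (simp_all add: d_def field_simps)
  define t where "t i = a + real i * d" for i
  have t0: "t 0 = a" and tn: "t n = b"
    using d(3) by (simp_all add: t_def)
  have mono: "t i \<le> t j" if "i \<le> j" for i j
    using that d(1) unfolding t_def by (intro add_left_mono mult_right_mono) auto
  have in_ab: "t i \<in> {a..b}" if "i \<le> n" for i
    using mono[of 0 i] mono[OF that] t0 tn by simp
  have step: "t (Suc i) - t i = d" for i
    by (simp add: t_def algebra_simps)
  have "curve_length l (t 0) (t n) \<gamma> \<le> of_nat (card F)"
  proof (rule chain_length_le_card[where p = "\<lambda>i. \<gamma> (t i)" and L = "\<lambda>i j. curve_length l (t i) (t j) \<gamma>"])
    fix i assume i: "i < n"
    then obtain U where U: "U \<in> F" "ball (t i) e \<subseteq> W U"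
      using e(2)[OF in_ab[of i]] by auto
    have "t i \<in> ball (t i) e" "t (Suc i) \<in> ball (t i) e"
      using e(1) step[of i] d by (simp_all add: dist_real_def)
    then have "t i \<in> {a..b} \<inter> W U" "t (Suc i) \<in> {a..b} \<inter> W U"
      using U(2) in_ab[of i] in_ab[of "Suc i"] i by auto
    then show "\<exists>U\<in>F. \<gamma> (t i) \<in> U \<and> \<gamma> (t (Suc i)) \<in> U"
      unfolding W(2)[OF U(1), symmetric] using U(1) by blast
  next
    fix U i j assume U: "U \<in> F" "i \<le> j" "j \<le> n" "\<gamma> (t i) \<in> U" "\<gamma> (t j) \<in> U"
    have "a \<le> t i" "t j \<le> b"
      using in_ab[of i] in_ab[of j] U(2,3) by simp_all
    then show "curve_length l (t i) (t j) \<gamma> \<le> 1"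
      using local[OF U(1) _ mono[OF U(2)] _ U(4,5)] by blast
  qed (use F(1) curve_length_add curve_length_self in auto)
  then show ?thesis
    by (simp add: t0 tn)
qed

section \<open>Triangle inequality, separation of slices and finiteness\<close>

section \<open>The distance between slices\<close>

lemma dist_J_commute: "dist_J l A B = dist_J l B A"
  unfolding dist_J_def by (subst SUP_commute) (simp add: add.commute)

lemma le_dist_J: "x \<in> A \<Longrightarrow> y \<in> B \<Longrightarrow> time_sep l x y + time_sep l y x \<le> dist_J l A B"
  unfolding dist_J_def by (meson SUP_upper SUP_upper2)

lemma dist_J_le_iff:
  "dist_J l A B \<le> c \<longleftrightarrow> (\<forall>x\<in>A. \<forall>y\<in>B. time_sep l x y + time_sep l y x \<le> c)"
  unfolding dist_J_def by (simp add: SUP_le_iff)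

lemma time_sep_le_dist_J:
  assumes "x \<in> A" "y \<in> B"
  shows "time_sep l x y \<le> dist_J l A B"
  using le_dist_J[OF assms, of l] by (metis add_increasing2 order_trans zero_le order_refl)

text \<open>What the three classes have in common: (i) has geodesics, while in (ii) and (iii) the
  time separation of chronologically related points is a supremum of lengths. The condition is void
  where the time separation vanishes.\<close>

definition approximable_by_curves :: "'a topology \<Rightarrow> 'a curve_class \<Rightarrow> ('a \<Rightarrow> 'a \<Rightarrow> ereal) \<Rightarrow> bool" where
  "approximable_by_curves T Cv l \<longleftrightarrow>
     (\<forall>x\<in>topspace T. \<forall>y\<in>topspace T. \<forall>c < time_sep l x y.
        \<exists>a b \<gamma>. a \<le> b \<and> causal_curve Cv l {a..b} \<gamma> \<and> \<gamma> a = x \<and> \<gamma> b = y \<and> c < curve_length l a b \<gamma>)"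

context curve_space
begin

lemma chron_slice_crossing:
  assumes S: "chron_slice T l S" and \<gamma>: "continuous_curve T {a..b} \<gamma>" "a \<le> b"
    and p: "p \<in> S" "chron_less l (\<gamma> a) p" and q: "q \<in> S" "chron_less l q (\<gamma> b)"
  obtains t where "t \<in> {a..b}" "\<gamma> t \<in> S"
proof (rule ccontr)
  assume "\<not> thesis"
  then have avoid: "\<gamma> t \<notin> S" if "t \<in> {a..b}" for t
    using that \<open>\<And>t. t \<in> {a..b} \<Longrightarrow> \<gamma> t \<in> S \<Longrightarrow> thesis\<close> by blast
  have X: "\<gamma> t \<in> topspace T" if "t \<in> {a..b}" for t
    using \<gamma>(1) that by (rule continuous_curve_image)
  have SX: "S \<subseteq> topspace T"
    using S unfolding chron_slice_def by blast
  define V where "V = (\<Union>s\<in>S. chron_past T l s)"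
  define W where "W = (\<Union>s\<in>S. chron_future T l s)"
  have "openin T V" "openin T W"
    using pre_length SX unfolding V_def W_def lorentzian_pre_length_space_def by blast+
  then have "openin (top_of_set {a..b}) {t \<in> {a..b}. \<gamma> t \<in> V}"
    and "openin (top_of_set {a..b}) {t \<in> {a..b}. \<gamma> t \<in> W}"
    using \<gamma>(1) unfolding continuous_curve_def continuous_map_def by auto
  moreover have "{a..b} \<subseteq> {t \<in> {a..b}. \<gamma> t \<in> V} \<union> {t \<in> {a..b}. \<gamma> t \<in> W}"
  proof
    fix t assume t: "t \<in> {a..b}"
    then obtain s where "s \<in> S" "s = \<gamma> t \<or> chron_less l (\<gamma> t) s \<or> chron_less l s (\<gamma> t)"
      using S X[OF t] unfolding chron_slice_def by blast
    then show "t \<in> {t \<in> {a..b}. \<gamma> t \<in> V} \<union> {t \<in> {a..b}. \<gamma> t \<in> W}"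
      using avoid[OF t] t X[OF t] by (auto simp: V_def W_def chron_past_def chron_future_def)
  qed
  moreover have "{t \<in> {a..b}. \<gamma> t \<in> V} \<inter> {t \<in> {a..b}. \<gamma> t \<in> W} = {}"
  proof -
    \<comment> \<open>Such a point would lie chronologically between two points of \<open>S\<close>,
      against achronality.\<close>
    have False if x: "x \<in> V" "x \<in> W" for x
    proof -
      obtain r s where "r \<in> S" "s \<in> S" "x \<in> topspace T" "chron_less l x r" "chron_less l s x"
        using x by (auto simp: V_def W_def chron_past_def chron_future_def)
      then show False
        using chron_trans[of s x r] S SX unfolding chron_slice_def by blast
    qed
    then show ?thesis
      by blast
  qed
  moreover have "a \<in> {t \<in> {a..b}. \<gamma> t \<in> V}" "b \<in> {t \<in> {a..b}. \<gamma> t \<in> W}"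
    using p q \<gamma>(2) X by (auto simp: V_def W_def chron_past_def chron_future_def)
  ultimately show False
    using connected_Icc[of a b] unfolding connected_openin by blast
qed

lemma time_sep_le_dist_J_via:
  assumes approx: "approximable_by_curves T Cv l"
    and B: "chron_slice T l B" and AC: "A \<subseteq> topspace T" "C \<subseteq> topspace T"
    and x: "x \<in> A" and z: "z \<in> C" and less: "chron_less l x z"
  shows "time_sep l x z \<le> dist_J l A B + dist_J l B C"
proof -
  have X: "x \<in> topspace T" "z \<in> topspace T" "B \<subseteq> topspace T"
    using AC B x z unfolding chron_slice_def by blast+
  have le: "causal_le l x z"
    using less by (rule chron_less_imp_causal_le)
  obtain p where p: "p \<in> B" "p = x \<or> chron_less l x p \<or> chron_less l p x"
    using B X unfolding chron_slice_def by blast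
  obtain q where q: "q \<in> B" "q = z \<or> chron_less l z q \<or> chron_less l q z"
    using B X unfolding chron_slice_def by blast
  \<comment> \<open>If \<open>p\<close> precedes \<open>x\<close>, replacing \<open>x\<close> by
    \<open>p\<close> can only increase the separation from \<open>z\<close>, and \<open>p\<close>,
    \<open>z\<close> is a pair from \<open>B\<close> and \<open>C\<close>; dually if
    \<open>q\<close> follows \<open>z\<close>. Only the remaining case needs a curve.\<close>
  consider "causal_le l p x" | "causal_le l z q" | "chron_less l x p" "chron_less l q z"
    using p(2) q(2) chron_less_imp_causal_le causal_refl[OF X(1)] causal_refl[OF X(2)] by metis
  then show ?thesis
  proof cases
    case 1
    then have "time_sep l x z \<le> time_sep l p z"
      using time_sep_mono_left[of p x z] X p le by blast
    also have "\<dots> \<le> dist_J l B C"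
      using p z by (intro time_sep_le_dist_J)
    finally show ?thesis
      by (simp add: add_increasing)
  next
    case 2
    then have "time_sep l x z \<le> time_sep l x q"
      using time_sep_mono_right[of x z q] X q le by blast
    also have "\<dots> \<le> dist_J l A B"
      using q x by (intro time_sep_le_dist_J)
    finally show ?thesis
      by (simp add: add_increasing2)
  next
    case 3
    show ?thesis
    proof (rule ccontr)
      \<comment> \<open>The violated bound itself serves as \<open>c\<close> in the approximation,
        so no error term appears.\<close>
      assume "\<not> ?thesis"
      then obtain a b \<gamma> where \<gamma>: "a \<le> b" "causal_curve Cv l {a..b} \<gamma>" "\<gamma> a = x" "\<gamma> b = z"
        and long: "dist_J l A B + dist_J l B C < curve_length l a b \<gamma>"
        using approx X unfolding approximable_by_curves_def not_le by blast
      have cont: "continuous_curve T {a..b} \<gamma>"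
        using \<gamma>(2) continuous unfolding causal_curve_def by blast
      obtain t where t: "t \<in> {a..b}" "\<gamma> t \<in> B"
        using chron_slice_crossing[OF B cont \<gamma>(1) p(1) _ q(1)] \<gamma> 3 by metis
      \<comment> \<open>Achronality keeps the endpoints off \<open>B\<close>. The crossing is
        therefore interior, and both parts are nondegenerate, as the one-step partition
        requires.\<close>
      have "x \<notin> B" "z \<notin> B"
        using 3 p(1) q(1) B unfolding chron_slice_def by blast+
      then have "a < t" "t < b"
        using t \<gamma> by (auto simp: less_le)
      then have "curve_length l a b \<gamma> \<le> time_sep l x (\<gamma> t) + time_sep l (\<gamma> t) z"
        using curve_length_add[of l a b \<gamma> t] curve_length_le_time_sep[of a t l \<gamma>]
          curve_length_le_time_sep[of t b l \<gamma>] \<gamma> by (meson add_mono order_trans)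
      also have "\<dots> \<le> dist_J l A B + dist_J l B C"
        using x z t by (intro add_mono time_sep_le_dist_J)
      finally show False
        using long by simp
    qed
  qed
qed

text \<open>Of \<open>time_sep l x z\<close> and \<open>time_sep l z x\<close> at least one
  vanishes, so each triangle inequality concerns a single direction. Achronality gives distance 0
  from a slice to itself.\<close>

lemma finite_metric_on_slices:
  assumes approx: "approximable_by_curves T Cv l"
    and M: "\<And>S. S \<in> M \<Longrightarrow> chron_slice T l S"
    and fin: "\<And>A B. A \<in> M \<Longrightarrow> B \<in> M \<Longrightarrow> dist_J l A B < \<infinity>"
  shows "finite_metric_on M (dist_J l)"
proof -
  have sub: "S \<subseteq> topspace T" if "S \<in> M" for S
    using M[OF that] unfolding chron_slice_def by blast
  have triangle: "dist_J l A C \<le> dist_J l A B + dist_J l B C" if ABC: "A \<in> M" "B \<in> M" "C \<in> M" for A B C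
    unfolding dist_J_le_iff
  proof (intro ballI)
    fix x z assume xz: "x \<in> A" "z \<in> C"
    have X: "x \<in> topspace T" "z \<in> topspace T"
      using xz ABC sub by blast+
    consider "chron_less l x z" | "chron_less l z x" | "\<not> chron_less l x z" "\<not> chron_less l z x"
      by blast
    then show "time_sep l x z + time_sep l z x \<le> dist_J l A B + dist_J l B C"
    proof cases
      case 1
      then have "time_sep l z x = 0"
        using chron_trans[OF X(1) X(2) X(1)] chron_irrefl[OF X(1)] time_sep_eq_0[of l z x] by blast
      then show ?thesis
        using time_sep_le_dist_J_via[OF approx M[OF ABC(2)] sub[OF ABC(1)] sub[OF ABC(3)] xz 1] by simp
    next
      case 2
      then have "time_sep l x z = 0"
        using chron_trans[OF X(1) X(2) X(1)] chron_irrefl[OF X(1)] time_sep_eq_0[of l x z] by blast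
      then show ?thesis
        using time_sep_le_dist_J_via[OF approx M[OF ABC(2)] sub[OF ABC(3)] sub[OF ABC(1)] xz(2,1) 2]
        by (simp add: dist_J_commute[of l A B] dist_J_commute[of l B C] add.commute)
    qed (simp add: time_sep_eq_0)
  qed
  \<comment> \<open>A point of \<open>A\<close> lies on \<open>B\<close> or is chronologically
    related to a point of \<open>B\<close>; the latter would make the distance positive.\<close>
  have subset: "A \<subseteq> B" if AB: "A \<in> M" "B \<in> M" "dist_J l A B = 0" for A B
  proof
    fix x assume x: "x \<in> A"
    then obtain s where s: "s \<in> B" "s = x \<or> chron_less l x s \<or> chron_less l s x"
      using M[OF AB(2)] sub[OF AB(1)] unfolding chron_slice_def by blast
    have "time_sep l x s + time_sep l s x \<le> 0"
      using le_dist_J[OF x s(1), of l] AB(3) by simp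
    then show "x \<in> B"
      using s by (auto simp: chron_less_def)
  qed
  have zero: "dist_J l A B = 0 \<longleftrightarrow> A = B" if AB: "A \<in> M" "B \<in> M" for A B
  proof
    assume "dist_J l A B = 0"
    then show "A = B"
      using subset AB dist_J_commute[of l A B] by (metis subset_antisym)
  next
    assume "A = B"
    then have "dist_J l A B \<le> 0"
      using M[OF AB(1)] unfolding dist_J_le_iff chron_slice_def by (auto simp: time_sep_eq_0)
    then show "dist_J l A B = 0"
      by simp
  qed
  have "Metric_space M (\<lambda>A B. enn2real (dist_J l A B))"
  proof
    fix A B C assume ABC: "A \<in> M" "B \<in> M" "C \<in> M"
    have "enn2real (dist_J l A C) \<le> enn2real (dist_J l A B + dist_J l B C)"
      using triangle[OF ABC] fin[OF ABC(1,2)] fin[OF ABC(2,3)] by (intro enn2real_mono) auto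
    also have "\<dots> = enn2real (dist_J l A B) + enn2real (dist_J l B C)"
      using fin[OF ABC(1,2)] fin[OF ABC(2,3)] by (intro enn2real_plus) auto
    finally show "enn2real (dist_J l A C) \<le> enn2real (dist_J l A B) + enn2real (dist_J l B C)" .
  next
    fix A B assume AB: "A \<in> M" "B \<in> M"
    show "enn2real (dist_J l A B) = 0 \<longleftrightarrow> A = B"
      using zero[OF AB] fin[OF AB] by (auto simp: enn2real_eq_0_iff)
  qed (simp_all add: dist_J_commute)
  then show ?thesis
    using fin unfolding finite_metric_on_def by blast
qed

text \<open>The bound is twice the size of a finite cover. Membership in a set of the cover has to
  bound all causal curves with both endpoints there, including those that leave the set in
  between.\<close>

lemma dist_J_finite:
  assumes approx: "approximable_by_curves T Cv l" and gh: "globally_hyperbolic T l"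
    and local: "\<And>x. x \<in> topspace T \<Longrightarrow> \<exists>U. openin T U \<and> x \<in> U \<and>
      (\<forall>a b \<gamma>. a \<le> b \<longrightarrow> causal_curve Cv l {a..b} \<gamma> \<longrightarrow> \<gamma> a \<in> U \<longrightarrow> \<gamma> b \<in> U \<longrightarrow> curve_length l a b \<gamma> \<le> 1)"
    and A: "compactin T A" and B: "compactin T B"
  shows "dist_J l A B < \<infinity>"
proof -
  \<comment> \<open>The hull of the union contains the causal curves from \<open>A\<close> to
    \<open>B\<close> as well as those from \<open>B\<close> to \<open>A\<close>.\<close>
  define H where "H = (\<Union>x\<in>A \<union> B. causal_future T l x) \<inter> (\<Union>x\<in>A \<union> B. causal_past T l x)"
  have AB: "A \<union> B \<subseteq> topspace T"
    using A B compactin_subset_topspace by blast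
  have H: "compactin T H"
    using gh compactin_Un[OF A B] unfolding globally_hyperbolic_def H_def by blast
  define good where "good U \<longleftrightarrow> openin T U \<and> (\<forall>a b \<gamma>. a \<le> b \<longrightarrow> causal_curve Cv l {a..b} \<gamma> \<longrightarrow>
      \<gamma> a \<in> U \<longrightarrow> \<gamma> b \<in> U \<longrightarrow> curve_length l a b \<gamma> \<le> 1)" for U
  have "H \<subseteq> \<Union>{U. good U}"
  proof
    fix x assume "x \<in> H"
    then have "x \<in> topspace T"
      using compactin_subset_topspace[OF H] by blast
    from local[OF this] obtain U where "good U" "x \<in> U"
      unfolding good_def by metis
    then show "x \<in> \<Union>{U. good U}"
      by blast
  qed
  then obtain F where F: "finite F" "F \<subseteq> {U. good U}" "H \<subseteq> \<Union>F"
    using H unfolding compactin_def good_def by (metis (no_types, lifting) mem_Collect_eq)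
  have bound: "time_sep l x y \<le> of_nat (card F)" if xy: "x \<in> A \<union> B" "y \<in> A \<union> B" for x y
  proof (rule ccontr)
    assume "\<not> ?thesis"
    then obtain a b \<gamma> where \<gamma>: "a \<le> b" "causal_curve Cv l {a..b} \<gamma>" "\<gamma> a = x" "\<gamma> b = y"
      and long: "of_nat (card F) < curve_length l a b \<gamma>"
      using approx xy AB unfolding approximable_by_curves_def not_le by blast
    have "curve_length l a b \<gamma> \<le> of_nat (card F)"
    proof (rule curve_length_le_card[where T = T])
      show "continuous_curve T {a..b} \<gamma>"
        using \<gamma>(2) continuous unfolding causal_curve_def by blast
      have "\<gamma> t \<in> H" if t: "t \<in> {a..b}" for t
      proof -
        have "causal_le l x (\<gamma> t)" "causal_le l (\<gamma> t) y"
          using causal_curve_le[OF \<gamma>(2)] \<gamma> t by auto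
        then show ?thesis
          using xy causal_image[OF \<gamma>(2) t] unfolding H_def causal_future_def causal_past_def by blast
      qed
      then show "\<gamma> ` {a..b} \<subseteq> \<Union>F"
        using F(3) by blast
      show "curve_length l r s \<gamma> \<le> 1"
        if U: "U \<in> F" "a \<le> r" "r \<le> s" "s \<le> b" "\<gamma> r \<in> U" "\<gamma> s \<in> U" for U r s
      proof -
        have "causal_curve Cv l {r..s} \<gamma>"
          by (rule causal_subset_cong[OF \<gamma>(2)]) (use U in \<open>auto simp: is_interval_1\<close>)
        then show ?thesis
          using F(2) U unfolding good_def by blast
      qed
    qed (use \<gamma>(1) F in \<open>auto simp: good_def\<close>)
    then show False
      using long by simp
  qed
  have "dist_J l A B \<le> of_nat (card F) + of_nat (card F)"
    unfolding dist_J_le_iff using bound by (intro ballI add_mono) auto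
  also have "\<dots> < \<infinity>"
    by (simp add: ennreal_of_nat_eq_real_of_nat flip: ennreal_plus)
  finally show ?thesis .
qed

lemma finite_metric_on_Cauchy_sets:
  assumes approx: "approximable_by_curves T Cv l"
    and fin: "\<And>A B. compactin T A \<Longrightarrow> compactin T B \<Longrightarrow> dist_J l A B < \<infinity>"
  shows "((\<forall>S\<in>strong_Cauchy_sets T Cv l. compactin T S) \<longrightarrow>
           finite_metric_on (strong_Cauchy_sets T Cv l) (dist_J l)) \<and>
         (timelike_path_connected T Cv l \<and> (\<forall>S\<in>Cauchy_sets T Cv l. compactin T S) \<longrightarrow>
           finite_metric_on (Cauchy_sets T Cv l) (dist_J l)) \<and>
         (timelike_path_connected T Cv l \<and>
          (\<forall>x\<in>topspace T. \<exists>I \<gamma>. Cauchy_complete_timelike_curve Cv l I \<gamma> \<and> x \<in> \<gamma> ` I) \<and>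
          (\<forall>S\<in>weak_Cauchy_sets T Cv l. compactin T S) \<longrightarrow>
           finite_metric_on (weak_Cauchy_sets T Cv l) (dist_J l))"
proof (intro conjI impI)
  \<comment> \<open>Approximation with \<open>c = 0\<close>: positive separation already yields some
    causal curve.\<close>
  have connected: "\<exists>a b \<gamma>. a \<le> b \<and> causal_curve Cv l {a..b} \<gamma> \<and> \<gamma> a = x \<and> \<gamma> b = y"
    if "x \<in> topspace T" "y \<in> topspace T" "chron_less l x y" for x y
    using approx that unfolding approximable_by_curves_def chron_less_def by blast
  have metric: "finite_metric_on M (dist_J l)"
    if "\<And>S. S \<in> M \<Longrightarrow> chron_slice T l S" "\<forall>S\<in>M. compactin T S" for M
    by (rule finite_metric_on_slices[OF approx]) (use that fin in auto)
  show "finite_metric_on (strong_Cauchy_sets T Cv l) (dist_J l)"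
    if h: "\<forall>S\<in>strong_Cauchy_sets T Cv l. compactin T S"
  proof (rule metric[OF _ h])
    show "chron_slice T l S" if "S \<in> strong_Cauchy_sets T Cv l" for S
      using that connected by (rule chron_slice_strong_Cauchy)
  qed
  show "finite_metric_on (Cauchy_sets T Cv l) (dist_J l)"
    if h: "timelike_path_connected T Cv l \<and> (\<forall>S\<in>Cauchy_sets T Cv l. compactin T S)"
  proof (rule metric)
    show "chron_slice T l S" if "S \<in> Cauchy_sets T Cv l" for S
      using that h by (blast intro: chron_slice_Cauchy)
  qed (use h in blast)
  show "finite_metric_on (weak_Cauchy_sets T Cv l) (dist_J l)"
    if h: "timelike_path_connected T Cv l \<and>
          (\<forall>x\<in>topspace T. \<exists>I \<gamma>. Cauchy_complete_timelike_curve Cv l I \<gamma> \<and> x \<in> \<gamma> ` I) \<and>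
          (\<forall>S\<in>weak_Cauchy_sets T Cv l. compactin T S)"
  proof (rule metric)
    show "chron_slice T l S" if S: "S \<in> weak_Cauchy_sets T Cv l" for S
    proof (rule chron_slice_weak_Cauchy[OF S])
      show "\<exists>I \<gamma>. Cauchy_complete_timelike_curve Cv l I \<gamma> \<and> x \<in> \<gamma> ` I" if "x \<in> topspace T" for x
        using h that by simp
    qed (use h in simp)
  qed (use h in blast)
qed

end

section \<open>Irreflexivity, continuation of curves and local length bounds in each class\<close>

section \<open>The three classes of spaces\<close>

text \<open>The family \<open>P\<close> of lengths is left open, because in one class the supremum
  runs over injective curves and in the other over all causal curves.\<close>

lemma lengths_less_time_sep:
  assumes "\<And>x y. \<lbrakk>x \<in> topspace T; y \<in> topspace T; chron_less l x y\<rbrakk> \<Longrightarrow> time_sep l x y = Sup (P x y)"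
    and "\<And>x y L. L \<in> P x y \<Longrightarrow> \<exists>a b \<gamma>. a \<le> b \<and> causal_curve Cv l {a..b} \<gamma> \<and> \<gamma> a = x \<and> \<gamma> b = y \<and> L = curve_length l a b \<gamma>"
  shows "approximable_by_curves T Cv l"
  unfolding approximable_by_curves_def
proof (intro ballI allI impI)
  fix x y c assume xy: "x \<in> topspace T" "y \<in> topspace T" and c: "c < time_sep l x y"
  then have "chron_less l x y"
    unfolding chron_less_def using zero_le order_le_less_trans by blast
  then obtain L where "L \<in> P x y" "c < L"
    using assms(1)[OF xy] c by (auto simp: less_Sup_iff)
  then show "\<exists>a b \<gamma>. a \<le> b \<and> causal_curve Cv l {a..b} \<gamma> \<and> \<gamma> a = x \<and> \<gamma> b = y \<and> c < curve_length l a b \<gamma>"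
    using assms(2) by metis
qed

text \<open>Stated for \<open>curve_class\<close> alone, since it serves to establish
  \<open>curve_space\<close>.\<close>

lemma curve_class_timelike_subset:
  assumes "curve_class T Cv" "timelike_curve Cv l I \<gamma>" "a \<in> I" "b \<in> I" "a \<le> b"
  shows "timelike_curve Cv l {a..b} \<gamma>"
proof -
  interpret curve_class T Cv
    by (rule assms(1))
  have I: "is_interval I"
    using assms(2) continuous unfolding timelike_curve_def continuous_curve_def by blast
  have sub: "{a..b} \<subseteq> I"
  proof
    fix t assume "t \<in> {a..b}"
    then show "t \<in> I"
      using I assms(3,4) unfolding is_interval_1 by (metis atLeastAtMost_iff)
  qed
  moreover have "Cv {a..b} \<gamma>"
  proof (rule subset_cong[OF _ _ _ sub])
    show "Cv I \<gamma>"
      using assms(2) unfolding timelike_curve_def by blast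
  qed (use assms(5) in \<open>auto simp: is_interval_1\<close>)
  ultimately show ?thesis
    using assms(2) unfolding timelike_curve_def by blast
qed

subsection \<open>Bykov-Minguzzi-Suhr spaces\<close>

lemma BMS_causal_le_iff:
  assumes d: "BMS_Lorentzian_metric_space T d"
    and l: "\<forall>x\<in>topspace T. \<forall>y\<in>topspace T. l x y = (if BMS_causal_le T d x y then ereal (d x y) else -\<infinity>)"
    and "x \<in> topspace T" "y \<in> topspace T"
  shows "causal_le l x y \<longleftrightarrow> BMS_causal_le T d x y"
  using assms unfolding causal_le_def BMS_Lorentzian_metric_space_def by simp

text \<open>If \<open>x\<close> and \<open>y\<close> precede each other, all their distances agree,
  and the separation axiom identifies them. As \<open>d\<close> is real-valued,
  \<open>2 d(x,x) \<le> d(x,x)\<close> excludes loops. On a chronological boundary the causal future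
  or past is a single point, as there are no bubbles; elsewhere a timelike extension is cut down to
  a compact interval.\<close>

lemma curve_space_BMS:
  assumes pre: "lorentzian_pre_length_space T l" and sep: "separable_space T"
    and BMS: "BMS_Lorentzian_length_space T l" and bub: "empty_bubbling_boundary T l"
    and ext: "timelike_extensions T (continuous_curve T) l"
  shows "curve_space T (continuous_curve T) l"
proof -
  obtain d where d: "BMS_Lorentzian_metric_space T d"
    and l: "\<forall>x\<in>topspace T. \<forall>y\<in>topspace T. l x y = (if BMS_causal_le T d x y then ereal (d x y) else -\<infinity>)"
    using BMS unfolding BMS_Lorentzian_length_space_def by blast
  interpret C: curve_class T "continuous_curve T"
    by (rule curve_class_continuous)
  show ?thesis
  proof
    show "causal_space T l"
      unfolding causal_space_def
    proof (intro ballI impI)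
      fix x y assume xy: "x \<in> topspace T" "y \<in> topspace T" "causal_le l x y" "causal_le l y x"
      have "BMS_causal_le T d x y" "BMS_causal_le T d y x"
        using xy BMS_causal_le_iff[OF d l] by blast+
      then have "\<forall>z\<in>topspace T. d x z = d y z \<and> d z x = d z y"
        unfolding BMS_causal_le_def by (meson order_antisym)
      moreover have "\<forall>x\<in>topspace T. \<forall>y\<in>topspace T. x \<noteq> y \<longrightarrow>
          (\<exists>z\<in>topspace T. d x z \<noteq> d y z \<or> d z x \<noteq> d z y)"
        using d unfolding BMS_Lorentzian_metric_space_def by (elim conjE) assumption
      ultimately show "x = y"
        using xy(1,2) by blast
    qed
    show "\<not> chron_less l x x" if x: "x \<in> topspace T" for x
    proof
      assume "chron_less l x x"
      then have "0 < d x x"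
        using l x by (auto simp: chron_less_iff split: if_splits)
      moreover have "\<forall>x\<in>topspace T. \<forall>y\<in>topspace T. \<forall>z\<in>topspace T.
          0 < d x y \<longrightarrow> 0 < d y z \<longrightarrow> d x y + d y z \<le> d x z"
        using d unfolding BMS_Lorentzian_metric_space_def by (elim conjE) assumption
      ultimately have "d x x + d x x \<le> d x x"
        using x by blast
      then show False
        using \<open>0 < d x x\<close> by simp
    qed
    show "causal_future T l x = {x} \<or>
        (\<exists>a b \<gamma>. a < b \<and> timelike_curve (continuous_curve T) l {a..b} \<gamma> \<and> \<gamma> a = x)"
      if x: "x \<in> topspace T" for x
    proof (cases "x \<in> future_chron_boundary T l")
      case True
      then show ?thesis
        using bub unfolding empty_bubbling_boundary_def future_causal_boundary_def by blast
    next
      case False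
      then obtain I \<gamma> a where \<gamma>: "timelike_curve (continuous_curve T) l I \<gamma>" "\<not> \<gamma> constant_on I"
        "a \<in> I" "\<forall>t\<in>I. a \<le> t" "\<gamma> a = x"
        using ext x unfolding timelike_extensions_def by blast
      then obtain b where b: "b \<in> I" "\<gamma> b \<noteq> \<gamma> a"
        unfolding constant_on_def by blast
      then have "a < b"
        using \<gamma>(4) by (metis less_eq_real_def)
      then show ?thesis
        using curve_class_timelike_subset[OF C.curve_class_axioms \<gamma>(1,3) b(1)] \<gamma>(5) less_imp_le by blast
    qed
    show "causal_past T l x = {x} \<or>
        (\<exists>a b \<gamma>. a < b \<and> timelike_curve (continuous_curve T) l {a..b} \<gamma> \<and> \<gamma> b = x)"
      if x: "x \<in> topspace T" for x
    proof (cases "x \<in> past_chron_boundary T l")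
      case True
      then show ?thesis
        using bub unfolding empty_bubbling_boundary_def past_causal_boundary_def by blast
    next
      case False
      then obtain I \<gamma> b where \<gamma>: "timelike_curve (continuous_curve T) l I \<gamma>" "\<not> \<gamma> constant_on I"
        "b \<in> I" "\<forall>t\<in>I. t \<le> b" "\<gamma> b = x"
        using ext x unfolding timelike_extensions_def by blast
      then obtain a where a: "a \<in> I" "\<gamma> a \<noteq> \<gamma> b"
        unfolding constant_on_def by blast
      then have "a < b"
        using \<gamma>(4) by (metis less_eq_real_def)
      then show ?thesis
        using curve_class_timelike_subset[OF C.curve_class_axioms \<gamma>(1) a(1) \<gamma>(3)] \<gamma>(5) less_imp_le by blast
    qed
  qed (use pre sep in auto)
qed

text \<open>A geodesic attains the time separation, hence exceeds every smaller
  \<open>c\<close>.\<close>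

lemma approximable_BMS:
  assumes "BMS_Lorentzian_length_space T l"
  shows "approximable_by_curves T (continuous_curve T) l"
  unfolding approximable_by_curves_def
proof (intro ballI allI impI)
  fix x y c assume xy: "x \<in> topspace T" "y \<in> topspace T" and c: "c < time_sep l x y"
  then have "chron_less l x y"
    unfolding chron_less_def using zero_le order_le_less_trans by blast
  then have "causal_le l x y"
    by (rule chron_less_imp_causal_le)
  then show "\<exists>a b \<gamma>. a \<le> b \<and> causal_curve (continuous_curve T) l {a..b} \<gamma> \<and> \<gamma> a = x \<and> \<gamma> b = y \<and>
      c < curve_length l a b \<gamma>"
    using assms xy c unfolding BMS_Lorentzian_length_space_def geodesic_space_def by metis
qed

lemma dist_J_finite_BMS:
  assumes BMS: "BMS_Lorentzian_length_space T l" and A: "compactin T A" and B: "compactin T B"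
  shows "dist_J l A B < \<infinity>"
proof -
  obtain d where d: "BMS_Lorentzian_metric_space T d"
    and l: "\<forall>x\<in>topspace T. \<forall>y\<in>topspace T. l x y = (if BMS_causal_le T d x y then ereal (d x y) else -\<infinity>)"
    using BMS unfolding BMS_Lorentzian_length_space_def by blast
  have bounded: "\<exists>M. \<forall>x\<in>A. \<forall>y\<in>B. d x y \<le> M" if AB: "compactin T A" "compactin T B" for A B
  proof -
    have "compactin euclideanreal ((\<lambda>(x, y). d x y) ` (A \<times> B))"
      using d AB unfolding BMS_Lorentzian_metric_space_def
      by (intro image_compactin[of "prod_topology T T"]) (simp_all add: compactin_Times)
    then have "bdd_above ((\<lambda>(x, y). d x y) ` (A \<times> B))"
      by (simp add: bounded_imp_bdd_above compact_imp_bounded)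
    then show ?thesis
      unfolding bdd_above_def by fastforce
  qed
  obtain M where M: "\<And>x y. x \<in> A \<Longrightarrow> y \<in> B \<Longrightarrow> d x y \<le> M"
    using bounded[OF A B] by blast
  obtain N where N: "\<And>x y. x \<in> A \<Longrightarrow> y \<in> B \<Longrightarrow> d y x \<le> N"
    using bounded[OF B A] by blast
  have le: "time_sep l x y \<le> ennreal K" if "x \<in> topspace T" "y \<in> topspace T" "d x y \<le> K" for x y K
  proof -
    have "max 0 (l x y) \<le> max 0 (ereal K)"
      using l that by (auto simp: max_def)
    then have "time_sep l x y \<le> e2ennreal (max 0 (ereal K))"
      unfolding time_sep_def by (rule e2ennreal_mono)
    \<comment> \<open>For negative \<open>K\<close> both sides are 0.\<close>
    also have "\<dots> = ennreal K"
      by (simp add: max_def ennreal_neg e2ennreal_neg)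
    finally show ?thesis .
  qed
  have "dist_J l A B \<le> ennreal M + ennreal N"
    unfolding dist_J_le_iff
    using le M N compactin_subset_topspace[OF A] compactin_subset_topspace[OF B]
    by (meson add_mono subsetD)
  also have "\<dots> < \<infinity>"
    by simp
  finally show ?thesis .
qed

subsection \<open>Braun-McCann spaces\<close>

text \<open>An injective curve from \<open>x\<close> to \<open>x\<close> lives on a single parameter
  and has length 0, so the length formula excludes loops. The timelike curve with midpoint
  \<open>x\<close> splits into a past and a future half.\<close>

lemma curve_space_BM:
  assumes sep: "separable_space T" and BM: "BM_length_metric_spacetime T l"
  shows "curve_space T (continuous_curve T) l"
proof -
  interpret C: curve_class T "continuous_curve T"
    by (rule curve_class_continuous)
  have mid: "\<exists>\<gamma>. timelike_curve (continuous_curve T) l {0..1} \<gamma> \<and> \<gamma> (1/2) = x" if "x \<in> topspace T" for x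
    using BM that unfolding BM_length_metric_spacetime_def by blast
  show ?thesis
  proof
    show "lorentzian_pre_length_space T l" "causal_space T l"
      using BM unfolding BM_length_metric_spacetime_def by blast+
    show "\<not> chron_less l x x" if x: "x \<in> topspace T" for x
    proof
      assume less: "chron_less l x x"
      have "time_sep l x x = Sup {curve_length l a b \<gamma> | a b \<gamma>.
          a \<le> b \<and> causal_curve (continuous_curve T) l {a..b} \<gamma> \<and> inj_on \<gamma> {a..b} \<and> \<gamma> a = x \<and> \<gamma> b = x}"
        using BM less x unfolding BM_length_metric_spacetime_def by blast
      also have "\<dots> \<le> 0"
      proof (rule Sup_least, clarify)
        fix a b and \<gamma> :: "real \<Rightarrow> 'a" assume "a \<le> b" "inj_on \<gamma> {a..b}" "\<gamma> b = \<gamma> a"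
        then have "a = b"
          by (metis atLeastAtMost_iff inj_onD order_refl)
        then show "curve_length l a b \<gamma> \<le> 0"
          by (simp add: curve_length_self)
      qed
      finally show False
        using less by (simp add: chron_less_def)
    qed
    show "causal_future T l x = {x} \<or>
        (\<exists>a b \<gamma>. a < b \<and> timelike_curve (continuous_curve T) l {a..b} \<gamma> \<and> \<gamma> a = x)"
      if x: "x \<in> topspace T" for x
    proof -
      obtain \<gamma> where "timelike_curve (continuous_curve T) l {0..1} \<gamma>" "\<gamma> (1/2) = x"
        using mid[OF x] by blast
      then show ?thesis
        using curve_class_timelike_subset[OF C.curve_class_axioms, of l "{0..1}" \<gamma> "1/2" 1]
        by (intro disjI2 exI[of _ "1/2"] exI[of _ 1] exI[of _ \<gamma>]) simp
    qed
    show "causal_past T l x = {x} \<or>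
        (\<exists>a b \<gamma>. a < b \<and> timelike_curve (continuous_curve T) l {a..b} \<gamma> \<and> \<gamma> b = x)"
      if x: "x \<in> topspace T" for x
    proof -
      obtain \<gamma> where "timelike_curve (continuous_curve T) l {0..1} \<gamma>" "\<gamma> (1/2) = x"
        using mid[OF x] by blast
      then show ?thesis
        using curve_class_timelike_subset[OF C.curve_class_axioms, of l "{0..1}" \<gamma> 0 "1/2"]
        by (intro disjI2 exI[of _ 0] exI[of _ "1/2"] exI[of _ \<gamma>]) simp
    qed
  qed (rule sep)
qed

lemma approximable_BM:
  assumes "BM_length_metric_spacetime T l"
  shows "approximable_by_curves T (continuous_curve T) l"
proof (rule lengths_less_time_sep)
  show "time_sep l x y = Sup {curve_length l a b \<gamma> | a b \<gamma>.
      a \<le> b \<and> causal_curve (continuous_curve T) l {a..b} \<gamma> \<and> inj_on \<gamma> {a..b} \<and> \<gamma> a = x \<and> \<gamma> b = y}"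
    if "x \<in> topspace T" "y \<in> topspace T" "chron_less l x y" for x y
    using assms that unfolding BM_length_metric_spacetime_def by blast
qed blast

text \<open>Upper semicontinuity of \<open>l\<close> at the diagonal:
  \<open>l x x \<le> 0 < 1\<close> gives neighborhoods on which \<open>l < 1\<close>, and length is
  at most time separation.\<close>

lemma dist_J_finite_BM:
  assumes sep: "separable_space T" and gh: "globally_hyperbolic T l" and BM: "BM_length_metric_spacetime T l"
    and AB: "compactin T A" "compactin T B"
  shows "dist_J l A B < \<infinity>"
proof -
  interpret curve_space T "continuous_curve T" l
    using sep BM by (rule curve_space_BM)
  show ?thesis
  proof (rule dist_J_finite[OF approximable_BM[OF BM] gh _ AB])
    fix x assume x: "x \<in> topspace T"
    have "l x x \<le> 0"
      using chron_irrefl[OF x] by (simp add: chron_less_iff not_less)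
    then have "l x x < 1"
      by (rule order_le_less_trans) simp
    then have xx: "(x, x) \<in> {(x, y). x \<in> topspace T \<and> y \<in> topspace T \<and> l x y < 1}"
      using x by simp
    have "openin (prod_topology T T) {(x, y). x \<in> topspace T \<and> y \<in> topspace T \<and> l x y < 1}"
      using BM unfolding BM_length_metric_spacetime_def by blast
    from this[unfolded openin_prod_topology_alt, rule_format, OF xx] obtain U V where UV: "openin T U" "openin T V" "x \<in> U" "x \<in> V"
      "U \<times> V \<subseteq> {(x, y). x \<in> topspace T \<and> y \<in> topspace T \<and> l x y < 1}"
      by blast
    have "curve_length l a b \<gamma> \<le> 1" if "a \<le> b" "\<gamma> a \<in> U \<inter> V" "\<gamma> b \<in> U \<inter> V" for a b and \<gamma> :: "real \<Rightarrow> 'a"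
    proof (cases "a = b")
      case False
      have "max 0 (l (\<gamma> a) (\<gamma> b)) \<le> ereal 1"
        using UV(5) that by (auto simp: one_ereal_def)
      then have "time_sep l (\<gamma> a) (\<gamma> b) \<le> 1"
        unfolding time_sep_def using e2ennreal_mono by fastforce
      then show ?thesis
        using curve_length_le_time_sep[of a b l \<gamma>] False that(1) by (meson less_eq_real_def order_trans)
    qed (simp add: curve_length_self)
    then show "\<exists>U. openin T U \<and> x \<in> U \<and> (\<forall>a b \<gamma>. a \<le> b \<longrightarrow> causal_curve (continuous_curve T) l {a..b} \<gamma> \<longrightarrow>
        \<gamma> a \<in> U \<longrightarrow> \<gamma> b \<in> U \<longrightarrow> curve_length l a b \<gamma> \<le> 1)"
      using UV by (intro exI[of _ "U \<inter> V"]) (simp add: openin_Int)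
  qed
qed

subsection \<open>Kunzinger-Saemann spaces\<close>

text \<open>A closed causal curve is constant by antisymmetry, hence degenerate and of length 0;
  this excludes loops. Localizing neighborhoods provide chronological neighbors of every point, and
  timelike path-connectedness turns them into curves.\<close>

lemma curve_space_KS:
  assumes sep: "separable_space T" and gh: "globally_hyperbolic T l" and KS: "KS_Lorentzian_length_space T \<rho> l"
  shows "curve_space T (locally_Lipschitz_curve T \<rho>) l"
proof -
  let ?Cv = "locally_Lipschitz_curve T \<rho>"
  have KS_pre: "KS_pre_length_space T \<rho> l"
    using KS unfolding KS_Lorentzian_length_space_def by blast
  interpret C: curve_class T ?Cv
    by (rule curve_class_locally_Lipschitz) (use KS_pre in \<open>simp add: KS_pre_length_space_def\<close>)
  have causal: "causal_space T l"
    using gh unfolding globally_hyperbolic_def by blast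
  have irrefl: "\<not> chron_less l x x" if x: "x \<in> topspace T" for x
  proof
    assume less: "chron_less l x x"
    have "time_sep l x x = Sup {curve_length l a b \<gamma> | a b \<gamma>.
        a \<le> b \<and> causal_curve ?Cv l {a..b} \<gamma> \<and> \<gamma> a = x \<and> \<gamma> b = x}"
      using KS less x unfolding KS_Lorentzian_length_space_def by blast
    also have "\<dots> \<le> 0"
    proof (rule Sup_least, clarify)
      fix a b and \<gamma> :: "real \<Rightarrow> 'a" assume \<gamma>: "a \<le> b" "causal_curve ?Cv l {a..b} \<gamma>" "x = \<gamma> a" "\<gamma> b = \<gamma> a"
      have "\<gamma> t = \<gamma> a" if t: "t \<in> {a..b}" for t
      proof (cases "t = a \<or> t = b")
        case False
        then have "causal_le l (\<gamma> a) (\<gamma> t)" "causal_le l (\<gamma> t) (\<gamma> b)"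
          using \<gamma>(1,2) t unfolding causal_curve_def by auto
        moreover have "\<gamma> t \<in> topspace T"
          using \<gamma>(2) t C.continuous continuous_curve_image unfolding causal_curve_def by blast
        ultimately show ?thesis
          using causal x \<gamma>(3,4) unfolding causal_space_def by metis
      qed (use \<gamma> in auto)
      then have "\<gamma> constant_on {a..b}"
        unfolding constant_on_def by blast
      then have "a = b"
        using \<gamma>(1,2) unfolding causal_curve_def by (metis atLeastAtMost_iff less_eq_real_def order_refl)
      then show "curve_length l a b \<gamma> \<le> 0"
        by (simp add: curve_length_self)
    qed
    finally show False
      using less by (simp add: chron_less_def)
  qed
  have tpc: "timelike_path_connected T ?Cv l"
    using KS unfolding KS_Lorentzian_length_space_def by blast
  have curve: "\<exists>a b \<gamma>. a < b \<and> timelike_curve ?Cv l {a..b} \<gamma> \<and> \<gamma> a = x \<and> \<gamma> b = y"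
    if xy: "x \<in> topspace T" "y \<in> topspace T" "chron_less l x y" for x y
  proof -
    obtain a b \<gamma> where \<gamma>: "a \<le> b" "timelike_curve ?Cv l {a..b} \<gamma>" "\<gamma> a = x" "\<gamma> b = y"
      using tpc xy unfolding timelike_path_connected_def by blast
    moreover have "a \<noteq> b"
      using \<gamma> xy irrefl by metis
    ultimately show ?thesis
      by (metis less_eq_real_def)
  qed
  have nonempty: "chron_future T l x \<noteq> {} \<and> chron_past T l x \<noteq> {}" if x: "x \<in> topspace T" for x
  proof -
    obtain \<Omega> where \<Omega>: "x \<in> \<Omega>" "KS_localizing T \<rho> l \<Omega>"
      using KS x unfolding KS_Lorentzian_length_space_def by blast
    then have "\<forall>y\<in>\<Omega>. chron_future T l y \<inter> \<Omega> \<noteq> {} \<and> chron_past T l y \<inter> \<Omega> \<noteq> {}"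
      unfolding KS_localizing_def by (elim conjE) assumption
    then show ?thesis
      using \<Omega>(1) by blast
  qed
  show ?thesis
  proof
    show "lorentzian_pre_length_space T l"
      using KS_pre unfolding KS_pre_length_space_def by blast
    fix x assume x: "x \<in> topspace T"
    obtain y where "y \<in> topspace T" "chron_less l x y"
      using nonempty[OF x] unfolding chron_future_def by blast
    then show "causal_future T l x = {x} \<or> (\<exists>a b \<gamma>. a < b \<and> timelike_curve ?Cv l {a..b} \<gamma> \<and> \<gamma> a = x)"
      using curve[OF x] by blast
    obtain y where "y \<in> topspace T" "chron_less l y x"
      using nonempty[OF x] unfolding chron_past_def by blast
    then show "causal_past T l x = {x} \<or> (\<exists>a b \<gamma>. a < b \<and> timelike_curve ?Cv l {a..b} \<gamma> \<and> \<gamma> b = x)"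
      using curve[OF _ x] by blast
  qed (use sep causal irrefl in auto)
qed

lemma approximable_KS:
  assumes "KS_Lorentzian_length_space T \<rho> l"
  shows "approximable_by_curves T (locally_Lipschitz_curve T \<rho>) l"
proof (rule lengths_less_time_sep)
  show "time_sep l x y = Sup {curve_length l a b \<gamma> | a b \<gamma>.
      a \<le> b \<and> causal_curve (locally_Lipschitz_curve T \<rho>) l {a..b} \<gamma> \<and> \<gamma> a = x \<and> \<gamma> b = y}"
    if "x \<in> topspace T" "y \<in> topspace T" "chron_less l x y" for x y
    using assms that unfolding KS_Lorentzian_length_space_def by blast
qed blast

text \<open>Strong causality in the form needed for localization. Otherwise there are points
  \<open>z n\<close> outside \<Omega> between \<open>p n\<close> and \<open>q n\<close>, both
  converging to \<open>x\<close>. Compactness of causal hulls gives a limit point \<open>w\<close>,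
  closedness of the relation puts it before and after \<open>x\<close>, and antisymmetry puts it at
  \<open>x\<close>, inside \<Omega>.\<close>

lemma strongly_causal:
  assumes M: "Metric_space (topspace T) \<rho>" "Metric_space.mtopology (topspace T) \<rho> = T"
    and gh: "globally_hyperbolic T l" and \<Omega>: "openin T \<Omega>" "x \<in> \<Omega>"
  obtains U where "openin T U" "x \<in> U"
    "\<And>p q z. \<lbrakk>p \<in> U; q \<in> U; z \<in> topspace T; causal_le l p z; causal_le l z q\<rbrakk> \<Longrightarrow> z \<in> \<Omega>"
proof (rule ccontr)
  assume none: "\<not> thesis"
  interpret Metric_space "topspace T" \<rho>
    by (rule M(1))
  have x: "x \<in> topspace T"
    using \<Omega> openin_subset by blast
  have "\<exists>p q z. p \<in> mball x (inverse (real (Suc n))) \<and> q \<in> mball x (inverse (real (Suc n))) \<and>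
      z \<in> topspace T \<and> causal_le l p z \<and> causal_le l z q \<and> z \<notin> \<Omega>" for n
  proof (rule ccontr)
    assume neg: "\<nexists>p q z. p \<in> mball x (inverse (real (Suc n))) \<and> q \<in> mball x (inverse (real (Suc n))) \<and>
      z \<in> topspace T \<and> causal_le l p z \<and> causal_le l z q \<and> z \<notin> \<Omega>"
    have "openin T (mball x (inverse (real (Suc n))))"
      using openin_mball M(2) by metis
    moreover have "x \<in> mball x (inverse (real (Suc n)))"
      using x by simp
    ultimately show False
      using that none neg by blast
  qed
  then obtain p q z where pqz: "\<And>n. p n \<in> mball x (inverse (real (Suc n)))"
    "\<And>n. q n \<in> mball x (inverse (real (Suc n)))" "\<And>n. z n \<in> topspace T"
    "\<And>n. causal_le l (p n) (z n)" "\<And>n. causal_le l (z n) (q n)" "\<And>n. z n \<notin> \<Omega>"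
    by metis
  have lim: "limitin T u x sequentially" if u: "\<And>n. u n \<in> mball x (inverse (real (Suc n)))" for u
  proof -
    have "limitin mtopology u x sequentially"
      unfolding limit_metric_sequentially
    proof (intro conjI allI impI)
      fix e :: real assume "e > 0"
      then obtain N where N: "inverse (real (Suc N)) < e"
        using reals_Archimedean by blast
      have "u n \<in> topspace T \<and> \<rho> (u n) x < e" if "N \<le> n" for n
      proof -
        have "inverse (real (Suc n)) \<le> inverse (real (Suc N))"
          using that by (intro le_imp_inverse_le) auto
        moreover have "u n \<in> topspace T" "\<rho> x (u n) < inverse (real (Suc n))"
          using u[of n] by simp_all
        ultimately show ?thesis
          using N commute[of "u n" x] by linarith
      qed
      then show "\<exists>N. \<forall>n\<ge>N. u n \<in> topspace T \<and> \<rho> (u n) x < e"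
        by blast
    qed (rule x)
    then show ?thesis
      using M(2) by simp
  qed
  have lim_p: "limitin T p x sequentially" and lim_q: "limitin T q x sequentially"
    using lim pqz(1,2) by blast+
  have p: "range p \<subseteq> topspace T" and q: "range q \<subseteq> topspace T"
    using pqz(1,2) by auto
  \<comment> \<open>The two sequences with their limit form a compact set, whose causal hull
    contains all \<open>z n\<close>.\<close>
  define K where "K = insert x (range p) \<union> insert x (range q)"
  have "compactin T K"
    unfolding K_def using compactin_sequence_with_limit[OF lim_p order_refl p]
      compactin_sequence_with_limit[OF lim_q order_refl q] by (rule compactin_Un)
  then have "compactin T ((\<Union>x\<in>K. causal_future T l x) \<inter> (\<Union>x\<in>K. causal_past T l x))"
    using gh unfolding globally_hyperbolic_def by blast
  then have "compactin mtopology ((\<Union>x\<in>K. causal_future T l x) \<inter> (\<Union>x\<in>K. causal_past T l x))"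
    using M(2) by simp
  moreover have "range z \<subseteq> (\<Union>x\<in>K. causal_future T l x) \<inter> (\<Union>x\<in>K. causal_past T l x)"
    using pqz(3-5) unfolding K_def causal_future_def causal_past_def by blast
  ultimately obtain w r where r: "strict_mono r" "limitin mtopology (z \<circ> r) w sequentially"
    unfolding compactin_sequentially by meson
  then have lim_z: "limitin T (z \<circ> r) w sequentially"
    using M(2) by simp
  define R where "R = {(x, y). x \<in> topspace T \<and> y \<in> topspace T \<and> causal_le l x y}"
  have R: "closedin (prod_topology T T) R" and causal: "causal_space T l"
    using gh unfolding globally_hyperbolic_def R_def by blast+
  have "(x, w) \<in> R"
  proof (rule limitin_closedin[OF _ R])
    show "limitin (prod_topology T T) (\<lambda>n. (p (r n), z (r n))) (x, w) sequentially"
      using limitin_subsequence[OF r(1) lim_p] lim_z by (simp add: limitin_pairwise o_def)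
  qed (use pqz p in \<open>auto simp: R_def\<close>)
  moreover have "(w, x) \<in> R"
  proof (rule limitin_closedin[OF _ R])
    show "limitin (prod_topology T T) (\<lambda>n. (z (r n), q (r n))) (w, x) sequentially"
      using limitin_subsequence[OF r(1) lim_q] lim_z by (simp add: limitin_pairwise o_def)
  qed (use pqz q in \<open>auto simp: R_def\<close>)
  ultimately have "w = x"
    using causal unfolding R_def causal_space_def by blast
  then have "\<forall>\<^sub>F n in sequentially. (z \<circ> r) n \<in> \<Omega>"
    using lim_z \<Omega> unfolding limitin_def by blast
  then show False
    using pqz(6) by (simp add: eventually_sequentially)
qed

text \<open>Lower semicontinuity of the time separation gives no upper bound near the diagonal. The
  local distance \<omega> is continuous and vanishes at \<open>(x, x)\<close>; it bounds the curves
  that stay in \<Omega>, and strong causality makes curves with endpoints near \<open>x\<close> stay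
  there.\<close>

lemma dist_J_finite_KS:
  assumes sep: "separable_space T" and gh: "globally_hyperbolic T l" and KS: "KS_Lorentzian_length_space T \<rho> l"
    and AB: "compactin T A" "compactin T B"
  shows "dist_J l A B < \<infinity>"
proof -
  let ?Cv = "locally_Lipschitz_curve T \<rho>"
  interpret curve_space T ?Cv l
    using sep gh KS by (rule curve_space_KS)
  have KS_pre: "Metric_space (topspace T) \<rho>" "Metric_space.mtopology (topspace T) \<rho> = T"
    using KS unfolding KS_Lorentzian_length_space_def KS_pre_length_space_def by blast+
  show ?thesis
  proof (rule dist_J_finite[OF approximable_KS[OF KS] gh _ AB])
    fix x assume x: "x \<in> topspace T"
    obtain \<Omega> where \<Omega>: "openin T \<Omega>" "x \<in> \<Omega>" and loc: "KS_localizing T \<rho> l \<Omega>"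
      using KS x unfolding KS_Lorentzian_length_space_def by blast
    obtain \<omega> :: "'a \<Rightarrow> 'a \<Rightarrow> real" where
      cont: "continuous_map (prod_topology (subtopology T \<Omega>) (subtopology T \<Omega>)) euclideanreal (\<lambda>(p, q). \<omega> p q)"
      and chron: "\<forall>p\<in>\<Omega>. \<forall>q\<in>\<Omega>. 0 < \<omega> p q \<longleftrightarrow> chron_less l p q"
      and maximal: "\<forall>p\<in>\<Omega>. \<forall>q\<in>\<Omega>. causal_le l p q \<longrightarrow> p \<noteq> q \<longrightarrow>
           (\<exists>a b \<gamma>. a \<le> b \<and> causal_curve ?Cv l {a..b} \<gamma> \<and>
              \<gamma> ` {a..b} \<subseteq> \<Omega> \<and> \<gamma> a = p \<and> \<gamma> b = q \<and>
              (\<forall>a' b' \<gamma>'. a' \<le> b' \<longrightarrow> causal_curve ?Cv l {a'..b'} \<gamma>' \<longrightarrow>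
                 \<gamma>' ` {a'..b'} \<subseteq> \<Omega> \<longrightarrow> \<gamma>' a' = p \<longrightarrow> \<gamma>' b' = q \<longrightarrow>
                 curve_length l a' b' \<gamma>' \<le> curve_length l a b \<gamma>) \<and>
              curve_length l a b \<gamma> = ennreal (\<omega> p q) \<and>
              ennreal (\<omega> p q) \<le> time_sep l p q)"
      using loc unfolding KS_localizing_def by (elim conjE exE) (rule that; assumption)
    have top: "topspace (subtopology T \<Omega>) = \<Omega>"
      using openin_subset[OF \<Omega>(1)] by auto
    have "openin (prod_topology (subtopology T \<Omega>) (subtopology T \<Omega>))
        {pq \<in> topspace (prod_topology (subtopology T \<Omega>) (subtopology T \<Omega>)). (\<lambda>(p, q). \<omega> p q) pq \<in> {..<1}}"
      using cont by (rule openin_continuous_map_preimage) simp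
    then have "openin (prod_topology (subtopology T \<Omega>) (subtopology T \<Omega>)) {pq \<in> \<Omega> \<times> \<Omega>. (\<lambda>(p, q). \<omega> p q) pq < 1}"
      by (simp only: topspace_prod_topology top lessThan_iff)
    moreover have "(x, x) \<in> {pq \<in> \<Omega> \<times> \<Omega>. (\<lambda>(p, q). \<omega> p q) pq < 1}"
    proof -
      \<comment> \<open>Positivity of \<omega> means being chronologically related, and there are no
        loops.\<close>
      have "\<not> 0 < \<omega> x x"
        using chron \<Omega>(2) chron_irrefl[OF x] by blast
      then show ?thesis
        using \<Omega>(2) by simp
    qed
    ultimately obtain V W where VW: "openin (subtopology T \<Omega>) V" "openin (subtopology T \<Omega>) W" "x \<in> V" "x \<in> W"
      "V \<times> W \<subseteq> {pq \<in> \<Omega> \<times> \<Omega>. (\<lambda>(p, q). \<omega> p q) pq < 1}"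
      unfolding openin_prod_topology_alt by meson
    then have open_VW: "openin T V" "openin T W"
      using \<Omega>(1) openin_trans_full by blast+
    obtain U where U: "openin T U" "x \<in> U"
      "\<And>p q z. \<lbrakk>p \<in> U; q \<in> U; z \<in> topspace T; causal_le l p z; causal_le l z q\<rbrakk> \<Longrightarrow> z \<in> \<Omega>"
      using strongly_causal[OF KS_pre gh \<Omega>] by blast
    have "curve_length l a b \<gamma> \<le> 1"
      if \<gamma>: "a \<le> b" "causal_curve ?Cv l {a..b} \<gamma>" "\<gamma> a \<in> U \<inter> V \<inter> W" "\<gamma> b \<in> U \<inter> V \<inter> W" for a b \<gamma>
    proof (cases "a = b")
      case False
      then have ends: "causal_le l (\<gamma> a) (\<gamma> b)" "\<gamma> a \<noteq> \<gamma> b"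
        using \<gamma>(1,2) unfolding causal_curve_iff by auto
      have "(\<gamma> a, \<gamma> b) \<in> {pq \<in> \<Omega> \<times> \<Omega>. (\<lambda>(p, q). \<omega> p q) pq < 1}"
        using VW(5) \<gamma>(3,4) by blast
      then have \<omega>: "\<gamma> a \<in> \<Omega>" "\<gamma> b \<in> \<Omega>" "\<omega> (\<gamma> a) (\<gamma> b) < 1"
        by auto
      have "\<gamma> t \<in> \<Omega>" if t: "t \<in> {a..b}" for t
      proof (rule U(3))
        show "\<gamma> t \<in> topspace T"
          using \<gamma>(2) t by (rule causal_image)
        show "causal_le l (\<gamma> a) (\<gamma> t)" "causal_le l (\<gamma> t) (\<gamma> b)"
          using causal_curve_le[OF \<gamma>(2)] t by auto
      qed (use \<gamma> in auto)
      then have "\<gamma> ` {a..b} \<subseteq> \<Omega>"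
        by blast
      \<comment> \<open>Comparison with the maximal curve in \<Omega> between the same endpoints,
        whose length is \<omega>.\<close>
      then have "curve_length l a b \<gamma> \<le> ennreal (\<omega> (\<gamma> a) (\<gamma> b))"
        using maximal \<omega>(1,2) ends \<gamma>(1,2) by metis
      also have "\<dots> \<le> 1"
        using \<omega>(3) by (simp add: ennreal_le_1)
      finally show ?thesis .
    qed (simp add: curve_length_self)
    then show "\<exists>U. openin T U \<and> x \<in> U \<and> (\<forall>a b \<gamma>. a \<le> b \<longrightarrow> causal_curve ?Cv l {a..b} \<gamma> \<longrightarrow>
        \<gamma> a \<in> U \<longrightarrow> \<gamma> b \<in> U \<longrightarrow> curve_length l a b \<gamma> \<le> 1)"
      using U VW open_VW by (intro exI[of _ "U \<inter> V \<inter> W"]) (simp add: openin_Int)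
  qed
qed

theorem corollary5p14:
  fixes T :: "'a topology"
    and l :: "'a \<Rightarrow> 'a \<Rightarrow> ereal"
    and Cv :: "'a curve_class"
  assumes "lorentzian_pre_length_space T l"
    and "separable_space T"
    and "(first_countable T \<and> BMS_Lorentzian_length_space T l \<and> compact_causal_diamonds T l \<and>
          empty_bubbling_boundary T l \<and> spacelike_boundary T l = {} \<and>
          timelike_extensions T (continuous_curve T) l \<and> Cv = continuous_curve T)
       \<or> (globally_hyperbolic T l \<and> BM_length_metric_spacetime T l \<and> Cv = continuous_curve T)
       \<or> (globally_hyperbolic T l \<and>
          (\<exists>\<rho>. KS_Lorentzian_length_space T \<rho> l \<and> Cv = locally_Lipschitz_curve T \<rho>))"
  shows "((\<forall>S\<in>strong_Cauchy_sets T Cv l. compactin T S) \<longrightarrow>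
           finite_metric_on (strong_Cauchy_sets T Cv l) (dist_J l)) \<and>
         (timelike_path_connected T Cv l \<and> (\<forall>S\<in>Cauchy_sets T Cv l. compactin T S) \<longrightarrow>
           finite_metric_on (Cauchy_sets T Cv l) (dist_J l)) \<and>
         (timelike_path_connected T Cv l \<and>
          (\<forall>x\<in>topspace T. \<exists>I \<gamma>. Cauchy_complete_timelike_curve Cv l I \<gamma> \<and> x \<in> \<gamma> ` I) \<and>
          (\<forall>S\<in>weak_Cauchy_sets T Cv l. compactin T S) \<longrightarrow>
           finite_metric_on (weak_Cauchy_sets T Cv l) (dist_J l))"
  using assms(3)
proof (elim disjE conjE exE)
  assume BMS: "BMS_Lorentzian_length_space T l" "empty_bubbling_boundary T l"
    "timelike_extensions T (continuous_curve T) l" and Cv: "Cv = continuous_curve T"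
  interpret curve_space T "continuous_curve T" l
    using assms(1,2) BMS by (rule curve_space_BMS)
  show ?thesis
    unfolding Cv by (rule finite_metric_on_Cauchy_sets[OF approximable_BMS[OF BMS(1)] dist_J_finite_BMS[OF BMS(1)]])
next
  assume gh: "globally_hyperbolic T l" and BM: "BM_length_metric_spacetime T l" and Cv: "Cv = continuous_curve T"
  interpret curve_space T "continuous_curve T" l
    using assms(2) BM by (rule curve_space_BM)
  show ?thesis
    unfolding Cv by (rule finite_metric_on_Cauchy_sets[OF approximable_BM[OF BM] dist_J_finite_BM[OF assms(2) gh BM]])
next
  fix \<rho> assume gh: "globally_hyperbolic T l" and KS: "KS_Lorentzian_length_space T \<rho> l"
    and Cv: "Cv = locally_Lipschitz_curve T \<rho>"
  interpret curve_space T "locally_Lipschitz_curve T \<rho>" l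
    using assms(2) gh KS by (rule curve_space_KS)
  show ?thesis
    unfolding Cv by (rule finite_metric_on_Cauchy_sets[OF approximable_KS[OF KS] dist_J_finite_KS[OF assms(2) gh KS]])
qed

end
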